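(* Let $\Lambda$ be the path algebra over a field of the Kronecker quiver (two vertices $1,2$ and two arrows from $1$ to $2$). There is no transitive action of the braid group $B_2$ on two strands (the infinite cyclic group) on the set of all complete signed $\tau$-exceptional sequences in $\mathrm{mod}\,\Lambda$ which factors through the action of the mutation group $M_2$ on the set of all such sequences.
   Context: An action of $B_2$ factors through the action of $M_2$ if it is obtained by composing a group homomorphism $B_2\to M_2$ with the given action of $M_2$. Mutation group. $G_2=\langle\mu_1,\mu_2\mid\mu_1^2=\mu_2^2=e\rangle$ and $M_2=S_2\ltimes G_2$, $S_2=\{1,\sigma\}$, where $S_2$ acts on $G_2$ by $\sigma(\mu_i)=\mu_{\sigma(i)}$ (so $\sigma\mu_1=\mu_2\sigma$, $\sigma\mu_2=\mu_1\sigma$). Basic notions. $\mathrm{mod}\,\Lambda$ is the category of finite-dimensional left modules, $\tau$ its Auslander–Reiten translate; objects are considered up to isomorphism. $\mathcal{C}(\mathrm{mod}\,\Lambda)=\mathrm{mod}\,\Lambda\oplus\mathrm{mod}\,\Lambda[1]\subset D^b(\mathrm{mod}\,\Lambda)$. A module $M$ is $\tau$-rigid if $\mathrm{Hom}(M,\tau M)=0$. A basic object $M\oplus P[1]$ is support $\tau$-rigid if $M$ is a $\tau$-rigid module and $P$ is projective with $\mathrm{Hom}(P,M)=0$; it is support $\tau$-tilting if it has exactly $2$ indecomposable summands. For support $\tau$-rigid $U=M\oplus P[1]$, $J(U)=\{Y\mid \mathrm{Hom}(M\oplus P,Y)=0=\mathrm{Hom}(Y,\tau M)\}$, a wide subcategory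 equivalent to a module category. For indecomposable $U\in\mathcal{C}(\mathrm{mod}\,\Lambda)$, $|U|=U$ if $U$ is a module and $|U|=U[-1]$ otherwise. A complete signed $\tau$-exceptional sequence in $\mathrm{mod}\,\Lambda$ (of length $2$) is a pair $(A_1,A_2)$ of indecomposable objects of $\mathcal{C}(\mathrm{mod}\,\Lambda)$ such that $A_2$ is a $\tau$-rigid module or $A_2=P[1]$ with $P$ projective, and $A_1$ is a $\tau$-rigid object of $J(|A_2|)$, or the shift by $[1]$ of a projective object of $J(|A_2|)$ (both notions taken in the module category $J(|A_2|)$). The $M_2$-action. An ordered support $\tau$-tilting object is a pair $(T_1,T_2)$ of indecomposables with $T_1\oplus T_2$ basic support $\tau$-tilting. $M_2$ acts on these by $\sigma(T_1,T_2)=(T_2,T_1)$, and $\mu_i$ replaces $T_i$ by the unique indecomposable $T_i^*\not\simeq T_i$ for which the result is again an ordered support $\tau$-tilting object. The action of $M_2$ on complete signed $\tau$-exceptional sequences is the transport of this action along the bijection $\psi(T_1,T_2)=(\mathcal{E}_{T_2}(T_1),T_2)$ from ordered support $\tau$-tilting objects to complete signed $\tau$-exceptional sequences. Here, for an indecomposable support $\tau$-rigid $U$, $\mathcal{E}_U$ is the bijection from indecomposable $X\not\simeq U$ with $X\oplus U$ support $\tau$-rigid to indecomposable support $\tau$-rigid objects in $\mathcal{C}(J(U))=J(U)\oplus J(U)[1]$ given as follows, with $f_M(X)=X/t_M(X)$ and $t_M(X)$ the sum of images of maps $M\to X$: (1) if $U=P[1]$, then $\mathcal{E}_U(X)=X$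 for $X$ a module and $\mathcal{E}_U(Q[1])=f_P(Q)[1]$; (2) if $U=M$ is a module, then $\mathcal{E}_U(X)=f_M(X)$ for $X$ a module not generated by $M$, and if $X$ is a module generated by $M$ or $X=Q[1]$, then $\mathcal{E}_U(X)=f_M(H^0(Y))[1]$, where $Y\to\mathbb{P}'\to\mathbb{P}_X\to Y[1]$ is a triangle in $K^b(\mathrm{proj}\,\Lambda)$, $\mathbb{P}_X$ is the minimal projective presentation of $X$ (resp. $Q[1]$), and $\mathbb{P}'\to\mathbb{P}_X$ is a minimal right $\mathrm{add}\,\mathbb{P}_M$-approximation with $\mathbb{P}_M$ the minimal projective presentation of $M$. *)

theory Defs
  imports
    "HOL-Algebra.Sym_Groups"
    "HOL-Algebra.Elementary_Groups"
    "HOL-Algebra.Group_Action"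
    "Graph_Theory.Arc_Walk"
    "Jordan_Normal_Form.Matrix_Kernel"
begin

section \<open>Path algebras\<close>

text \<open>
  A path is a pair of its start vertex and its list of arcs (the trivial path at \<open>v\<close> is
  \<open>(v, [])\<close>), and an element of the path algebra is its coefficient function on paths.
  Paths compose like functions: \<open>p * q\<close> is \<open>q\<close> followed by \<open>p\<close>, so left modules are
  representations of the quiver.  In the product, the coefficient at \<open>(v, es)\<close> sums over the
  ways of cutting \<open>(v, es)\<close> into an initial part \<open>(v, take i es)\<close> and the remaining part.
  A \<open>k\<close>-algebra is given by the library record of a ring with scalar multiplication; the
  library locale \<open>algebra\<close> is not used because it requires commutativity.
\<close>

definition path_algebra ::
  "('v, 'e) pre_digraph \<Rightarrow> ('k::field, 'v \<times> 'e list \<Rightarrow> 'k) module" where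
  "path_algebra Q = \<lparr>
     carrier = {x. finite {p. x p \<noteq> 0} \<and>
                   (\<forall>v es. x (v, es) \<noteq> 0 \<longrightarrow> (\<exists>w. pre_digraph.awalk Q v es w))},
     monoid.mult = (\<lambda>x y (v, es). \<Sum>i\<le>length es.
        x (pre_digraph.awlast Q v (take i es), drop i es) * y (v, take i es)),
     one = (\<lambda>(v, es). if v \<in> verts Q \<and> es = [] then 1 else 0),
     zero = (\<lambda>_. 0),
     add = (\<lambda>x y p. x p + y p),
     smult = (\<lambda>c x p. c * x p)\<rparr>"

definition kronecker_quiver :: "(nat, nat) pre_digraph" where
  "kronecker_quiver = \<lparr>verts = {1, 2}, arcs = {1, 2}, tail = (\<lambda>_. 1), head = (\<lambda>_. 2)\<rparr>"


section \<open>Finite-dimensional left modules\<close>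

text \<open>
  Up to isomorphism a finite-dimensional left module has underlying space \<open>k^n\<close>; it is then
  given by \<open>n\<close> and the matrix by which each algebra element acts.  Values of the action
  outside the carrier of the algebra are irrelevant: isomorphism ignores them.
\<close>

datatype ('k, 'a) lmod = LMod (ldim: nat) (lact: "'a \<Rightarrow> 'k mat")

definition mods :: "('k::field, 'a) module \<Rightarrow> ('k, 'a) lmod set" where
  "mods A = {M.
     (\<forall>a\<in>carrier A. lact M a \<in> carrier_mat (ldim M) (ldim M)) \<and>
     lact M \<one>\<^bsub>A\<^esub> = 1\<^sub>m (ldim M) \<and>
     (\<forall>a\<in>carrier A. \<forall>b\<in>carrier A. lact M (a \<otimes>\<^bsub>A\<^esub> b) = lact M a * lact M b) \<and>
     (\<forall>a\<in>carrier A. \<forall>b\<in>carrier A. lact M (a \<oplus>\<^bsub>A\<^esub> b) = lact M a + lact M b) \<and>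
     (\<forall>c. \<forall>a\<in>carrier A. lact M (c \<odot>\<^bsub>A\<^esub> a) = c \<cdot>\<^sub>m lact M a)}"

definition lhom ::
  "('k::field, 'a) module \<Rightarrow> ('k, 'a) lmod \<Rightarrow> ('k, 'a) lmod \<Rightarrow> 'k mat set" where
  "lhom A M N = {f \<in> carrier_mat (ldim N) (ldim M).
     \<forall>a\<in>carrier A. f * lact M a = lact N a * f}"

definition lhom_zero ::
  "('k::field, 'a) module \<Rightarrow> ('k, 'a) lmod \<Rightarrow> ('k, 'a) lmod \<Rightarrow> bool" where
  "lhom_zero A M N \<longleftrightarrow> lhom A M N = {0\<^sub>m (ldim N) (ldim M)}"

definition liso ::
  "('k::field, 'a) module \<Rightarrow> ('k, 'a) lmod \<Rightarrow> ('k, 'a) lmod \<Rightarrow> bool" where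
  "liso A M N \<longleftrightarrow>
     (\<exists>f\<in>lhom A M N. \<exists>g\<in>lhom A N M. g * f = 1\<^sub>m (ldim M) \<and> f * g = 1\<^sub>m (ldim N))"

definition lzero :: "('k::field, 'a) lmod" where
  "lzero = LMod 0 (\<lambda>_. 0\<^sub>m 0 0)"

definition lsum :: "('k::field, 'a) lmod \<Rightarrow> ('k, 'a) lmod \<Rightarrow> ('k, 'a) lmod" where
  "lsum M N = LMod (ldim M + ldim N)
     (\<lambda>a. four_block_mat (lact M a) (0\<^sub>m (ldim M) (ldim N)) (0\<^sub>m (ldim N) (ldim M)) (lact N a))"

definition mat_image :: "'k::field mat \<Rightarrow> 'k vec set" where
  "mat_image f = (\<lambda>v. f *\<^sub>v v) ` carrier_vec (dim_col f)"

definition mat_surj :: "'k::field mat \<Rightarrow> bool" where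
  "mat_surj f \<longleftrightarrow> mat_image f = carrier_vec (dim_row f)"

definition mat_inj :: "'k::field mat \<Rightarrow> bool" where
  "mat_inj f \<longleftrightarrow> mat_kernel f = {0\<^sub>v (dim_col f)}"

text \<open>\<open>trace A M X\<close> is the sum \<open>t_M(X)\<close> of the images of all maps \<open>M \<rightarrow> X\<close>.\<close>

inductive_set trace ::
  "('k::field, 'a) module \<Rightarrow> ('k, 'a) lmod \<Rightarrow> ('k, 'a) lmod \<Rightarrow> 'k vec set"
  for A :: "('k, 'a) module" and M X :: "('k, 'a) lmod" where
  zero: "0\<^sub>v (ldim X) \<in> trace A M X"
| add: "\<lbrakk>f \<in> lhom A M X; u \<in> carrier_vec (ldim M); w \<in> trace A M X\<rbrakk>
    \<Longrightarrow> f *\<^sub>v u + w \<in> trace A M X"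

definition generated ::
  "('k::field, 'a) module \<Rightarrow> ('k, 'a) lmod \<Rightarrow> ('k, 'a) lmod \<Rightarrow> bool" where
  "generated A M X \<longleftrightarrow> trace A M X = carrier_vec (ldim X)"

text \<open>\<open>is_quotient A X S Q\<close>: the module \<open>Q\<close> is isomorphic to \<open>X / S\<close>.\<close>

definition is_quotient ::
  "('k::field, 'a) module \<Rightarrow> ('k, 'a) lmod \<Rightarrow> 'k vec set \<Rightarrow> ('k, 'a) lmod \<Rightarrow> bool" where
  "is_quotient A X S Q \<longleftrightarrow>
     Q \<in> mods A \<and> (\<exists>p\<in>lhom A X Q. mat_surj p \<and> mat_kernel p = S)"

definition is_torsionfree_quotient ::
  "('k::field, 'a) module \<Rightarrow> ('k, 'a) lmod \<Rightarrow> ('k, 'a) lmod \<Rightarrow> ('k, 'a) lmod \<Rightarrow> bool" where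
  "is_torsionfree_quotient A M X Q \<longleftrightarrow> is_quotient A X (trace A M X) Q"


section \<open>Projectives and the Auslander--Reiten translate\<close>

text \<open>
  The following notions are relative to a full subcategory, given by its set \<open>\<C>\<close> of objects,
  that is either the whole module category or a wide subcategory.  Such a subcategory is
  closed under kernels and cokernels, so that exactness in \<open>\<C>\<close> is exactness in the module
  category and the epimorphisms of \<open>\<C>\<close> are the surjections.
\<close>

definition projective_in ::
  "('k::field, 'a) module \<Rightarrow> ('k, 'a) lmod set \<Rightarrow> ('k, 'a) lmod \<Rightarrow> bool" where
  "projective_in A \<C> P \<longleftrightarrow> P \<in> \<C> \<and>
     (\<forall>X\<in>\<C>. \<forall>Y\<in>\<C>. \<forall>e\<in>lhom A X Y. \<forall>f\<in>lhom A P Y.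
        mat_surj e \<longrightarrow> (\<exists>h\<in>lhom A P X. e * h = f))"

definition progenerator_in ::
  "('k::field, 'a) module \<Rightarrow> ('k, 'a) lmod set \<Rightarrow> ('k, 'a) lmod \<Rightarrow> bool" where
  "progenerator_in A \<C> G \<longleftrightarrow> projective_in A \<C> G \<and> (\<forall>X\<in>\<C>. generated A G X)"

definition right_minimal ::
  "('k::field, 'a) module \<Rightarrow> ('k, 'a) lmod \<Rightarrow> 'k mat \<Rightarrow> bool" where
  "right_minimal A X f \<longleftrightarrow>
     (\<forall>e\<in>lhom A X X. f * e = f \<longrightarrow>
        (\<exists>e'\<in>lhom A X X. e * e' = 1\<^sub>m (ldim X) \<and> e' * e = 1\<^sub>m (ldim X)))"

text \<open>\<open>P1 \<midarrow>p\<rightarrow> P0 \<midarrow>q\<rightarrow> M \<rightarrow> 0\<close> is a minimal projective presentation in \<open>\<C>\<close>.\<close>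

definition min_proj_pres ::
  "('k::field, 'a) module \<Rightarrow> ('k, 'a) lmod set \<Rightarrow> ('k, 'a) lmod \<Rightarrow> ('k, 'a) lmod \<Rightarrow>
   'k mat \<Rightarrow> 'k mat \<Rightarrow> ('k, 'a) lmod \<Rightarrow> bool" where
  "min_proj_pres A \<C> P1 P0 p q M \<longleftrightarrow>
     projective_in A \<C> P1 \<and> projective_in A \<C> P0 \<and>
     p \<in> lhom A P1 P0 \<and> q \<in> lhom A P0 M \<and>
     mat_surj q \<and> mat_kernel q = mat_image p \<and>
     right_minimal A P0 q \<and> right_minimal A P1 p"

definition linear_functionals :: "'k::field mat set \<Rightarrow> ('k mat \<Rightarrow> 'k) set" where
  "linear_functionals V = {\<phi> \<in> extensional V.
     (\<forall>x\<in>V. \<forall>y\<in>V. \<phi> (x + y) = \<phi> x + \<phi> y) \<and> (\<forall>c. \<forall>x\<in>V. \<phi> (c \<cdot>\<^sub>m x) = c * \<phi> x)}"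

text \<open>
  \<open>is_tau A \<C> M T\<close>: \<open>T\<close> is the Auslander--Reiten translate \<open>D Tr M\<close> computed in \<open>\<C>\<close>.
  A progenerator \<open>G\<close> of \<open>\<C>\<close> identifies \<open>\<C>\<close> with the left modules over \<open>\<Gamma> = End(G)^op\<close>
  via \<open>F = Hom(G, -)\<close>, where \<open>e \<in> End(G)\<close> acts on \<open>Hom(G, X)\<close> by \<open>g \<mapsto> g e\<close>.  For a minimal
  projective presentation \<open>p : P1 \<rightarrow> P0\<close> of \<open>M\<close>, applying \<open>Hom(-, \<Gamma>)\<close> to \<open>F p\<close> gives
  \<open>Hom(P0, G) \<rightarrow> Hom(P1, G)\<close>, \<open>h \<mapsto> h p\<close>; its cokernel is \<open>Tr\<close>, and the dual of the cokernel
  consists of the functionals on \<open>Hom(P1, G)\<close> that vanish on the image.  So \<open>T\<close> is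
  the translate iff \<open>F T\<close> is isomorphic, as a \<open>\<Gamma>\<close>-module, to this space of functionals.  For
  \<open>\<C>\<close> the category of all modules and \<open>G\<close> the algebra itself, \<open>F\<close> is the identity and this
  is literally \<open>D Tr\<close>; any other choice of \<open>G\<close> gives an isomorphic \<open>T\<close>.
\<close>

definition is_tau ::
  "('k::field, 'a) module \<Rightarrow> ('k, 'a) lmod set \<Rightarrow> ('k, 'a) lmod \<Rightarrow> ('k, 'a) lmod \<Rightarrow> bool" where
  "is_tau A \<C> M T \<longleftrightarrow> T \<in> \<C> \<and>
     (\<exists>G P1 P0 p q. progenerator_in A \<C> G \<and> min_proj_pres A \<C> P1 P0 p q M \<and>
       (\<exists>\<theta>. bij_betw \<theta> (lhom A G T)
               {\<phi> \<in> linear_functionals (lhom A P1 G). \<forall>h\<in>lhom A P0 G. \<phi> (h * p) = 0} \<and>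
          (\<forall>g\<in>lhom A G T. \<forall>g'\<in>lhom A G T. \<forall>h\<in>lhom A P1 G. \<theta> (g + g') h = \<theta> g h + \<theta> g' h) \<and>
          (\<forall>c. \<forall>g\<in>lhom A G T. \<forall>h\<in>lhom A P1 G. \<theta> (c \<cdot>\<^sub>m g) h = c * \<theta> g h) \<and>
          (\<forall>g\<in>lhom A G T. \<forall>e\<in>lhom A G G. \<forall>h\<in>lhom A P1 G. \<theta> (g * e) h = \<theta> g (e * h))))"

definition tau_rigid_in ::
  "('k::field, 'a) module \<Rightarrow> ('k, 'a) lmod set \<Rightarrow> ('k, 'a) lmod \<Rightarrow> bool" where
  "tau_rigid_in A \<C> M \<longleftrightarrow> M \<in> \<C> \<and> (\<exists>T. is_tau A \<C> M T \<and> lhom_zero A M T)"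


section \<open>The category of modules and shifted modules\<close>

text \<open>
  \<open>CObj M N\<close> stands for the object \<open>M \<oplus> N[1]\<close>.  Since \<open>M\<close> and \<open>N\<close> are the cohomologies of
  this object in degrees 0 and -1, isomorphism in the derived category is componentwise.
\<close>

datatype ('k, 'a) cobj = CObj (mpart: "('k, 'a) lmod") (spart: "('k, 'a) lmod")

definition cobjs :: "('k::field, 'a) module \<Rightarrow> ('k, 'a) cobj set" where
  "cobjs A = {U. mpart U \<in> mods A \<and> spart U \<in> mods A}"

definition ciso ::
  "('k::field, 'a) module \<Rightarrow> ('k, 'a) cobj \<Rightarrow> ('k, 'a) cobj \<Rightarrow> bool" where
  "ciso A U V \<longleftrightarrow> liso A (mpart U) (mpart V) \<and> liso A (spart U) (spart V)"

definition csum :: "('k::field, 'a) cobj \<Rightarrow> ('k, 'a) cobj \<Rightarrow> ('k, 'a) cobj" where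
  "csum U V = CObj (lsum (mpart U) (mpart V)) (lsum (spart U) (spart V))"

definition is_module :: "('k, 'a) cobj \<Rightarrow> bool" where
  "is_module U \<longleftrightarrow> ldim (spart U) = 0"

definition is_shifted :: "('k, 'a) cobj \<Rightarrow> bool" where
  "is_shifted U \<longleftrightarrow> ldim (mpart U) = 0"

definition is_zero :: "('k, 'a) cobj \<Rightarrow> bool" where
  "is_zero U \<longleftrightarrow> is_module U \<and> is_shifted U"

definition indecomposable :: "('k::field, 'a) module \<Rightarrow> ('k, 'a) cobj \<Rightarrow> bool" where
  "indecomposable A U \<longleftrightarrow> U \<in> cobjs A \<and> \<not> is_zero U \<and>
     (\<forall>V\<in>cobjs A. \<forall>W\<in>cobjs A. ciso A U (csum V W) \<longrightarrow> is_zero V \<or> is_zero W)"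

definition basic :: "('k::field, 'a) module \<Rightarrow> ('k, 'a) cobj \<Rightarrow> bool" where
  "basic A U \<longleftrightarrow> U \<in> cobjs A \<and>
     (\<forall>V\<in>cobjs A. \<forall>W\<in>cobjs A. ciso A U (csum (csum V V) W) \<longrightarrow> is_zero V)"

definition support_tau_rigid :: "('k::field, 'a) module \<Rightarrow> ('k, 'a) cobj \<Rightarrow> bool" where
  "support_tau_rigid A U \<longleftrightarrow> basic A U \<and>
     tau_rigid_in A (mods A) (mpart U) \<and> projective_in A (mods A) (spart U) \<and>
     lhom_zero A (spart U) (mpart U)"

text \<open>The number 2 is the number of simple modules, i.e. this is for algebras of rank 2.\<close>

definition support_tau_tilting2 :: "('k::field, 'a) module \<Rightarrow> ('k, 'a) cobj \<Rightarrow> bool" where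
  "support_tau_tilting2 A U \<longleftrightarrow> support_tau_rigid A U \<and>
     (\<exists>U1 U2. indecomposable A U1 \<and> indecomposable A U2 \<and> ciso A U (csum U1 U2))"

definition Jcat :: "('k::field, 'a) module \<Rightarrow> ('k, 'a) cobj \<Rightarrow> ('k, 'a) lmod set" where
  "Jcat A U = {Y \<in> mods A. lhom_zero A (lsum (mpart U) (spart U)) Y \<and>
     (\<exists>T. is_tau A (mods A) (mpart U) T \<and> lhom_zero A Y T)}"

definition cabs :: "('k::field, 'a) cobj \<Rightarrow> ('k, 'a) cobj" where
  "cabs U = (if is_module U then U else CObj (spart U) lzero)"

definition signed_tau_exceptional2 ::
  "('k::field, 'a) module \<Rightarrow> ('k, 'a) cobj \<Rightarrow> ('k, 'a) cobj \<Rightarrow> bool" where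
  "signed_tau_exceptional2 A A1 A2 \<longleftrightarrow>
     indecomposable A A1 \<and> indecomposable A A2 \<and>
     (is_module A2 \<and> tau_rigid_in A (mods A) (mpart A2) \<or>
      is_shifted A2 \<and> projective_in A (mods A) (spart A2)) \<and>
     (is_module A1 \<and> tau_rigid_in A (Jcat A (cabs A2)) (mpart A1) \<or>
      is_shifted A1 \<and> projective_in A (Jcat A (cabs A2)) (spart A1))"

definition ordered_support_tau_tilting2 ::
  "('k::field, 'a) module \<Rightarrow> ('k, 'a) cobj \<Rightarrow> ('k, 'a) cobj \<Rightarrow> bool" where
  "ordered_support_tau_tilting2 A T1 T2 \<longleftrightarrow>
     indecomposable A T1 \<and> indecomposable A T2 \<and> support_tau_tilting2 A (csum T1 T2)"


section \<open>Two-term complexes of projectives\<close>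

text \<open>
  \<open>Cx P1 P0 d\<close> is the complex \<open>d : P1 \<rightarrow> P0\<close> with \<open>P0\<close> in degree 0 and \<open>P1\<close> in degree -1.
  Chain maps are pairs of the components in degrees -1 and 0.
\<close>

datatype ('k, 'a) cx = Cx (cx1: "('k, 'a) lmod") (cx0: "('k, 'a) lmod") (cxd: "'k mat")

definition two_term :: "('k::field, 'a) module \<Rightarrow> ('k, 'a) cx \<Rightarrow> bool" where
  "two_term A C \<longleftrightarrow> projective_in A (mods A) (cx1 C) \<and> projective_in A (mods A) (cx0 C) \<and>
     cxd C \<in> lhom A (cx1 C) (cx0 C)"

definition chain_maps ::
  "('k::field, 'a) module \<Rightarrow> ('k, 'a) cx \<Rightarrow> ('k, 'a) cx \<Rightarrow> ('k mat \<times> 'k mat) set" where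
  "chain_maps A C D = {(f1, f0). f1 \<in> lhom A (cx1 C) (cx1 D) \<and> f0 \<in> lhom A (cx0 C) (cx0 D) \<and>
     f0 * cxd C = cxd D * f1}"

definition homotopic ::
  "('k::field, 'a) module \<Rightarrow> ('k, 'a) cx \<Rightarrow> ('k, 'a) cx \<Rightarrow>
   'k mat \<times> 'k mat \<Rightarrow> 'k mat \<times> 'k mat \<Rightarrow> bool" where
  "homotopic A C D f g \<longleftrightarrow>
     (\<exists>h\<in>lhom A (cx0 C) (cx1 D). fst f - fst g = h * cxd C \<and> snd f - snd g = cxd D * h)"

definition cx_comp ::
  "'k::field mat \<times> 'k mat \<Rightarrow> 'k mat \<times> 'k mat \<Rightarrow> 'k mat \<times> 'k mat" where
  "cx_comp g f = (fst g * fst f, snd g * snd f)"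

definition cx_id :: "('k::field, 'a) cx \<Rightarrow> 'k mat \<times> 'k mat" where
  "cx_id C = (1\<^sub>m (ldim (cx1 C)), 1\<^sub>m (ldim (cx0 C)))"

definition cx_sum :: "('k::field, 'a) cx \<Rightarrow> ('k, 'a) cx \<Rightarrow> ('k, 'a) cx" where
  "cx_sum C D = Cx (lsum (cx1 C) (cx1 D)) (lsum (cx0 C) (cx0 D))
     (four_block_mat (cxd C) (0\<^sub>m (ldim (cx0 C)) (ldim (cx1 D)))
        (0\<^sub>m (ldim (cx0 D)) (ldim (cx1 C))) (cxd D))"

primrec cx_power :: "('k::field, 'a) cx \<Rightarrow> nat \<Rightarrow> ('k, 'a) cx" where
  "cx_power C 0 = Cx lzero lzero (0\<^sub>m 0 0)"
| "cx_power C (Suc n) = cx_sum C (cx_power C n)"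

text \<open>
  Membership in \<open>add C\<close>: being a direct summand, in the homotopy category, of some power of
  \<open>C\<close>.  Every object of \<open>add C\<close> is isomorphic there to a two-term complex.
\<close>

definition in_add :: "('k::field, 'a) module \<Rightarrow> ('k, 'a) cx \<Rightarrow> ('k, 'a) cx \<Rightarrow> bool" where
  "in_add A C D \<longleftrightarrow> two_term A D \<and>
     (\<exists>n. \<exists>i\<in>chain_maps A D (cx_power C n). \<exists>r\<in>chain_maps A (cx_power C n) D.
        homotopic A D D (cx_comp r i) (cx_id D))"

definition min_right_add_approx ::
  "('k::field, 'a) module \<Rightarrow> ('k, 'a) cx \<Rightarrow> ('k, 'a) cx \<Rightarrow> ('k, 'a) cx \<Rightarrow>
   'k mat \<times> 'k mat \<Rightarrow> bool" where
  "min_right_add_approx A C X D f \<longleftrightarrow> in_add A C D \<and> f \<in> chain_maps A D X \<and>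
     (\<forall>W. in_add A C W \<longrightarrow> (\<forall>g\<in>chain_maps A W X.
        \<exists>h\<in>chain_maps A W D. homotopic A W X (cx_comp f h) g)) \<and>
     (\<forall>e\<in>chain_maps A D D. homotopic A D X (cx_comp f e) f \<longrightarrow>
        (\<exists>e'\<in>chain_maps A D D. homotopic A D D (cx_comp e e') (cx_id D) \<and>
                               homotopic A D D (cx_comp e' e) (cx_id D)))"

text \<open>
  The object \<open>Y\<close> completing \<open>f : D \<rightarrow> X\<close> to a triangle \<open>Y \<rightarrow> D \<rightarrow> X \<rightarrow> Y[1]\<close> is the shift by
  -1 of the mapping cone of \<open>f\<close>.  It is
  \<open>D1 \<rightarrow> D0 \<oplus> X1 \<rightarrow> X0\<close> in degrees -1, 0, 1, with differentials \<open>x \<mapsto> (d x, f1 x)\<close> and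
  \<open>(y, z) \<mapsto> f0 y - d z\<close>.  Its cohomology in degree 0 is described up to isomorphism:
  \<open>i : K \<rightarrow> D0 \<oplus> X1\<close> is a kernel of the second differential and \<open>r : K \<rightarrow> H\<close> a surjection
  whose kernel is the image of the first.
\<close>

definition is_H0_cocone ::
  "('k::field, 'a) module \<Rightarrow> ('k, 'a) cx \<Rightarrow> ('k, 'a) cx \<Rightarrow> 'k mat \<times> 'k mat \<Rightarrow>
   ('k, 'a) lmod \<Rightarrow> bool" where
  "is_H0_cocone A D X f H \<longleftrightarrow> H \<in> mods A \<and>
     (let d' = cxd D @\<^sub>r fst f;
          d = four_block_mat (snd f) (- cxd X) (0\<^sub>m 0 (ldim (cx0 D))) (0\<^sub>m 0 (ldim (cx1 X)))
      in \<exists>K\<in>mods A. \<exists>i\<in>lhom A K (lsum (cx0 D) (cx1 X)). \<exists>r\<in>lhom A K H.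
           mat_inj i \<and> mat_image i = mat_kernel d \<and> mat_surj r \<and>
           mat_kernel r = {v \<in> carrier_vec (ldim K). i *\<^sub>v v \<in> mat_image d'})"

definition is_pres_cx ::
  "('k::field, 'a) module \<Rightarrow> ('k, 'a) cobj \<Rightarrow> ('k, 'a) cx \<Rightarrow> bool" where
  "is_pres_cx A X C \<longleftrightarrow>
     (if is_module X then \<exists>q. min_proj_pres A (mods A) (cx1 C) (cx0 C) (cxd C) q (mpart X)
      else C = Cx (spart X) lzero (0\<^sub>m 0 (ldim (spart X))))"


section \<open>From ordered support tau-tilting objects to signed tau-exceptional sequences\<close>

text \<open>
  \<open>is_E A U X Z\<close>: the object \<open>Z\<close> is isomorphic to \<open>\<E>_U(X)\<close>.  It is only used for
  indecomposable \<open>U\<close> and \<open>X\<close>, each of which is therefore a module or a shifted module.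
\<close>

definition is_E ::
  "('k::field, 'a) module \<Rightarrow> ('k, 'a) cobj \<Rightarrow> ('k, 'a) cobj \<Rightarrow> ('k, 'a) cobj \<Rightarrow> bool" where
  "is_E A U X Z \<longleftrightarrow>
     (if is_shifted U then
        (if is_module X then ciso A X Z
         else is_shifted Z \<and> is_torsionfree_quotient A (spart U) (spart X) (spart Z))
      else if is_module X \<and> \<not> generated A (mpart U) (mpart X) then
        is_module Z \<and> is_torsionfree_quotient A (mpart U) (mpart X) (mpart Z)
      else is_shifted Z \<and>
        (\<exists>CU CX D f H. is_pres_cx A U CU \<and> is_pres_cx A X CX \<and>
           min_right_add_approx A CU CX D f \<and> is_H0_cocone A D CX f H \<and>
           is_torsionfree_quotient A (mpart U) H (spart Z)))"

definition iso_class :: "('k::field, 'a) module \<Rightarrow> ('k, 'a) cobj \<Rightarrow> ('k, 'a) cobj set" where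
  "iso_class A U = {V \<in> cobjs A. ciso A U V}"

definition OST ::
  "('k::field, 'a) module \<Rightarrow> (('k, 'a) cobj set \<times> ('k, 'a) cobj set) set" where
  "OST A = {(iso_class A T1, iso_class A T2) | T1 T2. ordered_support_tau_tilting2 A T1 T2}"

definition CSES ::
  "('k::field, 'a) module \<Rightarrow> (('k, 'a) cobj set \<times> ('k, 'a) cobj set) set" where
  "CSES A = {(iso_class A A1, iso_class A A2) | A1 A2. signed_tau_exceptional2 A A1 A2}"

definition psi ::
  "('k::field, 'a) module \<Rightarrow> ('k, 'a) cobj set \<times> ('k, 'a) cobj set \<Rightarrow>
   ('k, 'a) cobj set \<times> ('k, 'a) cobj set" where
  "psi A = (\<lambda>(c, d). ({Z \<in> cobjs A. \<exists>X\<in>c. \<exists>U\<in>d. is_E A U X Z}, d))"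


section \<open>The mutation group and its action\<close>

text \<open>
  \<open>G2\<close> is the group presented by generators \<open>\<mu>_1\<close>, \<open>\<mu>_2\<close> and relations \<open>\<mu>_i^2 = e\<close>, in normal
  form: \<open>[i1, \<dots>, in]\<close> is \<open>\<mu>_i1 \<dots> \<mu>_in\<close>, and each element has a unique such word without equal
  adjacent letters.
\<close>

fun mu_cons :: "nat \<Rightarrow> nat list \<Rightarrow> nat list" where
  "mu_cons i [] = [i]"
| "mu_cons i (j # w) = (if i = j then w else i # j # w)"

definition G2 :: "nat list monoid" where
  "G2 = \<lparr>carrier = {w. set w \<subseteq> {1, 2} \<and> distinct_adj w},
         monoid.mult = (\<lambda>v w. foldr mu_cons v w), one = []\<rparr>"

text \<open>
  The pair \<open>(s, w)\<close> is the product \<open>s w\<close> in the semidirect product, in which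
  \<open>s \<mu>_i = \<mu>_s(i) s\<close>; hence \<open>(s v) (t w) = (s t) (t^-1(v) w)\<close>.
\<close>

definition M2 :: "((nat \<Rightarrow> nat) \<times> nat list) monoid" where
  "M2 = \<lparr>carrier = carrier (sym_group 2) \<times> carrier G2,
         monoid.mult = (\<lambda>(s, v) (t, w).
           (s \<otimes>\<^bsub>sym_group 2\<^esub> t, map (inv\<^bsub>sym_group 2\<^esub> t) v \<otimes>\<^bsub>G2\<^esub> w)),
         one = (\<one>\<^bsub>sym_group 2\<^esub>, \<one>\<^bsub>G2\<^esub>)\<rparr>"

text \<open>
  The new entry is the set of all objects \<open>X\<close> outside the class of \<open>T_i\<close> for which replacing
  \<open>T_i\<close> by \<open>X\<close> gives an ordered support tau-tilting object again; as the exchange partner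
  \<open>T_i^*\<close> is unique up to isomorphism, this set is the isomorphism class of \<open>T_i^*\<close>.
\<close>

definition mutate ::
  "('k::field, 'a) module \<Rightarrow> nat \<Rightarrow> ('k, 'a) cobj set \<times> ('k, 'a) cobj set \<Rightarrow>
   ('k, 'a) cobj set \<times> ('k, 'a) cobj set" where
  "mutate A i = (\<lambda>(c, d).
     if i = 1 then ({X \<in> cobjs A. X \<notin> c \<and> (iso_class A X, d) \<in> OST A}, d)
     else (c, {X \<in> cobjs A. X \<notin> d \<and> (c, iso_class A X) \<in> OST A}))"

definition M2_act_OST ::
  "('k::field, 'a) module \<Rightarrow> (nat \<Rightarrow> nat) \<times> nat list \<Rightarrow>
   ('k, 'a) cobj set \<times> ('k, 'a) cobj set \<Rightarrow> ('k, 'a) cobj set \<times> ('k, 'a) cobj set" where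
  "M2_act_OST A = (\<lambda>(s, w) T.
     if s = id then foldr (mutate A) w T else prod.swap (foldr (mutate A) w T))"

definition M2_act_CSES ::
  "('k::field, 'a) module \<Rightarrow> (nat \<Rightarrow> nat) \<times> nat list \<Rightarrow>
   ('k, 'a) cobj set \<times> ('k, 'a) cobj set \<Rightarrow> ('k, 'a) cobj set \<times> ('k, 'a) cobj set" where
  "M2_act_CSES A g S = psi A (M2_act_OST A g (inv_into (OST A) (psi A) S))"

text \<open>The braid group on two strands is the infinite cyclic group.\<close>

abbreviation B2 :: "int monoid" where
  "B2 \<equiv> integer_group"

definition factors_through_M2 ::
  "('k::field, 'a) module \<Rightarrow>
   (int \<Rightarrow> ('k, 'a) cobj set \<times> ('k, 'a) cobj set \<Rightarrow> ('k, 'a) cobj set \<times> ('k, 'a) cobj set) \<Rightarrow>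
   bool" where
  "factors_through_M2 A \<beta> \<longleftrightarrow>
     (\<exists>\<phi>\<in>hom B2 M2. \<forall>z\<in>carrier B2. \<forall>S\<in>CSES A. \<beta> z S = M2_act_CSES A (\<phi> z) S)"

end

theory Submission
  imports Defs "Jordan_Normal_Form.DL_Rank"
begin

text \<open>
  The group \<open>M2\<close> is infinite dihedral and its action on ordered support tau-tilting objects has
  no reflection with a fixed point: every reflection is conjugate to the transposition, which
  moves \<open>(T1, T2)\<close> because \<open>T1\<close> and \<open>T2\<close> are not isomorphic, or to a mutation, which replaces an entry.
  If the generator of \<open>B2\<close> maps to a reflection, its square acts trivially and orbits have at most
  two elements, but there are three sequences.  Otherwise the image consists of rotations.  Let
  \<open>P\<close> be the projective with dimension vector (1,2) and \<open>S\<close> the simple projective.  Transitivity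
  gives a rotation that takes the sequence \<open>(S, P[1])\<close> to \<open>(S[1], P[1])\<close>.  Since \<open>S\<close> and \<open>S[1]\<close> are
  the only complements of \<open>P[1]\<close>, this rotation sends the ordered support tau-tilting object
  \<open>(S, P[1])\<close> to \<open>(S[1], P[1])\<close>.  So does the mutation at the first entry, and the two together
  give a reflection with a fixed point.
\<close>

section \<open>Matrices\<close>

text \<open>\<open>mutate\<close> returns a set of objects, which is an isomorphism class only where
  the exchange partner exists and is unique, and \<open>M2_act_CSES\<close> inverts
  \<open>psi\<close> by a choice. Both points are settled locally, at the objects with summand P[1],
  and backwards: the pair reached by a word is recognised at the end of the word, and since a
  mutation leaves one entry alone, membership in \<open>OST\<close> propagates back towards the
  start. P[1] is chosen because its complements can be found by elementary means: a module
  complement X satisfies Hom(P, X) = 0, hence is a power of S, and a shifted complement is a shifted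
  projective. Every translate to be computed is that of a projective, so it is zero, and
  \<open>psi\<close> at P[1] stays in the case of a shifted \<open>U\<close>, where it is the
  identity on modules and sends shifted objects to shifted ones. The three sequences for the orbit
  bound all come from the one category J(P), because P and P[1] have the same underlying
  module.\<close>

lemma mat_mult_unit_vec:
  fixes A :: "'k::field mat"
  assumes "A \<in> carrier_mat n m" "j < m"
  shows "A *\<^sub>v unit_vec m j = col A j"
proof (rule eq_vecI)
  fix i assume "i < dim_vec (col A j)"
  then have "i < n" using assms by simp
  moreover have "row A i \<bullet> unit_vec m j = row A i $ j"
    using assms by (intro scalar_prod_right_unit)
  ultimately show "(A *\<^sub>v unit_vec m j) $ i = col A j $ i" using assms by simp
qed (use assms in auto)

lemma eq_mat_by_vecI:
  fixes A B :: "'k::field mat"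
  assumes A: "A \<in> carrier_mat n m" and B: "B \<in> carrier_mat n m"
    and eq: "\<And>v. v \<in> carrier_vec m \<Longrightarrow> A *\<^sub>v v = B *\<^sub>v v"
  shows "A = B"
proof (rule mat_col_eqI)
  fix j assume "j < dim_col B"
  then have "j < m" using B by simp
  then show "col A j = col B j"
    using eq[of "unit_vec m j"] mat_mult_unit_vec[OF A] mat_mult_unit_vec[OF B] by simp
qed (use A B in auto)

lemma minus_vec_eq_zeroD:
  fixes x y :: "'k::field vec"
  assumes x: "x \<in> carrier_vec n" and y: "y \<in> carrier_vec n" and xy: "x - y = 0\<^sub>v n"
  shows "x = y"
proof (rule eq_vecI)
  fix i assume "i < dim_vec y"
  then have "i < n" using y by simp
  then show "x $ i = y $ i" using arg_cong[OF xy, of "\<lambda>v. v $ i"] x y by simp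
qed (use x y in simp)

lemma mat_left_cancel:
  fixes s A B :: "'k::field mat"
  assumes s: "s \<in> carrier_mat n r" and A: "A \<in> carrier_mat r m" and B: "B \<in> carrier_mat r m"
    and inj: "\<And>v. v \<in> carrier_vec r \<Longrightarrow> s *\<^sub>v v = 0\<^sub>v n \<Longrightarrow> v = 0\<^sub>v r"
    and eq: "s * A = s * B"
  shows "A = B"
proof (rule eq_mat_by_vecI[OF A B])
  fix v :: "'k vec" assume v: "v \<in> carrier_vec m"
  have Av: "A *\<^sub>v v \<in> carrier_vec r" and Bv: "B *\<^sub>v v \<in> carrier_vec r" using A B v by auto
  have "s *\<^sub>v (A *\<^sub>v v) = s *\<^sub>v (B *\<^sub>v v)"
    using eq assoc_mult_mat_vec[OF s A v] assoc_mult_mat_vec[OF s B v] by metis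
  then have "s *\<^sub>v (A *\<^sub>v v - B *\<^sub>v v) = 0\<^sub>v n"
    using mult_minus_distrib_mat_vec[OF s Av Bv] s Bv by (simp add: minus_cancel_vec)
  then have "A *\<^sub>v v - B *\<^sub>v v = 0\<^sub>v r" using Av Bv by (intro inj) auto
  then show "A *\<^sub>v v = B *\<^sub>v v" by (rule minus_vec_eq_zeroD[OF Av Bv])
qed

text \<open>The columns of \<open>s\<close> are a maximal linearly independent set of columns of
  \<open>f\<close>, \<open>h\<close> holds the coordinates of all columns in this basis, and
  \<open>J\<close> selects the chosen columns. The equation \<open>s = f * J\<close> places the
  image of \<open>s\<close> inside that of \<open>f\<close>, which the splitting of idempotents
  uses.\<close>

lemma rank_factorization:
  fixes f :: "'k::field mat"
  assumes f: "f \<in> carrier_mat n m"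
  obtains r s h J where "s \<in> carrier_mat n r" "h \<in> carrier_mat r m" "J \<in> carrier_mat m r"
    "f = s * h" "s = f * J" "\<And>v. v \<in> carrier_vec r \<Longrightarrow> s *\<^sub>v v = 0\<^sub>v n \<Longrightarrow> v = 0\<^sub>v r"
proof -
  interpret vec_space "TYPE('k)" n .
  have fin: "finite (set (cols f))" by simp
  have cf: "set (cols f) \<subseteq> carrier_vec n" using f cols_dim by blast
  have "lin_indpt {}" by (rule finite_lin_indpt2) auto
  then obtain S where S: "maximal S (\<lambda>T. T \<subseteq> set (cols f) \<and> lin_indpt T)" "finite S"
    using maximal_exists_superset[of "set (cols f)" "\<lambda>T. T \<subseteq> set (cols f) \<and> lin_indpt T" "{}"]
    by blast
  from S(2) obtain ss where ss: "set ss = S" "distinct ss"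
    using finite_distinct_list by blast
  have sub: "S \<subseteq> set (cols f)" and li: "lin_indpt S" using S(1) by (auto simp: maximal_def)
  define s where "s = mat_of_cols n ss"
  define r where "r = length ss"
  have s: "s \<in> carrier_mat n r" by (simp add: s_def r_def)
  have cs: "cols s = ss" unfolding s_def using sub ss cf by (intro cols_mat_of_cols) blast
  have inj: "v = 0\<^sub>v r" if "v \<in> carrier_vec r" "s *\<^sub>v v = 0\<^sub>v n" for v
    using lin_depI[OF s that(1) _ that(2)] li ss cs by auto
  have ex: "\<exists>a\<in>carrier_vec r. s *\<^sub>v a = col f j" if j: "j < m" for j
  proof -
    have cj: "col f j \<in> set (cols f)" using f j by (auto simp: cols_def)
    have "col f j \<in> span S"
    proof (cases "col f j \<in> S")
      case True then show ?thesis using in_own_span sub cf by blast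
    next
      case False
      have "lin_dep (S \<union> {col f j})"
      proof (rule ccontr)
        assume "\<not> lin_dep (S \<union> {col f j})"
        then have "S \<union> {col f j} = S" using S(1) sub cj by (auto simp: maximal_def)
        then show False using False by blast
      qed
      then show ?thesis
        using lin_dep_iff_in_span[of S "col f j"] sub cf cj li False by auto
    qed
    then obtain a where a: "lincomb a S = col f j"
      using finite_in_span[OF S(2)] sub cf by force
    then have "s *\<^sub>v vec r (\<lambda>i. a (col s i)) = col f j"
      using mat_mult_eq_lincomb[OF s, of a] cs ss by simp
    then show ?thesis by (intro bexI) auto
  qed
  then obtain a where a: "\<And>j. j < m \<Longrightarrow> a j \<in> carrier_vec r \<and> s *\<^sub>v a j = col f j" by metis
  define h where "h = mat_of_cols r (map a [0..<m])"
  have h: "h \<in> carrier_mat r m" by (auto simp: h_def)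
  have fsh: "f = s * h"
  proof (rule mat_col_eqI)
    fix j assume "j < dim_col (s * h)"
    then have j: "j < m" using h by simp
    have "col h j = a j" unfolding h_def using a[OF j] j by (subst col_mat_of_cols) auto
    then show "col f j = col (s * h) j" using a[OF j] col_mult2[OF s h j] by simp
  qed (use f s h in auto)
  have "\<exists>p<m. col s i = col f p" if i: "i < r" for i
  proof -
    have "col s i \<in> set (cols f)"
      using sub ss cs i s by (metis cols_length carrier_matD(2) cols_nth nth_mem subsetD)
    then show ?thesis using f by (auto simp: cols_def)
  qed
  then obtain p where p: "\<And>i. i < r \<Longrightarrow> p i < m \<and> col s i = col f (p i)" by metis
  define J :: "'k mat" where "J = mat_of_cols m (map (\<lambda>i. unit_vec m (p i)) [0..<r])"
  have J: "J \<in> carrier_mat m r" by (auto simp: J_def)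
  have "s = f * J"
  proof (rule mat_col_eqI)
    fix j assume "j < dim_col (f * J)"
    then have j: "j < r" using J by simp
    have "col J j = unit_vec m (p j)" unfolding J_def using j by (subst col_mat_of_cols) auto
    then show "col s j = col (f * J) j"
      using col_mult2[OF f J j] mat_mult_unit_vec[OF f] p[OF j] by simp
  qed (use f s J in auto)
  then show ?thesis using that s h J fsh inj by blast
qed

text \<open>An idempotent fixes its image, so \<open>f * s = s\<close>; this reads
  \<open>s * (h * s) = s\<close>, and the injective factor \<open>s\<close> cancels.\<close>

lemma idempotent_splitting:
  fixes f :: "'k::field mat"
  assumes f: "f \<in> carrier_mat n n" and ff: "f * f = f"
  obtains r s h where "s \<in> carrier_mat n r" "h \<in> carrier_mat r n" "f = s * h" "h * s = 1\<^sub>m r"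
proof -
  obtain r s h J where s: "s \<in> carrier_mat n r" and h: "h \<in> carrier_mat r n" and J: "J \<in> carrier_mat n r"
    and fsh: "f = s * h" and sfJ: "s = f * J"
    and inj: "\<And>v. v \<in> carrier_vec r \<Longrightarrow> s *\<^sub>v v = 0\<^sub>v n \<Longrightarrow> v = 0\<^sub>v r"
    using rank_factorization[OF f] by metis
  have fs: "f * s = s" using ff sfJ assoc_mult_mat[OF f f J] by simp
  have "h * s = 1\<^sub>m r"
  proof (rule mat_left_cancel[OF s _ _ inj])
    show "s * (h * s) = s * 1\<^sub>m r" using fs fsh s assoc_mult_mat[OF s h s] by simp
  qed (use s h in auto)
  then show ?thesis using that s h fsh by blast
qed

section \<open>Modules and direct sums\<close>

lemma modsD:
  assumes "M \<in> mods A"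
  shows "a \<in> carrier A \<Longrightarrow> lact M a \<in> carrier_mat (ldim M) (ldim M)"
    "lact M \<one>\<^bsub>A\<^esub> = 1\<^sub>m (ldim M)"
    "a \<in> carrier A \<Longrightarrow> b \<in> carrier A \<Longrightarrow> lact M (a \<otimes>\<^bsub>A\<^esub> b) = lact M a * lact M b"
    "a \<in> carrier A \<Longrightarrow> b \<in> carrier A \<Longrightarrow> lact M (a \<oplus>\<^bsub>A\<^esub> b) = lact M a + lact M b"
    "a \<in> carrier A \<Longrightarrow> lact M (c \<odot>\<^bsub>A\<^esub> a) = c \<cdot>\<^sub>m lact M a"
  using assms by (auto simp: mods_def)

lemma lhomD:
  assumes "f \<in> lhom A M N"
  shows "f \<in> carrier_mat (ldim N) (ldim M)" "a \<in> carrier A \<Longrightarrow> f * lact M a = lact N a * f"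
  using assms by (auto simp: lhom_def)

lemma lhomI:
  assumes "f \<in> carrier_mat (ldim N) (ldim M)" "\<And>a. a \<in> carrier A \<Longrightarrow> f * lact M a = lact N a * f"
  shows "f \<in> lhom A M N"
  using assms by (auto simp: lhom_def)

text \<open>Side conditions on \<open>dim_row\<close> and \<open>dim_col\<close> make the matrix
  laws usable as rewrite rules; the carrier versions contain dimensions that the simplifier cannot
  guess.\<close>

lemma mult_mat_assoc:
  "dim_col A = dim_row B \<Longrightarrow> dim_col B = dim_row C \<Longrightarrow> A * B * C = A * (B * C)"
  for A B C :: "'k::field mat"
  by (rule assoc_mult_mat[OF carrier_matI carrier_matI carrier_matI]) auto

lemma mult_mat_add_left:
  "dim_row A = dim_row B \<Longrightarrow> dim_col A = dim_col B \<Longrightarrow> dim_col B = dim_row C \<Longrightarrow> (A + B) * C = A * C + B * C"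
  for A B C :: "'k::field mat"
  by (rule add_mult_distrib_mat[OF carrier_matI carrier_matI carrier_matI]) auto

lemma mult_mat_add_right:
  "dim_row B = dim_row C \<Longrightarrow> dim_col B = dim_col C \<Longrightarrow> dim_col A = dim_row B \<Longrightarrow> A * (B + C) = A * B + A * C"
  for A B C :: "'k::field mat"
  by (rule mult_add_distrib_mat[OF carrier_matI carrier_matI carrier_matI]) auto

lemma mult_mat_smult:
  fixes A B :: "'k::field mat"
  assumes "dim_col A = dim_row B"
  shows "(c \<cdot>\<^sub>m A) * B = c \<cdot>\<^sub>m (A * B)" "A * (c \<cdot>\<^sub>m B) = c \<cdot>\<^sub>m (A * B)"
proof -
  have c: "A \<in> carrier_mat (dim_row A) (dim_col A)" "B \<in> carrier_mat (dim_col A) (dim_col B)"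
    using assms by auto
  show "(c \<cdot>\<^sub>m A) * B = c \<cdot>\<^sub>m (A * B)" "A * (c \<cdot>\<^sub>m B) = c \<cdot>\<^sub>m (A * B)"
    using mult_smult_assoc_mat[OF c] mult_smult_distrib[OF c] by auto
qed

lemmas mult_mat_simps = mult_mat_assoc mult_mat_add_left mult_mat_add_right mult_mat_smult

lemma lhom_comp:
  assumes M: "M \<in> mods A" and N: "N \<in> mods A" and P: "P \<in> mods A"
    and f: "f \<in> lhom A M N" and g: "g \<in> lhom A N P"
  shows "g * f \<in> lhom A M P"
proof (rule lhomI)
  fix a assume a: "a \<in> carrier A"
  note d [simp] = carrier_matD[OF lhomD(1)[OF f]] carrier_matD[OF lhomD(1)[OF g]] carrier_matD[OF modsD(1)[OF M a]]
    carrier_matD[OF modsD(1)[OF N a]] carrier_matD[OF modsD(1)[OF P a]]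
  have "g * f * lact M a = g * (lact N a * f)"
    using lhomD(2)[OF f a] by (simp add: mult_mat_assoc)
  also have "\<dots> = lact P a * (g * f)"
    using lhomD(2)[OF g a] by (simp flip: mult_mat_assoc)
  finally show "g * f * lact M a = lact P a * (g * f)" .
qed (use lhomD(1)[OF f] lhomD(1)[OF g] in auto)

lemma lhom_id: "M \<in> mods A \<Longrightarrow> 1\<^sub>m (ldim M) \<in> lhom A M M"
  by (rule lhomI) (auto dest!: modsD(1))

lemma lhom_zero_map:
  assumes "M \<in> mods A" "N \<in> mods A"
  shows "0\<^sub>m (ldim N) (ldim M) \<in> lhom A M N"
proof (rule lhomI)
  fix a assume a: "a \<in> carrier A"
  show "0\<^sub>m (ldim N) (ldim M) * lact M a = lact N a * 0\<^sub>m (ldim N) (ldim M)"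
    using modsD(1)[OF assms(1) a] modsD(1)[OF assms(2) a] by simp
qed simp

lemma lhom_add:
  assumes M: "M \<in> mods A" and N: "N \<in> mods A" and f: "f \<in> lhom A M N" and g: "g \<in> lhom A M N"
  shows "f + g \<in> lhom A M N"
proof (rule lhomI)
  fix a assume a: "a \<in> carrier A"
  note d [simp] = carrier_matD[OF lhomD(1)[OF f]] carrier_matD[OF lhomD(1)[OF g]] carrier_matD[OF modsD(1)[OF M a]]
    carrier_matD[OF modsD(1)[OF N a]]
  show "(f + g) * lact M a = lact N a * (f + g)"
    using lhomD(2)[OF f a] lhomD(2)[OF g a] by (simp add: mult_mat_simps)
qed (use lhomD(1)[OF f] lhomD(1)[OF g] in auto)

lemma lhom_smult:
  assumes M: "M \<in> mods A" and N: "N \<in> mods A" and f: "f \<in> lhom A M N"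
  shows "c \<cdot>\<^sub>m f \<in> lhom A M N"
proof (rule lhomI)
  fix a assume a: "a \<in> carrier A"
  note d [simp] = carrier_matD[OF lhomD(1)[OF f]] carrier_matD[OF modsD(1)[OF M a]] carrier_matD[OF modsD(1)[OF N a]]
  show "c \<cdot>\<^sub>m f * lact M a = lact N a * (c \<cdot>\<^sub>m f)"
    using lhomD(2)[OF f a] by (simp add: mult_mat_simps)
qed (use lhomD(1)[OF f] in auto)

lemma lhom_vec:
  assumes "f \<in> lhom A M N" "M \<in> mods A" "N \<in> mods A" "a \<in> carrier A" "v \<in> carrier_vec (ldim M)"
  shows "f *\<^sub>v (lact M a *\<^sub>v v) = lact N a *\<^sub>v (f *\<^sub>v v)"
  using lhomD[OF assms(1)] modsD(1)[OF assms(2,4)] modsD(1)[OF assms(3,4)] assms(4,5)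
  by (metis assoc_mult_mat_vec)

lemma liso_refl: "M \<in> mods A \<Longrightarrow> liso A M M"
  using lhom_id[of M A] by (force simp: liso_def)

lemma liso_sym: "liso A M N \<Longrightarrow> liso A N M"
  by (auto simp: liso_def)

lemma mult_mat_inverse_comp:
  fixes f g f' g' :: "'k::field mat"
  assumes c: "f \<in> carrier_mat n m" "f' \<in> carrier_mat m n" "g \<in> carrier_mat p n" "g' \<in> carrier_mat n p"
    and "f' * f = 1\<^sub>m m" "g' * g = 1\<^sub>m n"
  shows "(f' * g') * (g * f) = 1\<^sub>m m"
proof -
  note [simp] = carrier_matD[OF c(1)] carrier_matD[OF c(2)] carrier_matD[OF c(3)] carrier_matD[OF c(4)]
  have "(f' * g') * (g * f) = f' * ((g' * g) * f)" by (simp add: mult_mat_assoc)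
  also have "\<dots> = 1\<^sub>m m" using assms by simp
  finally show ?thesis .
qed

lemma liso_trans:
  assumes "M \<in> mods A" "N \<in> mods A" "P \<in> mods A" "liso A M N" "liso A N P"
  shows "liso A M P"
proof -
  obtain f f' g g' where f: "f \<in> lhom A M N" "f' \<in> lhom A N M" "f' * f = 1\<^sub>m (ldim M)" "f * f' = 1\<^sub>m (ldim N)"
    and g: "g \<in> lhom A N P" "g' \<in> lhom A P N" "g' * g = 1\<^sub>m (ldim N)" "g * g' = 1\<^sub>m (ldim P)"
    using assms(4,5) by (auto simp: liso_def)
  note c = lhomD(1)[OF f(1)] lhomD(1)[OF f(2)] lhomD(1)[OF g(1)] lhomD(1)[OF g(2)]
  have "f' * g' * (g * f) = 1\<^sub>m (ldim M)" "g * f * (f' * g') = 1\<^sub>m (ldim P)"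
    using mult_mat_inverse_comp[OF c f(3) g(3)] mult_mat_inverse_comp[OF c(4,3,2,1) g(4) f(4)] by auto
  then show ?thesis using lhom_comp[OF assms(1-3) f(1) g(1)] lhom_comp[OF assms(3,2,1) g(2) f(2)]
    by (auto simp: liso_def)
qed

lemma one_eq_zero_mat:
  assumes "1\<^sub>m n = (0\<^sub>m n n :: 'k::field mat)"
  shows "n = 0"
proof (rule ccontr)
  assume "n \<noteq> 0"
  then show False using arg_cong[OF assms, of "\<lambda>m. m $$ (0,0)"] by simp
qed

lemma mult_mat_inner_0:
  fixes f g :: "'k::field mat"
  assumes "f \<in> carrier_mat n 0" "g \<in> carrier_mat 0 m"
  shows "f * g = 0\<^sub>m n m"
  using assms by (intro eq_matI) (auto simp: scalar_prod_def)

lemma liso_ldim_0: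
  fixes M N :: "('k::field, 'a) lmod"
  assumes "liso A M N" "ldim M = 0"
  shows "ldim N = 0"
proof -
  obtain f g where f: "f \<in> lhom A M N" "g \<in> lhom A N M" "f * g = 1\<^sub>m (ldim N)"
    using assms(1) by (auto simp: liso_def)
  have "f * g = 0\<^sub>m (ldim N) (ldim N)"
    using lhomD(1)[OF f(1)] lhomD(1)[OF f(2)] assms(2) by (intro mult_mat_inner_0) auto
  then have "1\<^sub>m (ldim N) = (0\<^sub>m (ldim N) (ldim N) :: 'k mat)" using f(3) by simp
  then show ?thesis by (rule one_eq_zero_mat)
qed

lemma liso_ldim_0_iff: "liso A M N \<Longrightarrow> ldim M = 0 \<longleftrightarrow> ldim N = 0"
  using liso_ldim_0 liso_sym by blast

lemma lzero_mods: "lzero \<in> mods A"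
  by (auto simp: mods_def lzero_def)

lemma ldim_lzero [simp]: "ldim lzero = 0"
  by (simp add: lzero_def)

lemma liso_ldim_zero:
  assumes "M \<in> mods A" "N \<in> mods A" "ldim M = 0" "ldim N = 0"
  shows "liso A M N"
  using lhom_zero_map[OF assms(1,2)] lhom_zero_map[OF assms(2,1)] assms
  by (auto simp: liso_def intro!: bexI[of _ "0\<^sub>m 0 0"])

lemma four_block_mult:
  fixes A1 B1 C1 D1 A2 B2 C2 D2 A B C D :: "'k::field mat"
  assumes "A1 \<in> carrier_mat nr1 n1" "B1 \<in> carrier_mat nr1 n2" "C1 \<in> carrier_mat nr2 n1" "D1 \<in> carrier_mat nr2 n2"
    "A2 \<in> carrier_mat n1 nc1" "B2 \<in> carrier_mat n1 nc2" "C2 \<in> carrier_mat n2 nc1" "D2 \<in> carrier_mat n2 nc2"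
    "A1 * A2 + B1 * C2 = A" "A1 * B2 + B1 * D2 = B" "C1 * A2 + D1 * C2 = C" "C1 * B2 + D1 * D2 = D"
  shows "four_block_mat A1 B1 C1 D1 * four_block_mat A2 B2 C2 D2 = four_block_mat A B C D"
  using mult_four_block_mat[OF assms(1-8)] assms(9-12) by simp

lemma lsum_mods:
  assumes M: "M \<in> mods A" and N: "N \<in> mods A"
  shows "lsum M N \<in> mods A"
proof -
  let ?m = "ldim M" and ?n = "ldim N"
  have act: "lact (lsum M N) a = four_block_mat (lact M a) (0\<^sub>m ?m ?n) (0\<^sub>m ?n ?m) (lact N a)" for a
    by (simp add: lsum_def)
  have dim: "ldim (lsum M N) = ?m + ?n" by (simp add: lsum_def)
  have "lact (lsum M N) (a \<otimes>\<^bsub>A\<^esub> b) = lact (lsum M N) a * lact (lsum M N) b"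
    if a: "a \<in> carrier A" and b: "b \<in> carrier A" for a b
  proof -
    note c = modsD(1)[OF M a] modsD(1)[OF N a] modsD(1)[OF M b] modsD(1)[OF N b]
    note [simp] = c c[THEN carrier_matD(1)] c[THEN carrier_matD(2)]
    have "lact M a * lact M b \<in> carrier_mat ?m ?m" "lact N a * lact N b \<in> carrier_mat ?n ?n"
      by (auto intro: mult_carrier_mat)
    then show ?thesis unfolding act modsD(3)[OF M a b] modsD(3)[OF N a b]
      by (intro four_block_mult[of _ ?m ?m _ ?n _ ?n _ _ ?m _ ?n, symmetric]) simp_all
  qed
  moreover have "lact (lsum M N) (a \<oplus>\<^bsub>A\<^esub> b) = lact (lsum M N) a + lact (lsum M N) b"
    if a: "a \<in> carrier A" and b: "b \<in> carrier A" for a b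
    unfolding act modsD(4)[OF M a b] modsD(4)[OF N a b]
    by (subst add_four_block_mat[OF modsD(1)[OF M a] zero_carrier_mat zero_carrier_mat modsD(1)[OF N a]
          modsD(1)[OF M b] zero_carrier_mat zero_carrier_mat modsD(1)[OF N b]]) simp
  moreover have "lact (lsum M N) (c \<odot>\<^bsub>A\<^esub> a) = c \<cdot>\<^sub>m lact (lsum M N) a" if a: "a \<in> carrier A" for c a
    unfolding act modsD(5)[OF M a] modsD(5)[OF N a]
    by (subst smult_four_block_mat[OF modsD(1)[OF M a] zero_carrier_mat zero_carrier_mat modsD(1)[OF N a]]) simp
  moreover have "lact (lsum M N) a \<in> carrier_mat (ldim (lsum M N)) (ldim (lsum M N))" if a: "a \<in> carrier A" for a
    unfolding act dim by (rule four_block_carrier_mat[OF modsD(1)[OF M a] modsD(1)[OF N a]])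
  moreover have "lact (lsum M N) \<one>\<^bsub>A\<^esub> = 1\<^sub>m (ldim (lsum M N))"
    unfolding act dim modsD(2)[OF M] modsD(2)[OF N] by simp
  ultimately show ?thesis by (simp add: mods_def)
qed

lemma ldim_lsum [simp]: "ldim (lsum M N) = ldim M + ldim N"
  by (simp add: lsum_def)

text \<open>Direct sums are described by inclusions and projections, so that block matrices occur
  only in the construction for \<open>lsum\<close>.\<close>

definition biproduct ::
  "('k::field, 'a) module \<Rightarrow> ('k, 'a) lmod \<Rightarrow> ('k, 'a) lmod \<Rightarrow> ('k, 'a) lmod \<Rightarrow>
   'k mat \<Rightarrow> 'k mat \<Rightarrow> 'k mat \<Rightarrow> 'k mat \<Rightarrow> bool" where
  "biproduct A S M N i1 p1 i2 p2 \<longleftrightarrow>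
     i1 \<in> lhom A M S \<and> p1 \<in> lhom A S M \<and> i2 \<in> lhom A N S \<and> p2 \<in> lhom A S N \<and>
     p1 * i1 = 1\<^sub>m (ldim M) \<and> p2 * i2 = 1\<^sub>m (ldim N) \<and>
     p1 * i2 = 0\<^sub>m (ldim M) (ldim N) \<and> p2 * i1 = 0\<^sub>m (ldim N) (ldim M) \<and>
     i1 * p1 + i2 * p2 = 1\<^sub>m (ldim S)"

lemma biproductD:
  assumes "biproduct A S M N i1 p1 i2 p2"
  shows "i1 \<in> lhom A M S" "p1 \<in> lhom A S M" "i2 \<in> lhom A N S" "p2 \<in> lhom A S N"
    "p1 * i1 = 1\<^sub>m (ldim M)" "p2 * i2 = 1\<^sub>m (ldim N)"
    "p1 * i2 = 0\<^sub>m (ldim M) (ldim N)" "p2 * i1 = 0\<^sub>m (ldim N) (ldim M)"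
    "i1 * p1 + i2 * p2 = 1\<^sub>m (ldim S)"
  using assms by (auto simp: biproduct_def)

lemma lsum_biproduct:
  fixes M N :: "('k::field, 'a) lmod"
  assumes M: "M \<in> mods A" and N: "N \<in> mods A"
  shows "\<exists>i1 p1 i2 p2. biproduct A (lsum M N) M N i1 p1 i2 p2"
proof -
  let ?m = "ldim M" and ?n = "ldim N"
  \<comment> \<open>Inclusions and projections are written as 2 by 2 block matrices with an empty
    block row or column, so that every product below is one of 2 by 2 block matrices;
    \<open>pad\<close> and \<open>pad'\<close> remove the empty blocks again.\<close>
  define i1 :: "'k mat" where "i1 = four_block_mat (1\<^sub>m ?m) (0\<^sub>m ?m 0) (0\<^sub>m ?n ?m) (0\<^sub>m ?n 0)"
  define p1 :: "'k mat" where "p1 = four_block_mat (1\<^sub>m ?m) (0\<^sub>m ?m ?n) (0\<^sub>m 0 ?m) (0\<^sub>m 0 ?n)"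
  define i2 :: "'k mat" where "i2 = four_block_mat (0\<^sub>m ?m 0) (0\<^sub>m ?m ?n) (0\<^sub>m ?n 0) (1\<^sub>m ?n)"
  define p2 :: "'k mat" where "p2 = four_block_mat (0\<^sub>m 0 ?m) (0\<^sub>m 0 ?n) (0\<^sub>m ?n ?m) (1\<^sub>m ?n)"
  note defs = i1_def i2_def p1_def p2_def
  have pad: "four_block_mat (a :: 'k mat) (0\<^sub>m ?m 0) (0\<^sub>m 0 ?m) (0\<^sub>m 0 0) = a"
    if "a \<in> carrier_mat ?m ?m" for a using that by (intro eq_matI) auto
  have pad': "four_block_mat (0\<^sub>m 0 0) (0\<^sub>m 0 ?n) (0\<^sub>m ?n 0) (a :: 'k mat) = a"
    if "a \<in> carrier_mat ?n ?n" for a using that by (intro eq_matI) auto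
  note mfb = four_block_mult
  have z: "A * B = 0\<^sub>m r c" if "A \<in> carrier_mat r 0" "B \<in> carrier_mat 0 c" for A B :: "'k mat" and r c
    using that by (rule mult_mat_inner_0)
  note zz [simp] = z[OF zero_carrier_mat zero_carrier_mat]
  have p1i1: "p1 * i1 = four_block_mat (1\<^sub>m ?m) (0\<^sub>m ?m 0) (0\<^sub>m 0 ?m) (0\<^sub>m 0 0)"
    unfolding defs by (rule mfb[of _ ?m ?m _ ?n _ 0 _ _ ?m _ 0]) simp_all
  have p2i2: "p2 * i2 = four_block_mat (0\<^sub>m 0 0) (0\<^sub>m 0 ?n) (0\<^sub>m ?n 0) (1\<^sub>m ?n)"
    unfolding defs by (rule mfb[of _ 0 ?m _ ?n _ ?n _ _ 0 _ ?n]) simp_all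
  have p1i2: "p1 * i2 = four_block_mat (0\<^sub>m ?m 0) (0\<^sub>m ?m ?n) (0\<^sub>m 0 0) (0\<^sub>m 0 ?n)"
    unfolding defs by (rule mfb[of _ ?m ?m _ ?n _ 0 _ _ 0 _ ?n]) simp_all
  have p2i1: "p2 * i1 = four_block_mat (0\<^sub>m 0 ?m) (0\<^sub>m 0 0) (0\<^sub>m ?n ?m) (0\<^sub>m ?n 0)"
    unfolding defs by (rule mfb[of _ 0 ?m _ ?n _ ?n _ _ ?m _ 0]) simp_all
  have i1p1: "i1 * p1 = four_block_mat (1\<^sub>m ?m) (0\<^sub>m ?m ?n) (0\<^sub>m ?n ?m) (0\<^sub>m ?n ?n)"
    unfolding defs by (rule mfb[of _ ?m ?m _ 0 _ ?n _ _ ?m _ ?n]) simp_all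
  have i2p2: "i2 * p2 = four_block_mat (0\<^sub>m ?m ?m) (0\<^sub>m ?m ?n) (0\<^sub>m ?n ?m) (1\<^sub>m ?n)"
    unfolding defs by (rule mfb[of _ ?m 0 _ ?n _ ?n _ _ ?m _ ?n]) simp_all
  have sum: "i1 * p1 + i2 * p2 = 1\<^sub>m (?m + ?n)"
    unfolding i1p1 i2p2
    by (subst add_four_block_mat[of _ "?m" "?m" _ "?n" _ "?n"]) simp_all
  have act: "lact (lsum M N) a = four_block_mat (lact M a) (0\<^sub>m ?m ?n) (0\<^sub>m ?n ?m) (lact N a)" for a
    by (simp add: lsum_def)
  have h: "i1 * lact M a = lact (lsum M N) a * i1 \<and> p1 * lact (lsum M N) a = lact M a * p1 \<and>
      i2 * lact N a = lact (lsum M N) a * i2 \<and> p2 * lact (lsum M N) a = lact N a * p2"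
    if a: "a \<in> carrier A" for a
  proof (intro conjI)
    note c [simp] = modsD(1)[OF M a] modsD(1)[OF N a] carrier_matD[OF modsD(1)[OF M a]] carrier_matD[OF modsD(1)[OF N a]]
    have "i1 * four_block_mat (lact M a) (0\<^sub>m ?m 0) (0\<^sub>m 0 ?m) (0\<^sub>m 0 0) =
        four_block_mat (lact M a) (0\<^sub>m ?m 0) (0\<^sub>m ?n ?m) (0\<^sub>m ?n 0)"
      unfolding defs by (rule mfb[of _ ?m ?m _ 0 _ ?n _ _ ?m _ 0]) simp_all
    moreover have "lact (lsum M N) a * i1 = four_block_mat (lact M a) (0\<^sub>m ?m 0) (0\<^sub>m ?n ?m) (0\<^sub>m ?n 0)"
      unfolding act defs by (rule mfb[of _ ?m ?m _ ?n _ ?n _ _ ?m _ 0]) simp_all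
    ultimately show "i1 * lact M a = lact (lsum M N) a * i1" using pad[OF c(1)] by simp
    have "four_block_mat (lact M a) (0\<^sub>m ?m 0) (0\<^sub>m 0 ?m) (0\<^sub>m 0 0) * p1 =
        four_block_mat (lact M a) (0\<^sub>m ?m ?n) (0\<^sub>m 0 ?m) (0\<^sub>m 0 ?n)"
      unfolding defs by (rule mfb[of _ ?m ?m _ 0 _ 0 _ _ ?m _ ?n]) simp_all
    moreover have "p1 * lact (lsum M N) a = four_block_mat (lact M a) (0\<^sub>m ?m ?n) (0\<^sub>m 0 ?m) (0\<^sub>m 0 ?n)"
      unfolding act defs by (rule mfb[of _ ?m ?m _ ?n _ 0 _ _ ?m _ ?n]) simp_all
    ultimately show "p1 * lact (lsum M N) a = lact M a * p1" using pad[OF c(1)] by simp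
    have "i2 * four_block_mat (0\<^sub>m 0 0) (0\<^sub>m 0 ?n) (0\<^sub>m ?n 0) (lact N a) =
        four_block_mat (0\<^sub>m ?m 0) (0\<^sub>m ?m ?n) (0\<^sub>m ?n 0) (lact N a)"
      unfolding defs by (rule mfb[of _ ?m 0 _ ?n _ ?n _ _ 0 _ ?n]) simp_all
    moreover have "lact (lsum M N) a * i2 = four_block_mat (0\<^sub>m ?m 0) (0\<^sub>m ?m ?n) (0\<^sub>m ?n 0) (lact N a)"
      unfolding act defs by (rule mfb[of _ ?m ?m _ ?n _ ?n _ _ 0 _ ?n]) simp_all
    ultimately show "i2 * lact N a = lact (lsum M N) a * i2" using pad'[OF c(2)] by simp
    have "four_block_mat (0\<^sub>m 0 0) (0\<^sub>m 0 ?n) (0\<^sub>m ?n 0) (lact N a) * p2 =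
        four_block_mat (0\<^sub>m 0 ?m) (0\<^sub>m 0 ?n) (0\<^sub>m ?n ?m) (lact N a)"
      unfolding defs by (rule mfb[of _ 0 0 _ ?n _ ?n _ _ ?m _ ?n]) simp_all
    moreover have "p2 * lact (lsum M N) a = four_block_mat (0\<^sub>m 0 ?m) (0\<^sub>m 0 ?n) (0\<^sub>m ?n ?m) (lact N a)"
      unfolding act defs by (rule mfb[of _ 0 ?m _ ?n _ ?n _ _ ?m _ ?n]) simp_all
    ultimately show "p2 * lact (lsum M N) a = lact N a * p2" using pad'[OF c(2)] by simp
  qed
  have "i1 \<in> carrier_mat (?m + ?n) ?m" "p1 \<in> carrier_mat ?m (?m + ?n)"
    "i2 \<in> carrier_mat (?m + ?n) ?n" "p2 \<in> carrier_mat ?n (?m + ?n)"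
    unfolding defs by (rule carrier_matI; simp)+
  then have "i1 \<in> lhom A M (lsum M N)" "p1 \<in> lhom A (lsum M N) M"
    "i2 \<in> lhom A N (lsum M N)" "p2 \<in> lhom A (lsum M N) N"
    using h by (auto simp: lhom_def)
  then show ?thesis using pad[of "1\<^sub>m ?m"] pad'[of "1\<^sub>m ?n"]
    by (intro exI[of _ i1] exI[of _ p1] exI[of _ i2] exI[of _ p2]) (simp add: biproduct_def p1i1 p2i2 p1i2 p2i1 sum)
qed

text \<open>Each projection of one sum followed by the matching inclusion of the other gives a map
  in either direction, and these two maps are mutually inverse.\<close>

lemma biproduct_unique:
  assumes S: "S \<in> mods A" and T: "T \<in> mods A" and M: "M \<in> mods A" and N: "N \<in> mods A"
    and bs: "biproduct A S M N i1 p1 i2 p2" and bt: "biproduct A T M N j1 q1 j2 q2"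
  shows "liso A S T"
proof -
  \<comment> \<open>Stated for arbitrary \<open>S\<close> and \<open>T\<close> because it is used
    once in each direction.\<close>
  have inv: "(i1 * q1 + i2 * q2) * (j1 * p1 + j2 * p2) = 1\<^sub>m (ldim S)"
    if S: "S \<in> mods A" and T: "T \<in> mods A" and bs: "biproduct A S M N i1 p1 i2 p2" and bt: "biproduct A T M N j1 q1 j2 q2"
    for S T i1 i2 p1 p2 j1 j2 q1 q2
  proof -
    note b = biproductD[OF bs] and c = biproductD[OF bt]
    note bd [simp] = b(1-4)[THEN lhomD(1), THEN carrier_matD(1)] b(1-4)[THEN lhomD(1), THEN carrier_matD(2)]
      c(1-4)[THEN lhomD(1), THEN carrier_matD(1)] c(1-4)[THEN lhomD(1), THEN carrier_matD(2)]
    have [simp]: "q1 * (j1 * p1) = p1" "q1 * (j2 * p2) = 0\<^sub>m (ldim M) (ldim S)"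
      "q2 * (j1 * p1) = 0\<^sub>m (ldim N) (ldim S)" "q2 * (j2 * p2) = p2"
      using c(5-8) b(1-4)[THEN lhomD(1)]
      by (simp_all flip: mult_mat_assoc)
    have [simp]: "i1 * p1 \<in> carrier_mat (ldim S) (ldim S)" "i2 * p2 \<in> carrier_mat (ldim S) (ldim S)"
      using b(1-4)[THEN lhomD(1)] by auto
    have "(i1 * q1 + i2 * q2) * (j1 * p1 + j2 * p2) = i1 * p1 + i2 * p2"
      by (simp add: mult_mat_simps)
    then show ?thesis using b(9) by simp
  qed
  note b = biproductD[OF bs] and c = biproductD[OF bt]
  have "j1 * p1 + j2 * p2 \<in> lhom A S T" "i1 * q1 + i2 * q2 \<in> lhom A T S"
    by (intro lhom_add[OF S T] lhom_add[OF T S] lhom_comp[OF S M T b(2) c(1)] lhom_comp[OF S N T b(4) c(3)]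
        lhom_comp[OF T M S c(2) b(1)] lhom_comp[OF T N S c(4) b(3)])+
  then show ?thesis using inv[OF S T bs bt] inv[OF T S bt bs] by (auto simp: liso_def)
qed

lemma biproduct_transport:
  assumes S: "S \<in> mods A" and T: "T \<in> mods A" and M: "M \<in> mods A" and N: "N \<in> mods A"
    and iso: "liso A S T" and bt: "biproduct A T M N j1 q1 j2 q2"
  shows "\<exists>i1 p1 i2 p2. biproduct A S M N i1 p1 i2 p2"
proof -
  obtain f g where f: "f \<in> lhom A S T" and g: "g \<in> lhom A T S" and gf: "g * f = 1\<^sub>m (ldim S)" and fg: "f * g = 1\<^sub>m (ldim T)"
    using iso by (auto simp: liso_def)
  note c = biproductD[OF bt]
  note d = c(1-4)[THEN lhomD(1)] f[THEN lhomD(1)] g[THEN lhomD(1)]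
  note bd [simp] = d[THEN carrier_matD(1)] d[THEN carrier_matD(2)]
  have [simp]: "f * (g * j1) = j1" "f * (g * j2) = j2" using fg d by (simp_all flip: mult_mat_assoc)
  have "g * j1 * (q1 * f) + g * j2 * (q2 * f) = g * ((j1 * q1 + j2 * q2) * f)"
    by (simp add: mult_mat_simps)
  also have "\<dots> = 1\<^sub>m (ldim S)" using c(9) gf d by simp
  finally have "biproduct A S M N (g * j1) (q1 * f) (g * j2) (q2 * f)"
    unfolding biproduct_def using c lhom_comp[OF M T S c(1) g] lhom_comp[OF N T S c(3) g]
      lhom_comp[OF S T M f c(2)] lhom_comp[OF S T N f c(4)] by (simp add: mult_mat_assoc)
  then show ?thesis by blast
qed

text \<open>Turns an isomorphism with a direct sum into matrix equations, the form in which
  decompositions are used below.\<close>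

lemma liso_lsum_iff:
  assumes S: "S \<in> mods A" and M: "M \<in> mods A" and N: "N \<in> mods A"
  shows "liso A S (lsum M N) \<longleftrightarrow> (\<exists>i1 p1 i2 p2. biproduct A S M N i1 p1 i2 p2)"
  using biproduct_transport[OF S lsum_mods[OF M N] M N] biproduct_unique[OF S lsum_mods[OF M N] M N]
    lsum_biproduct[OF M N] by blast

lemma smult_one_mat_eq_zero:
  assumes "c \<cdot>\<^sub>m 1\<^sub>m n = (0\<^sub>m n n :: 'k::field mat)" "c \<noteq> 0"
  shows "n = 0"
proof (rule ccontr)
  assume "n \<noteq> 0"
  then show False using arg_cong[OF assms(1), of "\<lambda>m. m $$ (0,0)"] assms(2) by simp
qed

lemma retract_splits:
  fixes Q N :: "('k::field, 'a) lmod"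
  assumes Q: "Q \<in> mods A" and N: "N \<in> mods A" and r: "r \<in> lhom A Q N" and s: "s \<in> lhom A N Q"
    and rs: "r * s = 1\<^sub>m (ldim N)"
  shows "\<exists>K\<in>mods A. liso A Q (lsum N K)"
proof -
  let ?q = "ldim Q" and ?n = "ldim N"
  note cr = lhomD(1)[OF r] and cs = lhomD(1)[OF s]
  note [simp] = cr[THEN carrier_matD(1)] cr[THEN carrier_matD(2)] cs[THEN carrier_matD(1)] cs[THEN carrier_matD(2)]
  \<comment> \<open>The idempotent whose kernel is the copy of \<open>N\<close>; its image is the
    complement sought. The scalar -1 makes \<open>lhom_add\<close> and \<open>lhom_smult\<close>
    applicable.\<close>
  define f where "f = 1\<^sub>m ?q + (-1) \<cdot>\<^sub>m (s * r)"
  have fl: "f \<in> lhom A Q Q"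
    unfolding f_def by (intro lhom_add lhom_smult lhom_id lhom_comp[OF Q N Q r s] Q)
  have srsr: "s * (r * (s * r)) = s * r"
  proof -
    have "r * (s * r) = r" using rs cr by (simp flip: mult_mat_assoc)
    then show ?thesis by simp
  qed
  have cf: "f \<in> carrier_mat ?q ?q" using lhomD(1)[OF fl] .
  have ff: "f * f = f"
    unfolding f_def by (simp add: mult_mat_simps srsr) (auto intro!: eq_matI)
  obtain k s' h where s': "s' \<in> carrier_mat ?q k" and h: "h \<in> carrier_mat k ?q" and fsh: "f = s' * h"
    and hs: "h * s' = 1\<^sub>m k"
    using idempotent_splitting[OF cf ff] by metis
  note [simp] = s'[THEN carrier_matD(1)] s'[THEN carrier_matD(2)] h[THEN carrier_matD(1)] h[THEN carrier_matD(2)]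
    cf[THEN carrier_matD(1)] cf[THEN carrier_matD(2)]
  have hf: "h * f = h" using hs h by (simp add: fsh flip: mult_mat_assoc)
  have fs': "f * s' = s'" using hs s' by (simp add: fsh mult_mat_assoc)
  have rf: "r * f = 0\<^sub>m ?n ?q"
  proof -
    have "r * f = r + (-1) \<cdot>\<^sub>m (r * (s * r))" using cr unfolding f_def by (simp add: mult_mat_simps)
    also have "r * (s * r) = r" using rs cr by (simp flip: mult_mat_assoc)
    finally show ?thesis by (auto intro!: eq_matI)
  qed
  have fs: "f * s = 0\<^sub>m ?q ?n"
  proof -
    have "f * s = s + (-1) \<cdot>\<^sub>m (s * (r * s))" using cs unfolding f_def by (simp add: mult_mat_simps)
    also have "s * (r * s) = s" using rs cs by simp
    finally show ?thesis by (auto intro!: eq_matI)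
  qed
  have rs': "r * s' = 0\<^sub>m ?n k"
  proof -
    have "r * s' = r * (f * s')" using fs' by simp
    also have "\<dots> = (r * f) * s'" by (simp add: mult_mat_assoc)
    finally show ?thesis using rf s' by simp
  qed
  have hs0: "h * s = 0\<^sub>m k ?n"
  proof -
    have "h * s = (h * f) * s" using hf by simp
    also have "\<dots> = h * (f * s)" by (simp add: mult_mat_assoc)
    finally show ?thesis using fs h by simp
  qed
  \<comment> \<open>The image of \<open>f\<close> is a submodule because \<open>f\<close> commutes
    with the action; \<open>h\<close> and \<open>s'\<close> write that action in
    coordinates.\<close>
  define K where "K = LMod k (\<lambda>a. h * (lact Q a * s'))"
  have dK [simp]: "ldim K = k" by (simp add: K_def)
  have aK: "lact K a = h * (lact Q a * s')" for a by (simp add: K_def)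
  have comm: "f * lact Q a = lact Q a * f" if "a \<in> carrier A" for a using lhomD(2)[OF fl that] .
  have s'a: "s' * lact K a = lact Q a * s'" if a: "a \<in> carrier A" for a
  proof -
    note [simp] = carrier_matD[OF modsD(1)[OF Q a]]
    have "s' * lact K a = f * lact Q a * s'" unfolding aK fsh by (simp add: mult_mat_assoc)
    also have "\<dots> = lact Q a * (f * s')" unfolding comm[OF a] by (simp add: mult_mat_assoc)
    finally show ?thesis using fs' by simp
  qed
  have ha: "h * lact Q a = lact K a * h" if a: "a \<in> carrier A" for a
  proof -
    note [simp] = carrier_matD[OF modsD(1)[OF Q a]]
    have "lact K a * h = h * (lact Q a * f)" unfolding aK fsh by (simp add: mult_mat_assoc)
    also have "\<dots> = h * f * lact Q a" unfolding comm[OF a, symmetric] by (simp add: mult_mat_assoc)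
    finally show ?thesis using hf by simp
  qed
  have cK: "lact K a \<in> carrier_mat k k" if a: "a \<in> carrier A" for a
    unfolding aK using modsD(1)[OF Q a] h s' by auto
  have "K \<in> mods A"
    unfolding mods_def
  proof (intro CollectI conjI ballI allI)
    show "lact K \<one>\<^bsub>A\<^esub> = 1\<^sub>m (ldim K)" using modsD(2)[OF Q] s' hs by (simp add: aK)
    fix a assume a: "a \<in> carrier A"
    note [simp] = carrier_matD[OF modsD(1)[OF Q a]] carrier_matD[OF cK[OF a]]
    show "lact K a \<in> carrier_mat (ldim K) (ldim K)" using cK[OF a] by simp
    show "lact K (c \<odot>\<^bsub>A\<^esub> a) = c \<cdot>\<^sub>m lact K a" for c
      unfolding aK modsD(5)[OF Q a] by (simp add: mult_mat_simps)
    fix b assume b: "b \<in> carrier A"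
    note [simp] = carrier_matD[OF modsD(1)[OF Q b]] carrier_matD[OF cK[OF b]]
    show "lact K (a \<otimes>\<^bsub>A\<^esub> b) = lact K a * lact K b"
    proof -
      have "lact K a * lact K b = lact K a * h * (lact Q b * s')" unfolding aK[of b] by (simp add: mult_mat_assoc)
      also have "\<dots> = h * (lact Q a * lact Q b * s')" unfolding ha[OF a, symmetric] by (simp add: mult_mat_assoc)
      finally show ?thesis unfolding aK modsD(3)[OF Q a b] by simp
    qed
    show "lact K (a \<oplus>\<^bsub>A\<^esub> b) = lact K a + lact K b"
      unfolding aK modsD(4)[OF Q a b] by (simp add: mult_mat_simps)
  qed
  moreover have "biproduct A Q N K s r s' h"
    unfolding biproduct_def
  proof (intro conjI)
    show "s' \<in> lhom A K Q" "h \<in> lhom A Q K" using s'a ha s' h by (auto intro!: lhomI)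
    show "s * r + s' * h = 1\<^sub>m ?q" unfolding fsh[symmetric] f_def by (auto intro!: eq_matI)
  qed (use r s rs hs rs' hs0 in auto)
  ultimately show ?thesis using liso_lsum_iff[OF Q N] by blast
qed

section \<open>Modules whose only endomorphisms are scalars\<close>

text \<open>Such a module is often called a brick with endomorphism ring the ground field. Both S
  and P are of this kind, which gives their indecomposability and the basicness of their sum with
  one of them shifted.\<close>

definition scalar_endos :: "('k::field, 'a) module \<Rightarrow> ('k, 'a) lmod \<Rightarrow> bool" where
  "scalar_endos A M \<longleftrightarrow> (\<forall>e\<in>lhom A M M. \<exists>c. e = c \<cdot>\<^sub>m 1\<^sub>m (ldim M))"

text \<open>The projector \<open>i1 * p1\<close> is a scalar. If the scalar is zero, then so is the
  identity of \<open>V\<close>; otherwise the projector vanishes on \<open>W\<close> and is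
  invertible there at once.\<close>

lemma scalar_endos_lsum:
  fixes M V W :: "('k::field, 'a) lmod"
  assumes M: "M \<in> mods A" and V: "V \<in> mods A" and W: "W \<in> mods A" and sc: "scalar_endos A M"
    and iso: "liso A M (lsum V W)"
  shows "ldim V = 0 \<or> ldim W = 0"
proof -
  obtain i1 p1 i2 p2 where b: "biproduct A M V W i1 p1 i2 p2"
    using iso liso_lsum_iff[OF M V W] by blast
  note bp = biproductD[OF b]
  note c = bp(1-4)[THEN lhomD(1)]
  note [simp] = c[THEN carrier_matD(1)] c[THEN carrier_matD(2)]
  obtain a where a: "i1 * p1 = a \<cdot>\<^sub>m 1\<^sub>m (ldim M)"
    using sc lhom_comp[OF M V M bp(2,1)] by (auto simp: scalar_endos_def)
  show ?thesis
  proof (cases "a = 0")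
    case True
    have "1\<^sub>m (ldim V) = p1 * (i1 * p1) * i1" using bp(5) c by (simp add: mult_mat_assoc)
    also have "\<dots> = 0 \<cdot>\<^sub>m (p1 * i1)" unfolding a True using c by (simp add: mult_mat_simps)
    also have "\<dots> = 0\<^sub>m (ldim V) (ldim V)" unfolding bp(5) by (auto intro!: eq_matI)
    finally show ?thesis using one_eq_zero_mat by blast
  next
    case False
    have "p2 * (i1 * p1) * i2 = a \<cdot>\<^sub>m (p2 * i2)" unfolding a using c by (simp add: mult_mat_simps)
    moreover have "p2 * (i1 * p1) * i2 = (p2 * i1) * (p1 * i2)" by (simp add: mult_mat_assoc)
    moreover have "(p2 * i1) * (p1 * i2) = 0\<^sub>m (ldim W) (ldim W)"
      unfolding bp(7,8) by (rule left_mult_zero_mat[OF zero_carrier_mat])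
    ultimately have "a \<cdot>\<^sub>m 1\<^sub>m (ldim W) = 0\<^sub>m (ldim W) (ldim W)" unfolding bp(6) by (simp only:)
    then show ?thesis by (intro disjI2 smult_one_mat_eq_zero[OF _ False])
  qed
qed

text \<open>The endomorphism taking the second copy of \<open>V\<close> to the first has the
  identity as its off-diagonal component, while a scalar has off-diagonal component zero.\<close>

lemma scalar_endos_square:
  fixes M V W :: "('k::field, 'a) lmod"
  assumes M: "M \<in> mods A" and V: "V \<in> mods A" and W: "W \<in> mods A" and sc: "scalar_endos A M"
    and iso: "liso A M (lsum (lsum V V) W)"
  shows "ldim V = 0"
proof -
  let ?V = "lsum V V"
  have VV: "?V \<in> mods A" by (rule lsum_mods[OF V V])
  obtain i p j q where "biproduct A M ?V W i p j q"
    using iso liso_lsum_iff[OF M VV W] by blast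
  note b = biproductD[OF this]
  obtain a1 b1 a2 b2 where "biproduct A ?V V V a1 b1 a2 b2"
    using lsum_biproduct[OF V V] by blast
  note c = biproductD[OF this]
  note d = b(1-4)[THEN lhomD(1)] c(1-4)[THEN lhomD(1)]
  note [simp] = d[THEN carrier_matD(1)] d[THEN carrier_matD(2)]
  have "(i * a1) * (b2 * p) \<in> lhom A M M"
    by (rule lhom_comp[OF M V M lhom_comp[OF M VV V b(2) c(4)] lhom_comp[OF V VV M c(1) b(1)]])
  then obtain t where t: "(i * a1) * (b2 * p) = t \<cdot>\<^sub>m 1\<^sub>m (ldim M)"
    using sc by (auto simp: scalar_endos_def)
  have pi: "p * (i * a1) = a1" "p * (i * a2) = a2" using b(5) d by (simp_all flip: mult_mat_assoc)
  have "(b1 * p) * ((i * a1) * (b2 * p)) * (i * a2) = b1 * ((p * (i * a1)) * (b2 * (p * (i * a2))))"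
    by (simp add: mult_mat_assoc)
  also have "\<dots> = (b1 * a1) * (b2 * a2)" unfolding pi by (simp add: mult_mat_assoc)
  also have "\<dots> = 1\<^sub>m (ldim V)" unfolding c(5,6) by simp
  finally have 1: "(b1 * p) * ((i * a1) * (b2 * p)) * (i * a2) = 1\<^sub>m (ldim V)" .
  have "(b1 * p) * (t \<cdot>\<^sub>m 1\<^sub>m (ldim M)) * (i * a2) = t \<cdot>\<^sub>m ((b1 * p) * (i * a2))"
    using d by (simp add: mult_mat_simps)
  also have "(b1 * p) * (i * a2) = b1 * (p * (i * a2))" by (simp add: mult_mat_assoc)
  also have "\<dots> = 0\<^sub>m (ldim V) (ldim V)" unfolding pi c(7) ..
  finally have "1\<^sub>m (ldim V) = (0\<^sub>m (ldim V) (ldim V) :: 'k mat)" using 1 t by simp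
  then show ?thesis by (rule one_eq_zero_mat)
qed

section \<open>Vanishing of morphisms and projectivity\<close>

lemma lhom_zeroD: "lhom_zero A M N \<Longrightarrow> f \<in> lhom A M N \<Longrightarrow> f = 0\<^sub>m (ldim N) (ldim M)"
  by (auto simp: lhom_zero_def)

lemma lhom_zeroI:
  assumes "M \<in> mods A" "N \<in> mods A" "\<And>f. f \<in> lhom A M N \<Longrightarrow> f = 0\<^sub>m (ldim N) (ldim M)"
  shows "lhom_zero A M N"
  unfolding lhom_zero_def using lhom_zero_map[OF assms(1,2)] assms(3) by blast

lemma lhom_from_0:
  assumes M: "M \<in> mods A" and N: "N \<in> mods A" and 0: "ldim M = 0"
  shows "lhom A M N = {0\<^sub>m (ldim N) 0}"
proof (intro equalityI subsetI)
  fix f assume "f \<in> lhom A M N"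
  from lhomD(1)[OF this] show "f \<in> {0\<^sub>m (ldim N) 0}" using 0 by (auto intro!: eq_matI)
next
  fix f :: "'a mat" assume "f \<in> {0\<^sub>m (ldim N) 0}"
  then show "f \<in> lhom A M N" using lhom_zero_map[OF M N] 0 by simp
qed

lemma lhom_to_0:
  assumes M: "M \<in> mods A" and N: "N \<in> mods A" and 0: "ldim N = 0"
  shows "lhom A M N = {0\<^sub>m 0 (ldim M)}"
proof (intro equalityI subsetI)
  fix f assume "f \<in> lhom A M N"
  from lhomD(1)[OF this] show "f \<in> {0\<^sub>m 0 (ldim M)}" using 0 by (auto intro!: eq_matI)
next
  fix f :: "'a mat" assume "f \<in> {0\<^sub>m 0 (ldim M)}"
  then show "f \<in> lhom A M N" using lhom_zero_map[OF M N] 0 by simp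
qed

lemma lhom_zero_ldim_0:
  assumes "M \<in> mods A" "N \<in> mods A" "ldim N = 0"
  shows "lhom_zero A M N"
  using lhom_to_0[OF assms] assms(3) by (simp add: lhom_zero_def)

lemma lhom_zero_retract_left:
  assumes M: "M \<in> mods A" and M': "M' \<in> mods A" and N: "N \<in> mods A"
    and i: "i \<in> lhom A M' M" and r: "r \<in> lhom A M M'" and ri: "r * i = 1\<^sub>m (ldim M')"
    and z: "lhom_zero A M N"
  shows "lhom_zero A M' N"
proof (rule lhom_zeroI[OF M' N])
  fix f assume f: "f \<in> lhom A M' N"
  note c = f[THEN lhomD(1)] i[THEN lhomD(1)] r[THEN lhomD(1)]
  note [simp] = c[THEN carrier_matD(1)] c[THEN carrier_matD(2)]
  have "f = (f * r) * i" using ri c by (simp add: mult_mat_assoc)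
  also have "f * r = 0\<^sub>m (ldim N) (ldim M)" by (rule lhom_zeroD[OF z lhom_comp[OF M M' N r f]])
  finally show "f = 0\<^sub>m (ldim N) (ldim M')" using c by simp
qed

lemma lhom_zero_retract_right:
  assumes M: "M \<in> mods A" and N': "N' \<in> mods A" and N: "N \<in> mods A"
    and i: "i \<in> lhom A N' N" and r: "r \<in> lhom A N N'" and ri: "r * i = 1\<^sub>m (ldim N')"
    and z: "lhom_zero A M N"
  shows "lhom_zero A M N'"
proof (rule lhom_zeroI[OF M N'])
  fix f assume f: "f \<in> lhom A M N'"
  note c = f[THEN lhomD(1)] i[THEN lhomD(1)] r[THEN lhomD(1)]
  note [simp] = c[THEN carrier_matD(1)] c[THEN carrier_matD(2)]
  have "f = r * (i * f)" using ri c by (simp flip: mult_mat_assoc)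
  also have "i * f = 0\<^sub>m (ldim N) (ldim M)" by (rule lhom_zeroD[OF z lhom_comp[OF M N' N f i]])
  finally show "f = 0\<^sub>m (ldim N') (ldim M)" using c by simp
qed

lemma lhom_zero_liso:
  assumes "M \<in> mods A" "M' \<in> mods A" "N \<in> mods A" "N' \<in> mods A" "liso A M M'" "liso A N N'" "lhom_zero A M N"
  shows "lhom_zero A M' N'"
  using assms(5,6) lhom_zero_retract_left[OF assms(1,2,3) _ _ _ assms(7)]
    lhom_zero_retract_right[OF assms(2,4,3)] unfolding liso_def by blast

section \<open>Relative projectives and their translates\<close>

lemma projective_in_mono:
  "projective_in A \<C> P \<Longrightarrow> \<D> \<subseteq> \<C> \<Longrightarrow> P \<in> \<D> \<Longrightarrow> projective_in A \<D> P"
  unfolding projective_in_def by (metis subsetD)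

lemma projective_in_retract:
  assumes Q: "projective_in A (mods A) Q" and P: "P \<in> mods A"
    and i: "i \<in> lhom A P Q" and r: "r \<in> lhom A Q P" and ri: "r * i = 1\<^sub>m (ldim P)"
  shows "projective_in A (mods A) P"
  unfolding projective_in_def
proof (intro conjI P ballI impI)
  fix X Y e f assume X: "X \<in> mods A" and Y: "Y \<in> mods A" and e: "e \<in> lhom A X Y" and f: "f \<in> lhom A P Y"
    and "mat_surj e"
  have Qm: "Q \<in> mods A" using Q by (simp add: projective_in_def)
  have "f * r \<in> lhom A Q Y" by (rule lhom_comp[OF Qm P Y r f])
  then obtain h where h: "h \<in> lhom A Q X" "e * h = f * r"
    using Q X Y e \<open>mat_surj e\<close> unfolding projective_in_def by blast
  note c = f[THEN lhomD(1)] i[THEN lhomD(1)] r[THEN lhomD(1)] h(1)[THEN lhomD(1)] e[THEN lhomD(1)]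
  note [simp] = c[THEN carrier_matD(1)] c[THEN carrier_matD(2)]
  have "e * (h * i) = (f * r) * i" using h(2) by (simp flip: mult_mat_assoc)
  also have "\<dots> = f" using ri c by (simp add: mult_mat_assoc)
  finally show "\<exists>h\<in>lhom A P X. e * h = f" using lhom_comp[OF P Qm X i h(1)] by blast
qed

lemma projective_in_liso:
  "projective_in A (mods A) Q \<Longrightarrow> P \<in> mods A \<Longrightarrow> liso A Q P \<Longrightarrow> projective_in A (mods A) P"
  unfolding liso_def by (blast intro: projective_in_retract)

lemma projective_in_lsum:
  assumes P: "projective_in A (mods A) P" and Q: "projective_in A (mods A) Q"
  shows "projective_in A (mods A) (lsum P Q)"
proof -
  have Pm: "P \<in> mods A" and Qm: "Q \<in> mods A" using P Q by (auto simp: projective_in_def)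
  let ?S = "lsum P Q"
  have S: "?S \<in> mods A" by (rule lsum_mods[OF Pm Qm])
  obtain i1 p1 i2 p2 where "biproduct A ?S P Q i1 p1 i2 p2" using lsum_biproduct[OF Pm Qm] by blast
  note b = biproductD[OF this]
  show ?thesis
    unfolding projective_in_def
  proof (intro conjI S ballI impI)
    fix X Y e f assume X: "X \<in> mods A" and Y: "Y \<in> mods A" and e: "e \<in> lhom A X Y" and f: "f \<in> lhom A ?S Y"
      and su: "mat_surj e"
    obtain h1 where h1: "h1 \<in> lhom A P X" "e * h1 = f * i1"
      using P X Y e su lhom_comp[OF Pm S Y b(1) f] unfolding projective_in_def by blast
    obtain h2 where h2: "h2 \<in> lhom A Q X" "e * h2 = f * i2"
      using Q X Y e su lhom_comp[OF Qm S Y b(3) f] unfolding projective_in_def by blast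
    note c = b(1-4)[THEN lhomD(1)] f[THEN lhomD(1)] h1(1)[THEN lhomD(1)] h2(1)[THEN lhomD(1)] e[THEN lhomD(1)]
    note [simp] = c[THEN carrier_matD(1)] c[THEN carrier_matD(2)]
    have "e * (h1 * p1 + h2 * p2) = (e * h1) * p1 + (e * h2) * p2" by (simp add: mult_mat_simps)
    also have "\<dots> = f * (i1 * p1 + i2 * p2)" unfolding h1(2) h2(2) by (simp add: mult_mat_simps)
    also have "\<dots> = f" unfolding b(9) using c by simp
    finally have "e * (h1 * p1 + h2 * p2) = f" .
    moreover have "h1 * p1 + h2 * p2 \<in> lhom A ?S X"
      by (intro lhom_add[OF S X] lhom_comp[OF S Pm X b(2) h1(1)] lhom_comp[OF S Qm X b(4) h2(1)])
    ultimately show "\<exists>h\<in>lhom A ?S X. e * h = f" by blast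
  qed
qed

lemma projective_in_lzero:
  assumes "\<C> \<subseteq> mods A" "lzero \<in> \<C>"
  shows "projective_in A \<C> lzero"
  unfolding projective_in_def
proof (intro conjI assms(2) ballI impI)
  fix X Y e f assume X: "X \<in> \<C>" and Y: "Y \<in> \<C>" and e: "e \<in> lhom A X Y" and f: "f \<in> lhom A lzero Y"
  have "X \<in> mods A" using X assms by blast
  then have "0\<^sub>m (ldim X) 0 \<in> lhom A lzero X" using lhom_zero_map[OF lzero_mods, of X A] by simp
  moreover have "e * 0\<^sub>m (ldim X) 0 = f"
    using lhomD(1)[OF e] lhomD(1)[OF f] by (auto intro!: eq_matI)
  ultimately show "\<exists>h\<in>lhom A lzero X. e * h = f" by blast
qed

text \<open>A projective has the minimal presentation 0 -> M -> M, so the functionals in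
  \<open>is_tau\<close> live on Hom(0, G), a zero space. Both sides of the required bijection are
  singletons.\<close>

lemma tau_projective:
  fixes M :: "('k::field, 'a) lmod"
  assumes C: "\<C> \<subseteq> mods A" "lzero \<in> \<C>" and M: "projective_in A \<C> M" and G: "progenerator_in A \<C> G"
  shows "is_tau A \<C> M lzero"
proof -
  have Mm: "M \<in> mods A" and Gm: "G \<in> mods A" using M G C by (auto simp: projective_in_def progenerator_in_def)
  let ?z = "lzero :: ('k, 'a) lmod" and ?n = "ldim M"
  have pres: "min_proj_pres A \<C> ?z M (0\<^sub>m ?n 0) (1\<^sub>m ?n) M"
    unfolding min_proj_pres_def
  proof (intro conjI M projective_in_lzero C)
    show "0\<^sub>m ?n 0 \<in> lhom A ?z M" using lhom_zero_map[OF lzero_mods Mm] by simp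
    show "1\<^sub>m ?n \<in> lhom A M M" by (rule lhom_id[OF Mm])
    show "mat_surj (1\<^sub>m ?n :: 'k mat)" by (auto simp: mat_surj_def mat_image_def image_iff)
    have "mat_kernel (1\<^sub>m ?n) = {0\<^sub>v ?n :: 'k vec}" by (auto simp: mat_kernel_def)
    moreover have "mat_image (0\<^sub>m ?n 0) = {0\<^sub>v ?n :: 'k vec}"
    proof -
      have "carrier_vec 0 = {0\<^sub>v 0 :: 'k vec}" by auto
      then show ?thesis by (auto simp: mat_image_def)
    qed
    ultimately show "mat_kernel (1\<^sub>m ?n) = mat_image (0\<^sub>m ?n 0 :: 'k mat)" by simp
    show "right_minimal A M (1\<^sub>m ?n)"
      unfolding right_minimal_def
    proof (intro ballI impI)
      fix e assume e: "e \<in> lhom A M M" "1\<^sub>m ?n * e = 1\<^sub>m ?n"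
      then have "e = 1\<^sub>m ?n" using lhomD(1)[OF e(1)] by simp
      then show "\<exists>e'\<in>lhom A M M. e * e' = 1\<^sub>m ?n \<and> e' * e = 1\<^sub>m ?n" using lhom_id[OF Mm] by force
    qed
    show "right_minimal A ?z (0\<^sub>m ?n 0)"
      unfolding right_minimal_def
    proof (intro ballI impI)
      fix e assume e: "e \<in> lhom A ?z ?z"
      then show "\<exists>e'\<in>lhom A ?z ?z. e * e' = 1\<^sub>m (ldim ?z) \<and> e' * e = 1\<^sub>m (ldim ?z)"
        using lhomD(1)[OF e] by (intro bexI[of _ e]) (auto intro!: eq_matI)
    qed
  qed
  let ?L = "lhom A ?z G" and ?R = "lhom A G ?z"
  have L: "?L = {0\<^sub>m (ldim G) 0}"
    by (rule lhom_from_0[OF lzero_mods Gm ldim_lzero])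
  have R: "?R = {0\<^sub>m 0 (ldim G)}"
    by (rule lhom_to_0[OF Gm lzero_mods ldim_lzero])
  \<comment> \<open>The zero functional, restricted because \<open>linear_functionals\<close>
    consists of extensional functions.\<close>
  define \<theta> :: "'k mat \<Rightarrow> 'k mat \<Rightarrow> 'k" where "\<theta> = (\<lambda>g. restrict (\<lambda>h. 0) ?L)"
  have F: "{\<phi> \<in> linear_functionals ?L. \<forall>h\<in>lhom A M G. \<phi> (h * 0\<^sub>m ?n 0) = 0} = {restrict (\<lambda>h. 0) ?L}"
    (is "?F = _")
  proof (intro equalityI subsetI)
    fix \<phi> :: "'k mat \<Rightarrow> 'k" assume "\<phi> \<in> ?F"
    then have p: "\<phi> \<in> linear_functionals {0\<^sub>m (ldim G) 0}" unfolding L by blast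
    then have "\<phi> (0 \<cdot>\<^sub>m 0\<^sub>m (ldim G) 0) = 0 * \<phi> (0\<^sub>m (ldim G) 0)"
      unfolding linear_functionals_def by blast
    then have "\<phi> (0\<^sub>m (ldim G) 0) = 0" by simp
    moreover have "\<phi> \<in> extensional {0\<^sub>m (ldim G) 0}" using p by (simp add: linear_functionals_def)
    ultimately have "\<phi> = restrict (\<lambda>h. 0) ?L" unfolding L by (auto simp: extensional_def restrict_def)
    then show "\<phi> \<in> {restrict (\<lambda>h. 0) ?L}" by simp
  next
    fix \<phi> :: "'k mat \<Rightarrow> 'k" assume "\<phi> \<in> {restrict (\<lambda>h. 0) ?L}"
    then have p: "\<phi> = restrict (\<lambda>h. 0) {0\<^sub>m (ldim G) 0}" unfolding L by simp
    have "\<phi> \<in> linear_functionals ?L" unfolding L p by (simp add: linear_functionals_def)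
    moreover have "\<phi> (h * 0\<^sub>m ?n 0) = 0" if "h \<in> lhom A M G" for h
      using lhomD(1)[OF that] by (simp add: p)
    ultimately show "\<phi> \<in> ?F" by blast
  qed
  have "bij_betw \<theta> ?R {\<phi> \<in> linear_functionals ?L. \<forall>h\<in>lhom A M G. \<phi> (h * 0\<^sub>m ?n 0) = 0}"
    unfolding F unfolding R by (simp add: \<theta>_def bij_betw_def)
  moreover have "\<theta> g h = 0" if "h \<in> ?L" for g h using that by (simp add: \<theta>_def)
  moreover have "e * h \<in> ?L" if "e \<in> lhom A G G" "h \<in> ?L" for e h
    by (rule lhom_comp[OF lzero_mods Gm Gm that(2,1)])
  ultimately show ?thesis
    unfolding is_tau_def
    by (intro conjI C(2) exI[of _ G] exI[of _ ?z] exI[of _ M] exI[of _ "0\<^sub>m ?n 0"] exI[of _ "1\<^sub>m ?n"] exI[of _ \<theta>] G pres)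
      simp_all
qed

lemma tau_rigid_projective:
  assumes "\<C> \<subseteq> mods A" "lzero \<in> \<C>" "projective_in A \<C> M" "progenerator_in A \<C> G"
  shows "tau_rigid_in A \<C> M"
proof -
  have "M \<in> \<C>" using assms(3) by (simp add: projective_in_def)
  then show ?thesis
    unfolding tau_rigid_in_def
    using tau_projective[OF assms] lhom_zero_ldim_0[OF _ lzero_mods] assms(1) by fastforce
qed

text \<open>Only the augmentation changes: composing \<open>q\<close> with an isomorphism preserves
  its kernel, its surjectivity and its right minimality.\<close>

lemma min_proj_pres_liso:
  fixes M M' :: "('k::field, 'a) lmod"
  assumes C: "\<C> \<subseteq> mods A" and M: "M \<in> mods A" and M': "M' \<in> mods A" and iso: "liso A M M'"
    and pres: "min_proj_pres A \<C> P1 P0 p q M"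
  shows "\<exists>q'. min_proj_pres A \<C> P1 P0 p q' M'"
proof -
  obtain f g where f: "f \<in> lhom A M M'" and g: "g \<in> lhom A M' M" and gf: "g * f = 1\<^sub>m (ldim M)"
    and fg: "f * g = 1\<^sub>m (ldim M')"
    using iso by (auto simp: liso_def)
  have q: "q \<in> lhom A P0 M" and P0: "P0 \<in> mods A" and su: "mat_surj q" and ker: "mat_kernel q = mat_image p"
    and rm: "right_minimal A P0 q"
    using pres C by (auto simp: min_proj_pres_def projective_in_def)
  note c = q[THEN lhomD(1)] f[THEN lhomD(1)] g[THEN lhomD(1)]
  note [simp] = c[THEN carrier_matD(1)] c[THEN carrier_matD(2)]
  have gfq: "g * (f * q) = q" using gf c by (simp flip: mult_mat_assoc)
  have "mat_surj (f * q)"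
    unfolding mat_surj_def mat_image_def
  proof (intro equalityI subsetI)
    fix y :: "'k vec" assume "y \<in> carrier_vec (dim_row (f * q))"
    then have y: "y \<in> carrier_vec (ldim M')" by simp
    then have "g *\<^sub>v y \<in> mat_image q" using su c by (auto simp: mat_surj_def)
    then obtain x where x: "x \<in> carrier_vec (ldim P0)" "g *\<^sub>v y = q *\<^sub>v x" by (auto simp: mat_image_def)
    have "f * q *\<^sub>v x = f *\<^sub>v (g *\<^sub>v y)" using x assoc_mult_mat_vec[OF c(2,1) x(1)] by simp
    also have "\<dots> = y" using assoc_mult_mat_vec[OF c(2,3) y] fg y by simp
    finally show "y \<in> (\<lambda>v. f * q *\<^sub>v v) ` carrier_vec (dim_col (f * q))" using x by force
  qed (auto intro!: mult_mat_vec_carrier[OF mult_carrier_mat[OF c(2,1)]])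
  moreover have "mat_kernel (f * q) = mat_kernel q"
  proof
    show "mat_kernel q \<subseteq> mat_kernel (f * q)" by (rule mat_kernel_mult_subset[OF c(1,2)])
    have "mat_kernel (f * q) \<subseteq> mat_kernel (g * (f * q))"
      using c by (intro mat_kernel_mult_subset) auto
    then show "mat_kernel (f * q) \<subseteq> mat_kernel q" unfolding gfq .
  qed
  moreover have "right_minimal A P0 (f * q)"
    unfolding right_minimal_def
  proof (intro ballI impI)
    fix e assume e: "e \<in> lhom A P0 P0" "f * q * e = f * q"
    note [simp] = e(1)[THEN lhomD(1), THEN carrier_matD(1)]
    have "q * e = g * (f * q * e)" using gfq by (simp flip: mult_mat_assoc)
    also have "\<dots> = q" using e(2) gfq by simp
    finally show "\<exists>e'\<in>lhom A P0 P0. e * e' = 1\<^sub>m (ldim P0) \<and> e' * e = 1\<^sub>m (ldim P0)"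
      using rm e(1) by (auto simp: right_minimal_def)
  qed
  ultimately have "min_proj_pres A \<C> P1 P0 p (f * q) M'"
    using pres ker lhom_comp[OF P0 M M' q f] by (simp add: min_proj_pres_def)
  then show ?thesis by blast
qed

text \<open>\<open>is_tau\<close> refers to the module only through a minimal presentation, so
  isomorphic modules have the same translates.\<close>

lemma tau_rigid_in_liso:
  assumes M': "M' \<in> mods A" and iso: "liso A M M'" and t: "tau_rigid_in A (mods A) M"
  shows "tau_rigid_in A (mods A) M'"
proof -
  obtain T where T: "is_tau A (mods A) M T" "lhom_zero A M T" and M: "M \<in> mods A"
    using t by (auto simp: tau_rigid_in_def)
  have Tm: "T \<in> mods A" using T(1) by (simp add: is_tau_def)
  have "is_tau A (mods A) M' T"
    using T(1) unfolding is_tau_def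
    by (elim conjE exE) (drule min_proj_pres_liso[OF order_refl M M' iso], elim exE, intro conjI exI, assumption+)
  moreover have "lhom_zero A M' T"
    by (rule lhom_zero_liso[OF M M' Tm Tm iso liso_refl[OF Tm] T(2)])
  ultimately show ?thesis using M' by (auto simp: tau_rigid_in_def)
qed

section \<open>The Kronecker algebra\<close>

abbreviation kronecker_algebra :: "('k::field, nat \<times> nat list \<Rightarrow> 'k) module" where
  "kronecker_algebra \<equiv> path_algebra kronecker_quiver"

definition kronecker_paths :: "(nat \<times> nat list) set" where
  "kronecker_paths = {(1, []), (2, []), (1, [1]), (1, [2])}"

text \<open>Every arc runs from 1 to 2, so no two arcs can be composed and only four paths
  remain.\<close>

lemma kronecker_awalk:
  "(\<exists>w. pre_digraph.awalk kronecker_quiver v es w) \<longleftrightarrow> (v, es) \<in> kronecker_paths"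
proof -
  consider "es = []" | e where "es = [e]" | e f es' where "es = e # f # es'"
    by (metis neq_Nil_conv)
  then show ?thesis
    by cases (auto simp: pre_digraph.awalk_def pre_digraph.cas.simps kronecker_quiver_def kronecker_paths_def)
qed

lemma kronecker_carrier:
  "x \<in> carrier kronecker_algebra \<longleftrightarrow> (\<forall>p. p \<notin> kronecker_paths \<longrightarrow> x p = 0)"
proof -
  have "finite {p. x p \<noteq> 0}" if "\<forall>p. p \<notin> kronecker_paths \<longrightarrow> x p = 0"
    by (rule finite_subset[of _ kronecker_paths]) (use that in \<open>auto simp: kronecker_paths_def\<close>)
  then show ?thesis
    unfolding path_algebra_def partial_object.simps mem_Collect_eq kronecker_awalk by (auto simp: split_paired_all)
qed

lemma kronecker_eqI:
  assumes "x \<in> carrier kronecker_algebra" "y \<in> carrier kronecker_algebra"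
    "x (1, []) = y (1, [])" "x (2, []) = y (2, [])" "x (1, [1]) = y (1, [1])" "x (1, [2]) = y (1, [2])"
  shows "x = y"
proof
  fix p show "x p = y p"
  proof (cases "p \<in> kronecker_paths")
    case True then show ?thesis using assms(3-6) by (auto simp: kronecker_paths_def)
  next
    case False then show ?thesis using assms(1,2) unfolding kronecker_carrier by metis
  qed
qed

text \<open>A path with one arc is cut either before the arc or after it; in the second case the
  remainder is the trivial path at 2, the head of every arc.\<close>

lemma kronecker_mult:
  "(x \<otimes>\<^bsub>kronecker_algebra\<^esub> y) (v, []) = x (v, []) * y (v, [])"
  "(x \<otimes>\<^bsub>kronecker_algebra\<^esub> y) (v, [j]) = x (v, [j]) * y (v, []) + x (2, []) * y (v, [j])"
  by (simp_all add: path_algebra_def pre_digraph.awalk_verts.simps kronecker_quiver_def atMost_Suc)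

lemma kronecker_ops:
  "(x \<oplus>\<^bsub>kronecker_algebra\<^esub> y) p = x p + y p"
  "(c \<odot>\<^bsub>kronecker_algebra\<^esub> x) p = c * x p"
  "\<one>\<^bsub>kronecker_algebra\<^esub> (v, es) = (if (v = 1 \<or> v = 2) \<and> es = [] then 1 else 0)"
  by (simp_all add: path_algebra_def kronecker_quiver_def)

lemma kronecker_closed:
  "x \<in> carrier kronecker_algebra \<Longrightarrow> y \<in> carrier kronecker_algebra \<Longrightarrow>
    x \<otimes>\<^bsub>kronecker_algebra\<^esub> y \<in> carrier kronecker_algebra"
  "x \<in> carrier kronecker_algebra \<Longrightarrow> y \<in> carrier kronecker_algebra \<Longrightarrow>
    x \<oplus>\<^bsub>kronecker_algebra\<^esub> y \<in> carrier kronecker_algebra"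
  "x \<in> carrier kronecker_algebra \<Longrightarrow> c \<odot>\<^bsub>kronecker_algebra\<^esub> x \<in> carrier kronecker_algebra"
  "\<one>\<^bsub>kronecker_algebra\<^esub> \<in> carrier kronecker_algebra"
proof -
  assume x: "x \<in> carrier kronecker_algebra" and y: "y \<in> carrier kronecker_algebra"
  show "x \<otimes>\<^bsub>kronecker_algebra\<^esub> y \<in> carrier kronecker_algebra"
    unfolding kronecker_carrier
  proof (intro allI impI)
    fix p assume p: "p \<notin> kronecker_paths"
    obtain v es where ves: "p = (v, es)" by force
    \<comment> \<open>In a nonzero summand both pieces are among the four paths. If the initial
      piece is an arc, the rest starts at 2 and is trivial, so the whole is again one of the four
      paths.\<close>
    have "x (pre_digraph.awlast kronecker_quiver v (take i es), drop i es) * y (v, take i es) = 0" for i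
    proof (rule ccontr)
      assume "\<not> ?thesis"
      then have "(pre_digraph.awlast kronecker_quiver v (take i es), drop i es) \<in> kronecker_paths"
        "(v, take i es) \<in> kronecker_paths"
        using x y unfolding kronecker_carrier by auto
      moreover have "pre_digraph.awlast kronecker_quiver v [e] = 2" "pre_digraph.awlast kronecker_quiver v [] = v" for e
        by (simp_all add: pre_digraph.awalk_verts.simps kronecker_quiver_def)
      moreover have "es = take i es @ drop i es" by simp
      ultimately have "(v, es) \<in> kronecker_paths"
        unfolding kronecker_paths_def by (smt (verit) append_Nil append_Nil2 insert_iff prod.inject singletonD list.distinct(1) numeral_eq_one_iff semiring_norm(85))
      then show False using p ves by simp
    qed
    then show "(x \<otimes>\<^bsub>kronecker_algebra\<^esub> y) p = 0" by (simp add: ves path_algebra_def)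
  qed
qed (auto simp: kronecker_carrier kronecker_ops kronecker_paths_def split_paired_all)

definition path_elt :: "nat \<times> nat list \<Rightarrow> nat \<times> nat list \<Rightarrow> 'k::field" where
  "path_elt p = (\<lambda>q. if q = p then 1 else 0)"

lemma path_elt_closed: "p \<in> kronecker_paths \<Longrightarrow> path_elt p \<in> carrier kronecker_algebra"
  by (auto simp: kronecker_carrier path_elt_def)

text \<open>The versions with \<open>Suc 0\<close> serve goals in which the simplifier has already
  rewritten \<open>1\<close>.\<close>

lemma path_elt_in_carrier [simp]:
  "path_elt (1, []) \<in> carrier kronecker_algebra" "path_elt (2, []) \<in> carrier kronecker_algebra"
  "path_elt (1, [1]) \<in> carrier kronecker_algebra" "path_elt (1, [2]) \<in> carrier kronecker_algebra"
  "path_elt (Suc 0, []) \<in> carrier kronecker_algebra"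
  "path_elt (Suc 0, [Suc 0]) \<in> carrier kronecker_algebra" "path_elt (Suc 0, [2]) \<in> carrier kronecker_algebra"
  by (auto intro!: path_elt_closed simp: kronecker_paths_def)

text \<open>The left ideal of a basis element is read off from the paths extending it; only the
  trivial path at 1 can be extended. The last equation holds because no arc ends at 1.\<close>

lemma mult_path_elt:
  assumes a: "a \<in> carrier kronecker_algebra"
  shows "a \<otimes>\<^bsub>kronecker_algebra\<^esub> path_elt (1, []) =
      (a (1, []) \<odot>\<^bsub>kronecker_algebra\<^esub> path_elt (1, [])) \<oplus>\<^bsub>kronecker_algebra\<^esub>
      ((a (1, [1]) \<odot>\<^bsub>kronecker_algebra\<^esub> path_elt (1, [1])) \<oplus>\<^bsub>kronecker_algebra\<^esub>
       (a (1, [2]) \<odot>\<^bsub>kronecker_algebra\<^esub> path_elt (1, [2])))"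
    "a \<otimes>\<^bsub>kronecker_algebra\<^esub> path_elt (2, []) = a (2, []) \<odot>\<^bsub>kronecker_algebra\<^esub> path_elt (2, [])"
    "a \<otimes>\<^bsub>kronecker_algebra\<^esub> path_elt (1, [1]) = a (2, []) \<odot>\<^bsub>kronecker_algebra\<^esub> path_elt (1, [1])"
    "a \<otimes>\<^bsub>kronecker_algebra\<^esub> path_elt (1, [2]) = a (2, []) \<odot>\<^bsub>kronecker_algebra\<^esub> path_elt (1, [2])"
    "path_elt (1, []) \<otimes>\<^bsub>kronecker_algebra\<^esub> a = a (1, []) \<odot>\<^bsub>kronecker_algebra\<^esub> path_elt (1, [])"
  by (rule kronecker_eqI; auto simp: kronecker_mult kronecker_ops path_elt_def a
      intro!: kronecker_closed path_elt_closed[unfolded path_elt_def] simp: kronecker_paths_def)+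

lemma kronecker_one: "\<one>\<^bsub>kronecker_algebra\<^esub> = path_elt (1, []) \<oplus>\<^bsub>kronecker_algebra\<^esub> path_elt (2, [])"
  by (rule kronecker_eqI) (auto simp: kronecker_ops path_elt_def
      intro!: kronecker_closed path_elt_closed[unfolded path_elt_def] simp: kronecker_paths_def)

section \<open>Powers of simple modules and cyclic projectives\<close>

definition vertex_module :: "nat \<Rightarrow> nat \<Rightarrow> ('k::field, nat \<times> nat list \<Rightarrow> 'k) lmod" where
  "vertex_module v n = LMod n (\<lambda>a. a (v, []) \<cdot>\<^sub>m 1\<^sub>m n)"

lemma vertex_module_simps [simp]:
  "ldim (vertex_module v n) = n" "lact (vertex_module v n) a = a (v, []) \<cdot>\<^sub>m 1\<^sub>m n"
  by (simp_all add: vertex_module_def)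

lemma vertex_module_mods:
  assumes "v = 1 \<or> v = 2"
  shows "vertex_module v n \<in> mods kronecker_algebra"
  unfolding mods_def
  using assms by (auto simp: kronecker_mult kronecker_ops mult_mat_smult intro!: eq_matI)

lemma lsum_vertex_module: "lsum (vertex_module v m) (vertex_module v n) = vertex_module v (m + n)"
proof -
  have "four_block_mat (c \<cdot>\<^sub>m 1\<^sub>m m) (0\<^sub>m m n) (0\<^sub>m n m) (c \<cdot>\<^sub>m 1\<^sub>m n) = (c :: 'a) \<cdot>\<^sub>m 1\<^sub>m (m + n)" for c
    by (intro eq_matI) auto
  then show ?thesis by (simp add: lsum_def vertex_module_def)
qed

lemma smult_mat_mult_vec:
  fixes A :: "'k::field mat"
  assumes "v \<in> carrier_vec (dim_col A)"
  shows "(c \<cdot>\<^sub>m A) *\<^sub>v v = c \<cdot>\<^sub>v (A *\<^sub>v v)"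
  using assms by (intro eq_vecI) auto

text \<open>The hypotheses express that \<open>P\<close> is the left ideal generated by the
  idempotent: maps from \<open>P\<close> to a module correspond to the vectors of that module fixed
  by the idempotent.\<close>

lemma cyclic_projective:
  fixes P :: "('k::field, 'a) lmod"
  assumes P: "P \<in> mods A" and u: "u \<in> carrier_vec (ldim P)"
    and \<epsilon>: "\<epsilon> \<in> carrier A" "\<epsilon> \<otimes>\<^bsub>A\<^esub> \<epsilon> = \<epsilon>" "lact P \<epsilon> *\<^sub>v u = u"
    and ex: "\<And>M v. M \<in> mods A \<Longrightarrow> v \<in> carrier_vec (ldim M) \<Longrightarrow> lact M \<epsilon> *\<^sub>v v = v \<Longrightarrow> \<exists>h\<in>lhom A P M. h *\<^sub>v u = v"
    and unique: "\<And>M h h'. M \<in> mods A \<Longrightarrow> h \<in> lhom A P M \<Longrightarrow> h' \<in> lhom A P M \<Longrightarrow> h *\<^sub>v u = h' *\<^sub>v u \<Longrightarrow> h = h'"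
  shows "projective_in A (mods A) P"
  unfolding projective_in_def
proof (intro conjI P ballI impI)
  fix X Y e f assume X: "X \<in> mods A" and Y: "Y \<in> mods A" and e: "e \<in> lhom A X Y" and f: "f \<in> lhom A P Y"
    and su: "mat_surj e"
  note ce = lhomD(1)[OF e] and cf = lhomD(1)[OF f]
  have "f *\<^sub>v u \<in> mat_image e" using su cf u ce by (auto simp: mat_surj_def)
  then obtain x where x: "x \<in> carrier_vec (ldim X)" and ex: "e *\<^sub>v x = f *\<^sub>v u"
    using ce by (auto simp: mat_image_def)
  \<comment> \<open>A preimage of \<open>f *\<^sub>v u\<close> need not be fixed by the idempotent;
    applying the idempotent makes it fixed and leaves its image unchanged.\<close>
  let ?x = "lact X \<epsilon> *\<^sub>v x"
  have "lact X \<epsilon> *\<^sub>v ?x = ?x"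
    using modsD(3)[OF X \<epsilon>(1) \<epsilon>(1)] modsD(1)[OF X \<epsilon>(1)] x \<epsilon>(2) by (metis assoc_mult_mat_vec)
  moreover have "?x \<in> carrier_vec (ldim X)" using modsD(1)[OF X \<epsilon>(1)] x by auto
  ultimately obtain h where h: "h \<in> lhom A P X" "h *\<^sub>v u = ?x" using assms(6)[OF X] by blast
  have "e * h = f"
  proof (rule unique[OF Y lhom_comp[OF P X Y h(1) e] f])
    have "e * h *\<^sub>v u = e *\<^sub>v ?x" using assoc_mult_mat_vec[OF ce lhomD(1)[OF h(1)] u] h(2) by simp
    also have "\<dots> = lact Y \<epsilon> *\<^sub>v (f *\<^sub>v u)" using lhom_vec[OF e X Y \<epsilon>(1) x] ex by simp
    also have "\<dots> = f *\<^sub>v u" using lhom_vec[OF f P Y \<epsilon>(1) u] \<epsilon>(3) by simp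
    finally show "e * h *\<^sub>v u = f *\<^sub>v u" .
  qed
  then show "\<exists>h\<in>lhom A P X. e * h = f" using h(1) by blast
qed

text \<open>A map out of a one-dimensional module is a common eigenvector with the same character
  \<open>c\<close>.\<close>

lemma lhom_1_dim:
  fixes M N :: "('k::field, 'a) lmod"
  assumes M: "ldim M = 1" and N: "N \<in> mods A" and v: "v \<in> carrier_vec (ldim N)"
    and act: "\<And>a. a \<in> carrier A \<Longrightarrow> lact M a = c a \<cdot>\<^sub>m 1\<^sub>m 1 \<and> lact N a *\<^sub>v v = c a \<cdot>\<^sub>v v"
  shows "mat_of_cols (ldim N) [v] \<in> lhom A M N" "mat_of_cols (ldim N) [v] *\<^sub>v unit_vec 1 0 = v"
proof -
  let ?h = "mat_of_cols (ldim N) [v]"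
  have ch: "?h \<in> carrier_mat (ldim N) 1" using mat_of_cols_carrier(1)[of "ldim N" "[v]"] by simp
  have col: "col ?h 0 = v" using v by (subst col_mat_of_cols) auto
  then show "?h *\<^sub>v unit_vec 1 0 = v" using mat_mult_unit_vec[OF ch, of 0] by simp
  show "?h \<in> lhom A M N"
  proof (rule lhomI)
    show "?h \<in> carrier_mat (ldim N) (ldim M)" using ch M by simp
    fix a assume a: "a \<in> carrier A"
    note cN = modsD(1)[OF N a]
    have "?h * lact M a = c a \<cdot>\<^sub>m ?h" using act[OF a] ch by (simp add: mult_mat_smult(2))
    moreover have "lact N a * ?h = c a \<cdot>\<^sub>m ?h"
    proof (rule mat_col_eqI)
      fix j assume "j < dim_col (c a \<cdot>\<^sub>m ?h)"
      then have j: "j = 0" using ch by simp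
      show "col (lact N a * ?h) j = col (c a \<cdot>\<^sub>m ?h) j"
        unfolding j using col_mult2[OF cN ch, of 0] col act[OF a] ch by simp
    qed (use cN ch in auto)
    ultimately show "?h * lact M a = lact N a * ?h" by simp
  qed
qed

lemma path_elt_mult_vec:
  fixes M :: "('k::field, nat \<times> nat list \<Rightarrow> 'k) lmod"
  assumes M: "M \<in> mods kronecker_algebra" and a: "a \<in> carrier kronecker_algebra" and v: "v \<in> carrier_vec (ldim M)"
  shows "lact M a *\<^sub>v (lact M (path_elt (1, [])) *\<^sub>v v) = a (1, []) \<cdot>\<^sub>v (lact M (path_elt (1, [])) *\<^sub>v v) +
      (a (1, [1]) \<cdot>\<^sub>v (lact M (path_elt (1, [1])) *\<^sub>v v) + a (1, [2]) \<cdot>\<^sub>v (lact M (path_elt (1, [2])) *\<^sub>v v))"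
    "lact M a *\<^sub>v (lact M (path_elt (2, [])) *\<^sub>v v) = a (2, []) \<cdot>\<^sub>v (lact M (path_elt (2, [])) *\<^sub>v v)"
    "lact M a *\<^sub>v (lact M (path_elt (1, [1])) *\<^sub>v v) = a (2, []) \<cdot>\<^sub>v (lact M (path_elt (1, [1])) *\<^sub>v v)"
    "lact M a *\<^sub>v (lact M (path_elt (1, [2])) *\<^sub>v v) = a (2, []) \<cdot>\<^sub>v (lact M (path_elt (1, [2])) *\<^sub>v v)"
proof -
  have assoc: "lact M a *\<^sub>v (lact M b *\<^sub>v v) = lact M (a \<otimes>\<^bsub>kronecker_algebra\<^esub> b) *\<^sub>v v"
    if b: "b \<in> carrier kronecker_algebra" for b
    using modsD(3)[OF M a b] assoc_mult_mat_vec[OF modsD(1)[OF M a] modsD(1)[OF M b] v] by simp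
  have sm: "lact M (c \<odot>\<^bsub>kronecker_algebra\<^esub> b) *\<^sub>v v = c \<cdot>\<^sub>v (lact M b *\<^sub>v v)"
    if b: "b \<in> carrier kronecker_algebra" for b c
    using modsD(5)[OF M b] modsD(1)[OF M b] v by (simp add: smult_mat_mult_vec)
  have ad: "lact M (b \<oplus>\<^bsub>kronecker_algebra\<^esub> c) *\<^sub>v v = lact M b *\<^sub>v v + lact M c *\<^sub>v v"
    if b: "b \<in> carrier kronecker_algebra" and c: "c \<in> carrier kronecker_algebra" for b c
    using modsD(4)[OF M b c] add_mult_distrib_mat_vec[OF modsD(1)[OF M b] modsD(1)[OF M c] v] by simp
  show "lact M a *\<^sub>v (lact M (path_elt (1, [])) *\<^sub>v v) = a (1, []) \<cdot>\<^sub>v (lact M (path_elt (1, [])) *\<^sub>v v) +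
      (a (1, [1]) \<cdot>\<^sub>v (lact M (path_elt (1, [1])) *\<^sub>v v) + a (1, [2]) \<cdot>\<^sub>v (lact M (path_elt (1, [2])) *\<^sub>v v))"
    unfolding assoc[OF path_elt_in_carrier(1)] mult_path_elt(1)[OF a]
    by (simp only: ad sm kronecker_closed path_elt_in_carrier)
  show "lact M a *\<^sub>v (lact M (path_elt (2, [])) *\<^sub>v v) = a (2, []) \<cdot>\<^sub>v (lact M (path_elt (2, [])) *\<^sub>v v)"
    unfolding assoc[OF path_elt_in_carrier(2)] mult_path_elt(2)[OF a] by (rule sm[OF path_elt_in_carrier(2)])
  show "lact M a *\<^sub>v (lact M (path_elt (1, [1])) *\<^sub>v v) = a (2, []) \<cdot>\<^sub>v (lact M (path_elt (1, [1])) *\<^sub>v v)"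
    unfolding assoc[OF path_elt_in_carrier(3)] mult_path_elt(3)[OF a] by (rule sm[OF path_elt_in_carrier(3)])
  show "lact M a *\<^sub>v (lact M (path_elt (1, [2])) *\<^sub>v v) = a (2, []) \<cdot>\<^sub>v (lact M (path_elt (1, [2])) *\<^sub>v v)"
    unfolding assoc[OF path_elt_in_carrier(4)] mult_path_elt(4)[OF a] by (rule sm[OF path_elt_in_carrier(4)])
qed

abbreviation simple2 :: "('k::field, nat \<times> nat list \<Rightarrow> 'k) lmod" where
  "simple2 \<equiv> vertex_module 2 1"

lemma simple2_mods: "simple2 \<in> mods kronecker_algebra"
  by (rule vertex_module_mods) simp

lemma simple2_hom:
  assumes M: "M \<in> mods kronecker_algebra" and v: "v \<in> carrier_vec (ldim M)"
    and fix': "lact M (path_elt (2, [])) *\<^sub>v v = v"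
  shows "\<exists>h\<in>lhom kronecker_algebra simple2 M. h *\<^sub>v unit_vec 1 0 = v"
proof -
  have "lact M a *\<^sub>v v = a (2, []) \<cdot>\<^sub>v v" if "a \<in> carrier kronecker_algebra" for a
    using path_elt_mult_vec(2)[OF M that v] fix' by simp
  then show ?thesis
    using lhom_1_dim[of simple2 M kronecker_algebra v "\<lambda>a. a (2, [])"] M v by auto
qed

lemma simple2_hom_unique:
  assumes "h \<in> lhom kronecker_algebra simple2 M" "h' \<in> lhom kronecker_algebra simple2 M"
    "h *\<^sub>v unit_vec 1 0 = h' *\<^sub>v unit_vec 1 0"
  shows "h = h'"
proof -
  have c: "h \<in> carrier_mat (ldim M) 1" "h' \<in> carrier_mat (ldim M) 1"
    using assms(1,2)[THEN lhomD(1)] by simp_all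
  have "col h 0 = col h' 0"
    using assms(3) mat_mult_unit_vec[OF c(1), of 0] mat_mult_unit_vec[OF c(2), of 0] by simp
  then show ?thesis using c by (intro mat_col_eqI) auto
qed

lemma path_elt_idem:
  "path_elt (1, []) \<otimes>\<^bsub>kronecker_algebra\<^esub> path_elt (1, []) = path_elt (1, [])"
  "path_elt (2, []) \<otimes>\<^bsub>kronecker_algebra\<^esub> path_elt (2, []) = path_elt (2, [])"
proof -
  show "path_elt (1, []) \<otimes>\<^bsub>kronecker_algebra\<^esub> path_elt (1, []) = path_elt (1, [])"
    unfolding mult_path_elt(5)[OF path_elt_in_carrier(1)] by (rule ext) (simp add: kronecker_ops path_elt_def)
  show "path_elt (2, []) \<otimes>\<^bsub>kronecker_algebra\<^esub> path_elt (2, []) = path_elt (2, [])"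
    unfolding mult_path_elt(2)[OF path_elt_in_carrier(2)] by (rule ext) (simp add: kronecker_ops path_elt_def)
qed

text \<open>Vertex 2 is a sink, so the left ideal of its trivial path is one-dimensional and equals
  the simple module.\<close>

lemma simple2_projective: "projective_in kronecker_algebra (mods kronecker_algebra) simple2"
proof (rule cyclic_projective[OF simple2_mods _ path_elt_in_carrier(2) path_elt_idem(2)])
  show "lact simple2 (path_elt (2, [])) *\<^sub>v unit_vec 1 0 = unit_vec 1 0"
    by (simp add: path_elt_def smult_mat_mult_vec)
qed (use simple2_hom simple2_hom_unique in auto)

text \<open>The left ideal of the trivial path at 1, in the basis of the paths starting at 1: each
  column is the product of \<open>a\<close> with one such path, as computed in
  \<open>mult_path_elt\<close>.\<close>

definition proj1 :: "('k::field, nat \<times> nat list \<Rightarrow> 'k) lmod" where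
  "proj1 = LMod 3 (\<lambda>a. mat_of_cols 3
     [a (1, []) \<cdot>\<^sub>v unit_vec 3 0 + (a (1, [1]) \<cdot>\<^sub>v unit_vec 3 1 + a (1, [2]) \<cdot>\<^sub>v unit_vec 3 2),
      a (2, []) \<cdot>\<^sub>v unit_vec 3 1, a (2, []) \<cdot>\<^sub>v unit_vec 3 2])"

lemma ldim_proj1 [simp]: "ldim proj1 = 3"
  by (simp add: proj1_def)

lemma less_3: "i < (3::nat) \<longleftrightarrow> i = 0 \<or> i = 1 \<or> i = 2"
  by auto

lemma lact_proj1_carrier: "lact proj1 a \<in> carrier_mat 3 3"
  by (rule carrier_matI) (simp_all add: proj1_def)

lemma lact_proj1_col:
  "col (lact proj1 a) 0 = a (1, []) \<cdot>\<^sub>v unit_vec 3 0 + (a (1, [1]) \<cdot>\<^sub>v unit_vec 3 1 + a (1, [2]) \<cdot>\<^sub>v unit_vec 3 2)"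
  "col (lact proj1 a) 1 = a (2, []) \<cdot>\<^sub>v unit_vec 3 1"
  "col (lact proj1 a) 2 = a (2, []) \<cdot>\<^sub>v unit_vec 3 2"
  unfolding proj1_def lmod.sel by (subst col_mat_of_cols; simp)+

lemma lact_proj1_unit:
  "lact proj1 a *\<^sub>v unit_vec 3 0 = a (1, []) \<cdot>\<^sub>v unit_vec 3 0 + (a (1, [1]) \<cdot>\<^sub>v unit_vec 3 1 + a (1, [2]) \<cdot>\<^sub>v unit_vec 3 2)"
  "lact proj1 a *\<^sub>v unit_vec 3 1 = a (2, []) \<cdot>\<^sub>v unit_vec 3 1"
  "lact proj1 a *\<^sub>v unit_vec 3 2 = a (2, []) \<cdot>\<^sub>v unit_vec 3 2"
  using lact_proj1_col[of a] mat_mult_unit_vec[OF lact_proj1_carrier[of a]] by simp_all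

lemma mat_eq_3I:
  assumes "A \<in> carrier_mat n 3" "B \<in> carrier_mat n 3" "col A 0 = col B 0" "col A 1 = col B 1" "col A 2 = col B 2"
  shows "A = B"
proof (rule mat_col_eqI)
  fix j assume "j < dim_col B"
  then show "col A j = col B j" using assms less_3[of j] by auto
qed (use assms in auto)

lemma mult_vec_3:
  fixes H :: "'k::field mat"
  assumes H: "H \<in> carrier_mat n 3"
  shows "H *\<^sub>v (a \<cdot>\<^sub>v unit_vec 3 0 + (b \<cdot>\<^sub>v unit_vec 3 1 + c \<cdot>\<^sub>v unit_vec 3 2)) =
    a \<cdot>\<^sub>v col H 0 + (b \<cdot>\<^sub>v col H 1 + c \<cdot>\<^sub>v col H 2)"
proof -
  have *: "H *\<^sub>v (x \<cdot>\<^sub>v unit_vec 3 i) = x \<cdot>\<^sub>v col H i" if "i < 3" for x i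
    using mult_mat_vec[OF H, of "unit_vec 3 i" x] mat_mult_unit_vec[OF H that] by simp
  have c: "x \<cdot>\<^sub>v unit_vec 3 i \<in> carrier_vec 3" for x :: 'k and i by simp
  show ?thesis
    unfolding mult_add_distrib_mat_vec[OF H c add_carrier_vec[OF c c]] mult_add_distrib_mat_vec[OF H c c]
    by (simp add: *)
qed

lemma proj1_mods: "proj1 \<in> mods kronecker_algebra"
proof -
  have c: "lact proj1 (a :: nat \<times> nat list \<Rightarrow> 'a) \<in> carrier_mat 3 3" for a by (rule lact_proj1_carrier)
  have u: "(unit_vec 3 i :: 'a vec) \<in> carrier_vec 3" for i by simp
  have s: "x \<cdot>\<^sub>v (unit_vec 3 i :: 'a vec) \<in> carrier_vec 3" for x i by simp
  have m: "lact proj1 a *\<^sub>v (x \<cdot>\<^sub>v unit_vec 3 i) = x \<cdot>\<^sub>v (lact proj1 a *\<^sub>v unit_vec 3 i)" for a and x :: 'a and i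
    by (rule mult_mat_vec[OF c u])
  have mult: "lact proj1 (a \<otimes>\<^bsub>kronecker_algebra\<^esub> b) = lact proj1 a * lact proj1 b"
    for a b :: "nat \<times> nat list \<Rightarrow> 'a"
  proof (rule mat_eq_3I[OF c mult_carrier_mat[OF c c]])
    show "col (lact proj1 (a \<otimes>\<^bsub>kronecker_algebra\<^esub> b)) 0 = col (lact proj1 a * lact proj1 b) 0"
      by (subst col_mult2[OF c c], simp, unfold lact_proj1_col(1),
          unfold mult_add_distrib_mat_vec[OF c s add_carrier_vec[OF s s]] mult_add_distrib_mat_vec[OF c s s] m lact_proj1_unit
            kronecker_mult)
        (auto intro!: eq_vecI simp: less_3 algebra_simps)
    show "col (lact proj1 (a \<otimes>\<^bsub>kronecker_algebra\<^esub> b)) 1 = col (lact proj1 a * lact proj1 b) 1"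
      by (subst col_mult2[OF c c], simp, unfold lact_proj1_col m lact_proj1_unit kronecker_mult)
        (simp add: smult_smult_assoc mult.commute)
    show "col (lact proj1 (a \<otimes>\<^bsub>kronecker_algebra\<^esub> b)) 2 = col (lact proj1 a * lact proj1 b) 2"
      by (subst col_mult2[OF c c], simp, unfold lact_proj1_col m lact_proj1_unit kronecker_mult)
        (simp add: smult_smult_assoc mult.commute)
  qed
  have add: "lact proj1 (a \<oplus>\<^bsub>kronecker_algebra\<^esub> b) = lact proj1 a + lact proj1 b"
    for a b :: "nat \<times> nat list \<Rightarrow> 'a"
  proof -
    have col: "col (lact proj1 a + lact proj1 b) j = col (lact proj1 a) j + col (lact proj1 b) j" if "j < 3" for j
      using that carrier_matD[OF c[of a]] carrier_matD[OF c[of b]] by (intro eq_vecI) auto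
    have 0: "0 < (3::nat)" and 1: "1 < (3::nat)" and 2: "2 < (3::nat)" by auto
    show ?thesis
      by (rule mat_eq_3I[OF c add_carrier_mat[OF c]];
          unfold col[OF 0] col[OF 1] col[OF 2] lact_proj1_col kronecker_ops)
        (auto intro!: eq_vecI simp: less_3 algebra_simps)
  qed
  have smult: "lact proj1 (x \<odot>\<^bsub>kronecker_algebra\<^esub> a) = x \<cdot>\<^sub>m lact proj1 a"
    for a :: "nat \<times> nat list \<Rightarrow> 'a" and x
    by (rule mat_eq_3I[OF c smult_carrier_mat[OF c]])
      (simp_all add: col_smult carrier_matD[OF c] lact_proj1_col[unfolded One_nat_def] kronecker_ops smult_add_distrib_vec[of _ 3] smult_smult_assoc
        mult.commute)
  have one: "lact proj1 \<one>\<^bsub>kronecker_algebra\<^esub> = (1\<^sub>m 3 :: 'a mat)"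
    by (rule mat_eq_3I[OF c one_carrier_mat], unfold lact_proj1_col kronecker_ops)
      (auto intro!: eq_vecI simp: less_3)
  show ?thesis unfolding mods_def using c mult add smult one by simp
qed

abbreviation kmods :: "('k::field, nat \<times> nat list \<Rightarrow> 'k) lmod set" where
  "kmods \<equiv> mods kronecker_algebra"

lemma path_elt_fixed:
  fixes M :: "('k::field, nat \<times> nat list \<Rightarrow> 'k) lmod"
  assumes M: "M \<in> kmods" and v: "v \<in> carrier_vec (ldim M)"
  shows "lact M (path_elt (1, [])) *\<^sub>v (lact M (path_elt (1, [])) *\<^sub>v v) = lact M (path_elt (1, [])) *\<^sub>v v"
    "lact M (path_elt (2, [])) *\<^sub>v (lact M (path_elt (2, [])) *\<^sub>v v) = lact M (path_elt (2, [])) *\<^sub>v v"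
  using modsD(3)[OF M path_elt_in_carrier(1) path_elt_in_carrier(1)] modsD(3)[OF M path_elt_in_carrier(2) path_elt_in_carrier(2)]
    assoc_mult_mat_vec[OF modsD(1)[OF M path_elt_in_carrier(1)] modsD(1)[OF M path_elt_in_carrier(1)] v]
    assoc_mult_mat_vec[OF modsD(1)[OF M path_elt_in_carrier(2)] modsD(1)[OF M path_elt_in_carrier(2)] v]
  unfolding path_elt_idem by simp_all

lemma proj1_generators:
  "lact proj1 (path_elt (1, [])) *\<^sub>v unit_vec 3 0 = unit_vec 3 0"
  "lact proj1 (path_elt (1, [1])) *\<^sub>v unit_vec 3 0 = unit_vec 3 1"
  "lact proj1 (path_elt (1, [2])) *\<^sub>v unit_vec 3 0 = unit_vec 3 2"
  unfolding lact_proj1_unit by (auto simp: path_elt_def less_3 intro!: eq_vecI)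

text \<open>The image \<open>v\<close> of the generator dictates the matrix, since the other two
  basis vectors are the two arcs applied to the generator.\<close>

lemma proj1_hom:
  fixes M :: "('k::field, nat \<times> nat list \<Rightarrow> 'k) lmod"
  assumes M: "M \<in> kmods" and v: "v \<in> carrier_vec (ldim M)"
    and fix': "lact M (path_elt (1, [])) *\<^sub>v v = v"
  shows "\<exists>h\<in>lhom kronecker_algebra proj1 M. h *\<^sub>v unit_vec 3 0 = v"
proof -
  let ?x = "lact M (path_elt (1, [1])) *\<^sub>v v" and ?y = "lact M (path_elt (1, [2])) *\<^sub>v v"
  let ?h = "mat_of_cols (ldim M) [v, ?x, ?y]"
  have x: "?x \<in> carrier_vec (ldim M)" and y: "?y \<in> carrier_vec (ldim M)"
    using modsD(1)[OF M path_elt_in_carrier(3)] modsD(1)[OF M path_elt_in_carrier(4)] v by auto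
  have h: "?h \<in> carrier_mat (ldim M) 3" by (rule carrier_matI) simp_all
  have cols: "col ?h 0 = v" "col ?h 1 = ?x" "col ?h 2 = ?y"
    by (subst col_mat_of_cols; use v x y in simp)+
  have "?h \<in> lhom kronecker_algebra proj1 M"
  proof (rule lhomI)
    show "?h \<in> carrier_mat (ldim M) (ldim (proj1 :: ('k, nat \<times> nat list \<Rightarrow> 'k) lmod))" using h by simp
    fix a :: "nat \<times> nat list \<Rightarrow> 'k" assume a: "a \<in> carrier kronecker_algebra"
    note cM = modsD(1)[OF M a]
    have 0: "0 < (3::nat)" and 1: "1 < (3::nat)" and 2: "2 < (3::nat)" by auto
    have hu: "?h *\<^sub>v (c \<cdot>\<^sub>v unit_vec 3 i) = c \<cdot>\<^sub>v col ?h i" if "i < 3" for c i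
      using mult_mat_vec[OF h, of "unit_vec 3 i" c] mat_mult_unit_vec[OF h that] by simp
    show "?h * lact proj1 a = lact M a * ?h"
    proof (rule mat_eq_3I[OF mult_carrier_mat[OF h lact_proj1_carrier] mult_carrier_mat[OF cM h]])
      show "col (?h * lact proj1 a) 0 = col (lact M a * ?h) 0"
        unfolding col_mult2[OF h lact_proj1_carrier 0] col_mult2[OF cM h 0] lact_proj1_col mult_vec_3[OF h] cols
        using path_elt_mult_vec(1)[OF M a v] fix' by simp
      show "col (?h * lact proj1 a) 1 = col (lact M a * ?h) 1"
        unfolding col_mult2[OF h lact_proj1_carrier 1] col_mult2[OF cM h 1] lact_proj1_col hu[OF 1] cols
        using path_elt_mult_vec(3)[OF M a v] by simp
      show "col (?h * lact proj1 a) 2 = col (lact M a * ?h) 2"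
        unfolding col_mult2[OF h lact_proj1_carrier 2] col_mult2[OF cM h 2] lact_proj1_col hu[OF 2] cols
        using path_elt_mult_vec(4)[OF M a v] by simp
    qed
  qed
  moreover have "?h *\<^sub>v unit_vec 3 0 = v" using mat_mult_unit_vec[OF h, of 0] cols(1) by simp
  ultimately show ?thesis by blast
qed

lemma proj1_hom_unique:
  fixes M :: "('k::field, nat \<times> nat list \<Rightarrow> 'k) lmod"
  assumes M: "M \<in> kmods" and h: "h \<in> lhom kronecker_algebra proj1 M" and h': "h' \<in> lhom kronecker_algebra proj1 M"
    and eq: "h *\<^sub>v unit_vec 3 0 = h' *\<^sub>v unit_vec 3 0"
  shows "h = h'"
proof -
  have c: "h \<in> carrier_mat (ldim M) 3" "h' \<in> carrier_mat (ldim M) 3"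
    using lhomD(1)[OF h] lhomD(1)[OF h'] by simp_all
  have u: "unit_vec 3 0 \<in> carrier_vec (ldim (proj1 :: ('k, nat \<times> nat list \<Rightarrow> 'k) lmod))" by simp
  have "col h i = col h' i" if "i < 3" and p: "p \<in> carrier kronecker_algebra"
    "lact proj1 p *\<^sub>v unit_vec 3 0 = (unit_vec 3 i :: 'k vec)" for i p
    using lhom_vec[OF h proj1_mods M p(1) u] lhom_vec[OF h' proj1_mods M p(1) u] eq
      mat_mult_unit_vec[OF c(1) that(1)] mat_mult_unit_vec[OF c(2) that(1)] p(2) by simp
  from this[OF _ path_elt_in_carrier(1) proj1_generators(1)] this[OF _ path_elt_in_carrier(3) proj1_generators(2)]
    this[OF _ path_elt_in_carrier(4) proj1_generators(3)]
  show ?thesis by (intro mat_eq_3I[OF c]) simp_all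
qed

lemma proj1_projective: "projective_in kronecker_algebra kmods proj1"
proof (rule cyclic_projective[OF proj1_mods _ path_elt_in_carrier(1) path_elt_idem(1) proj1_generators(1)])
  show "unit_vec 3 0 \<in> carrier_vec (ldim proj1)" by simp
qed (use proj1_hom proj1_hom_unique in blast)+

lemma proj1_path_elt:
  fixes w :: "'k::field vec"
  assumes w: "w \<in> carrier_vec 3" and fix': "lact proj1 (path_elt (1, [])) *\<^sub>v w = w"
  shows "w = w $ 0 \<cdot>\<^sub>v unit_vec 3 0"
proof -
  have c: "lact proj1 (path_elt (1, [])) \<in> carrier_mat 3 3" by (rule lact_proj1_carrier)
  have w3: "w = w $ 0 \<cdot>\<^sub>v unit_vec 3 0 + (w $ 1 \<cdot>\<^sub>v unit_vec 3 1 + w $ 2 \<cdot>\<^sub>v unit_vec 3 2)"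
    using w by (intro eq_vecI) (auto simp: less_3)
  have "w = lact proj1 (path_elt (1, [])) *\<^sub>v (w $ 0 \<cdot>\<^sub>v unit_vec 3 0 + (w $ 1 \<cdot>\<^sub>v unit_vec 3 1 + w $ 2 \<cdot>\<^sub>v unit_vec 3 2))"
    unfolding w3[symmetric] by (rule fix'[symmetric])
  also have "\<dots> = w $ 0 \<cdot>\<^sub>v unit_vec 3 0"
    unfolding mult_vec_3[OF c] lact_proj1_col by (auto simp: path_elt_def less_3 intro!: eq_vecI)
  finally show ?thesis .
qed

text \<open>An endomorphism is determined by the image of the generator. That image is fixed by the
  trivial path at 1, so it is a multiple of the generator.\<close>

lemma scalar_endos_proj1: "scalar_endos kronecker_algebra (proj1 :: ('k::field, nat \<times> nat list \<Rightarrow> 'k) lmod)"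
  unfolding scalar_endos_def
proof
  fix e :: "'k mat" assume e: "e \<in> lhom kronecker_algebra proj1 proj1"
  let ?P = "proj1 :: ('k, nat \<times> nat list \<Rightarrow> 'k) lmod"
  let ?w = "e *\<^sub>v unit_vec 3 0"
  have ce: "e \<in> carrier_mat 3 3" using lhomD(1)[OF e] by simp
  have u: "unit_vec 3 0 \<in> carrier_vec (ldim ?P)" by simp
  have w: "?w \<in> carrier_vec 3" using ce by simp
  have "lact ?P (path_elt (1, [])) *\<^sub>v ?w = ?w"
    using lhom_vec[OF e proj1_mods proj1_mods path_elt_in_carrier(1) u] unfolding proj1_generators(1) by simp
  then have "?w = ?w $ 0 \<cdot>\<^sub>v unit_vec 3 0" by (rule proj1_path_elt[OF w])
  also have "\<dots> = (?w $ 0 \<cdot>\<^sub>m 1\<^sub>m 3) *\<^sub>v unit_vec 3 0" by (subst smult_mat_mult_vec) simp_all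
  finally have "e = ?w $ 0 \<cdot>\<^sub>m 1\<^sub>m (ldim ?P)"
    using proj1_hom_unique[OF proj1_mods e lhom_smult[OF proj1_mods proj1_mods lhom_id[OF proj1_mods]], of "?w $ 0"]
    by simp
  then show "\<exists>c. e = c \<cdot>\<^sub>m 1\<^sub>m (ldim ?P)" by blast
qed

lemma scalar_endos_1_dim:
  assumes "ldim M = 1"
  shows "scalar_endos A M"
  unfolding scalar_endos_def
proof
  fix e assume "e \<in> lhom A M M"
  then have "e \<in> carrier_mat 1 1" using lhomD(1) assms by metis
  then have "e = e $$ (0, 0) \<cdot>\<^sub>m 1\<^sub>m 1" by (intro eq_matI) auto
  then show "\<exists>c. e = c \<cdot>\<^sub>m 1\<^sub>m (ldim M)" unfolding assms by blast
qed

lemma zero_mat_mult_vec: "w \<in> carrier_vec m \<Longrightarrow> 0\<^sub>m n m *\<^sub>v w = (0\<^sub>v n :: 'k::field vec)"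
  by (intro eq_vecI) auto

text \<open>Hom(P, M) is the image of the trivial path at 1 on \<open>M\<close>, so it vanishes
  exactly when \<open>M\<close> has no component at vertex 1.\<close>

lemma lhom_zero_proj1:
  fixes M :: "('k::field, nat \<times> nat list \<Rightarrow> 'k) lmod"
  assumes M: "M \<in> kmods"
  shows "lhom_zero kronecker_algebra proj1 M \<longleftrightarrow> lact M (path_elt (1, [])) = 0\<^sub>m (ldim M) (ldim M)"
proof
  assume z: "lhom_zero kronecker_algebra proj1 M"
  note c = modsD(1)[OF M path_elt_in_carrier(1)]
  show "lact M (path_elt (1, [])) = 0\<^sub>m (ldim M) (ldim M)"
  proof (rule eq_mat_by_vecI[OF c])
    fix v :: "'k vec" assume v: "v \<in> carrier_vec (ldim M)"
    obtain h where h: "h \<in> lhom kronecker_algebra proj1 M"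
      "h *\<^sub>v unit_vec 3 0 = lact M (path_elt (1, [])) *\<^sub>v v"
      using proj1_hom[OF M mult_mat_vec_carrier[OF c v] path_elt_fixed(1)[OF M v]] by blast
    have "h = 0\<^sub>m (ldim M) 3" using lhom_zeroD[OF z h(1)] by simp
    then show "lact M (path_elt (1, [])) *\<^sub>v v = 0\<^sub>m (ldim M) (ldim M) *\<^sub>v v" using h(2) v by (simp add: zero_mat_mult_vec)
  qed simp
next
  assume z: "lact M (path_elt (1, [])) = 0\<^sub>m (ldim M) (ldim M)"
  have u: "unit_vec 3 0 \<in> carrier_vec (ldim (proj1 :: ('k, nat \<times> nat list \<Rightarrow> 'k) lmod))" by simp
  show "lhom_zero kronecker_algebra proj1 M"
  proof (rule lhom_zeroI[OF proj1_mods M])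
    fix h assume h: "h \<in> lhom kronecker_algebra proj1 M"
    have "h *\<^sub>v unit_vec 3 0 = 0\<^sub>m (ldim M) (ldim M) *\<^sub>v (h *\<^sub>v unit_vec 3 0)"
      using lhom_vec[OF h proj1_mods M path_elt_in_carrier(1) u] unfolding proj1_generators(1) z .
    also have "\<dots> = 0\<^sub>m (ldim M) 3 *\<^sub>v unit_vec 3 0"
      using lhomD(1)[OF h] by (simp add: zero_mat_mult_vec[of _ "ldim M"] zero_mat_mult_vec[of _ 3])
    finally show "h = 0\<^sub>m (ldim M) (ldim proj1)"
      using proj1_hom_unique[OF M h lhom_zero_map[OF proj1_mods M]] by simp
  qed
qed

text \<open>The unit is the sum of the two trivial paths, so the one at 2 acts as the identity, and
  \<open>a\<close> times it is the multiple of it by \<open>a (2, [])\<close>. Hence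
  \<open>M\<close> is a power of S.\<close>

lemma lact_of_path_elt_zero:
  fixes M :: "('k::field, nat \<times> nat list \<Rightarrow> 'k) lmod"
  assumes M: "M \<in> kmods" and z: "lact M (path_elt (1, [])) = 0\<^sub>m (ldim M) (ldim M)"
    and a: "a \<in> carrier kronecker_algebra"
  shows "lact M a = a (2, []) \<cdot>\<^sub>m 1\<^sub>m (ldim M)"
proof -
  have "lact M (path_elt (2, [])) = 1\<^sub>m (ldim M)"
    using modsD(2)[OF M] modsD(4)[OF M path_elt_in_carrier(1) path_elt_in_carrier(2)] z
      modsD(1)[OF M path_elt_in_carrier(2)] by (simp add: kronecker_one)
  then show ?thesis
    using modsD(3)[OF M a path_elt_in_carrier(2)] modsD(5)[OF M path_elt_in_carrier(2)] modsD(1)[OF M a]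
      mult_path_elt(2)[OF a] by simp
qed

lemma liso_eqI:
  assumes M: "M \<in> mods A" and N: "N \<in> mods A" and d: "ldim M = ldim N"
    and act: "\<And>a. a \<in> carrier A \<Longrightarrow> lact M a = lact N a"
  shows "liso A M N"
proof -
  have "1\<^sub>m (ldim M) \<in> lhom A M N" "1\<^sub>m (ldim M) \<in> lhom A N M"
    using left_mult_one_mat[OF modsD(1)[OF N]] right_mult_one_mat[OF modsD(1)[OF N]] act d
    by (auto intro!: lhomI)
  then show ?thesis using d by (force simp: liso_def)
qed

lemma liso_vertex_module:
  fixes M :: "('k::field, nat \<times> nat list \<Rightarrow> 'k) lmod"
  assumes M: "M \<in> kmods" and z: "lact M (path_elt (1, [])) = 0\<^sub>m (ldim M) (ldim M)"
  shows "liso kronecker_algebra M (vertex_module 2 (ldim M))"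
  by (rule liso_eqI[OF M vertex_module_mods]) (auto simp: lact_of_path_elt_zero[OF M z])

section \<open>Progenerators and the category J(P)\<close>

lemma trace_carrier: "X \<in> mods A \<Longrightarrow> trace A M X \<subseteq> carrier_vec (ldim X)"
proof
  fix v assume "v \<in> trace A M X" then show "v \<in> carrier_vec (ldim X)"
    by induction (auto dest!: lhomD(1))
qed

text \<open>Every vector is the sum of its components at the two vertices; the first is reached by a
  map from P, the second by a map from S.\<close>

lemma kmods_progenerator: "progenerator_in kronecker_algebra kmods (lsum proj1 simple2)"
  unfolding progenerator_in_def
proof (intro conjI ballI)
  let ?P = "proj1 :: ('a, nat \<times> nat list \<Rightarrow> 'a) lmod" and ?S = "simple2 :: ('a, nat \<times> nat list \<Rightarrow> 'a) lmod"
  let ?G = "lsum ?P ?S"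
  show "projective_in kronecker_algebra kmods ?G"
    by (rule projective_in_lsum[OF proj1_projective simple2_projective])
  have G: "?G \<in> kmods" by (rule lsum_mods[OF proj1_mods simple2_mods])
  obtain i1 p1 i2 p2 where "biproduct kronecker_algebra ?G ?P ?S i1 p1 i2 p2"
    using lsum_biproduct[OF proj1_mods simple2_mods] by blast
  note b = biproductD[OF this]
  fix X :: "('a, nat \<times> nat list \<Rightarrow> 'a) lmod" assume X: "X \<in> kmods"
  have "v \<in> trace kronecker_algebra ?G X" if v: "v \<in> carrier_vec (ldim X)" for v
  proof -
    let ?v1 = "lact X (path_elt (1, [])) *\<^sub>v v" and ?v2 = "lact X (path_elt (2, [])) *\<^sub>v v"
    note c1 = modsD(1)[OF X path_elt_in_carrier(1)] and c2 = modsD(1)[OF X path_elt_in_carrier(2)]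
    have v1: "?v1 \<in> carrier_vec (ldim X)" and v2: "?v2 \<in> carrier_vec (ldim X)"
      using c1 c2 v by auto
    obtain h1 where h1: "h1 \<in> lhom kronecker_algebra ?P X" "h1 *\<^sub>v unit_vec 3 0 = ?v1"
      using proj1_hom[OF X v1 path_elt_fixed(1)[OF X v]] by blast
    obtain h2 where h2: "h2 \<in> lhom kronecker_algebra ?S X" "h2 *\<^sub>v unit_vec 1 0 = ?v2"
      using simple2_hom[OF X v2 path_elt_fixed(2)[OF X v]] by blast
    have f1: "h1 * p1 \<in> lhom kronecker_algebra ?G X" by (rule lhom_comp[OF G proj1_mods X b(2) h1(1)])
    have f2: "h2 * p2 \<in> lhom kronecker_algebra ?G X" by (rule lhom_comp[OF G simple2_mods X b(4) h2(1)])
    have u1: "unit_vec 3 0 \<in> carrier_vec (ldim ?P)" and u2: "unit_vec 1 0 \<in> carrier_vec (ldim ?S)" by simp_all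
    have e1: "(h1 * p1) *\<^sub>v (i1 *\<^sub>v unit_vec 3 0) = ?v1"
    proof -
      have "(h1 * p1) *\<^sub>v (i1 *\<^sub>v unit_vec 3 0) = ((h1 * p1) * i1) *\<^sub>v unit_vec 3 0"
        by (rule assoc_mult_mat_vec[OF lhomD(1)[OF f1] lhomD(1)[OF b(1)] u1, symmetric])
      also have "(h1 * p1) * i1 = h1"
        using assoc_mult_mat[OF lhomD(1)[OF h1(1)] lhomD(1)[OF b(2)] lhomD(1)[OF b(1)]] b(5) lhomD(1)[OF h1(1)] by simp
      finally show ?thesis using h1(2) by simp
    qed
    have e2: "(h2 * p2) *\<^sub>v (i2 *\<^sub>v unit_vec 1 0) = ?v2"
    proof -
      have "(h2 * p2) *\<^sub>v (i2 *\<^sub>v unit_vec 1 0) = ((h2 * p2) * i2) *\<^sub>v unit_vec 1 0"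
        by (rule assoc_mult_mat_vec[OF lhomD(1)[OF f2] lhomD(1)[OF b(3)] u2, symmetric])
      also have "(h2 * p2) * i2 = h2"
        using assoc_mult_mat[OF lhomD(1)[OF h2(1)] lhomD(1)[OF b(4)] lhomD(1)[OF b(3)]] b(6) lhomD(1)[OF h2(1)] by simp
      finally show ?thesis using h2(2) by simp
    qed
    have "?v1 + (?v2 + 0\<^sub>v (ldim X)) \<in> trace kronecker_algebra ?G X"
      using trace.add[OF f1 mult_mat_vec_carrier[OF lhomD(1)[OF b(1)] u1]
          trace.add[OF f2 mult_mat_vec_carrier[OF lhomD(1)[OF b(3)] u2] trace.zero]]
      unfolding e1 e2 .
    also have "?v1 + (?v2 + 0\<^sub>v (ldim X)) = (lact X (path_elt (1, [])) + lact X (path_elt (2, []))) *\<^sub>v v"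
      using add_mult_distrib_mat_vec[OF c1 c2 v] v2 by simp
    also have "lact X (path_elt (1, [])) + lact X (path_elt (2, [])) = 1\<^sub>m (ldim X)"
      using modsD(2)[OF X] unfolding kronecker_one modsD(4)[OF X path_elt_in_carrier(1) path_elt_in_carrier(2)] .
    also have "1\<^sub>m (ldim X) *\<^sub>v v = v" using v by simp
    finally show ?thesis .
  qed
  then show "generated kronecker_algebra ?G X"
    unfolding generated_def using trace_carrier[OF X] by blast
qed

lemma tau_rigid_projective_kmods:
  assumes "projective_in kronecker_algebra kmods P"
  shows "tau_rigid_in kronecker_algebra kmods P"
  by (rule tau_rigid_projective[OF order_refl lzero_mods assms kmods_progenerator])

text \<open>An equality rather than an isomorphism, so that \<open>Jcat\<close> unfolds directly to
  a condition on \<open>proj1\<close>.\<close>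

lemma lsum_proj1_lzero: "lsum proj1 lzero = proj1"
proof -
  have "four_block_mat (lact proj1 a) (0\<^sub>m 3 0) (0\<^sub>m 0 3) (0\<^sub>m 0 0) = lact proj1 a" for a :: "nat \<times> nat list \<Rightarrow> 'a"
    using lact_proj1_carrier[of a] by (intro eq_matI) auto
  then show ?thesis by (simp add: lsum_def lzero_def lmod.expand)
qed

text \<open>The translate of the projective P is zero, so the only condition left is Hom(P, Y) = 0:
  J(P) consists of the modules isomorphic to powers of S.\<close>

lemma Jcat_proj1:
  fixes Y :: "('k::field, nat \<times> nat list \<Rightarrow> 'k) lmod"
  shows "Y \<in> Jcat kronecker_algebra (CObj proj1 lzero) \<longleftrightarrow>
    Y \<in> kmods \<and> lact Y (path_elt (1, [])) = 0\<^sub>m (ldim Y) (ldim Y)"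
proof -
  have "is_tau kronecker_algebra kmods proj1 (lzero :: ('k, nat \<times> nat list \<Rightarrow> 'k) lmod)"
    by (rule tau_projective[OF order_refl lzero_mods proj1_projective kmods_progenerator])
  then have "\<exists>T. is_tau kronecker_algebra kmods proj1 T \<and> lhom_zero kronecker_algebra Y T" if "Y \<in> kmods"
    using lhom_zero_ldim_0[OF that lzero_mods ldim_lzero] by blast
  then show ?thesis
    unfolding Jcat_def using lhom_zero_proj1 by (auto simp: lsum_proj1_lzero)
qed

lemma simple2_Jcat: "simple2 \<in> Jcat kronecker_algebra (CObj proj1 lzero)"
  unfolding Jcat_proj1 by (intro conjI simple2_mods) (auto simp: path_elt_def intro!: eq_matI)

text \<open>On a module in J(P) the trivial path at 2 acts as the identity, so every vector is the
  image of the generator of S. Projectivity passes down because a lifting problem in J(P) is one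
  among all modules.\<close>

lemma Jcat_progenerator:
  "progenerator_in kronecker_algebra (Jcat kronecker_algebra (CObj proj1 lzero)) simple2"
proof -
  let ?J = "Jcat kronecker_algebra (CObj proj1 lzero) :: ('a, nat \<times> nat list \<Rightarrow> 'a) lmod set"
  have J: "?J \<subseteq> kmods" by (auto simp: Jcat_def)
  have "generated kronecker_algebra simple2 Y" if "Y \<in> ?J" for Y
  proof -
    have Y: "Y \<in> kmods" and z: "lact Y (path_elt (1, [])) = 0\<^sub>m (ldim Y) (ldim Y)"
      using that by (simp_all add: Jcat_proj1)
    have "v \<in> trace kronecker_algebra simple2 Y" if v: "v \<in> carrier_vec (ldim Y)" for v
    proof -
      have "lact Y (path_elt (2, [])) *\<^sub>v v = v"
        using lact_of_path_elt_zero[OF Y z path_elt_in_carrier(2)] v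
        by (simp add: path_elt_def smult_mat_mult_vec)
      then obtain h where h: "h \<in> lhom kronecker_algebra simple2 Y" "h *\<^sub>v unit_vec 1 0 = v"
        using simple2_hom[OF Y v] by blast
      show ?thesis using trace.add[OF h(1) _ trace.zero, of "unit_vec 1 0"] h(2) v by simp
    qed
    then show ?thesis unfolding generated_def using trace_carrier[OF Y] by blast
  qed
  then show ?thesis
    unfolding progenerator_in_def
    using projective_in_mono[OF simple2_projective J simple2_Jcat] by blast
qed

lemma simple2_tau_rigid_Jcat:
  "tau_rigid_in kronecker_algebra (Jcat kronecker_algebra (CObj proj1 lzero)) simple2"
proof (rule tau_rigid_projective[OF _ _ _ Jcat_progenerator])
  show "Jcat kronecker_algebra (CObj proj1 lzero) \<subseteq> kmods" by (auto simp: Jcat_def)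
  show "projective_in kronecker_algebra (Jcat kronecker_algebra (CObj proj1 lzero)) simple2"
    by (rule Jcat_progenerator[unfolded progenerator_in_def, THEN conjunct1])
  show "lzero \<in> Jcat kronecker_algebra (CObj proj1 lzero)"
    by (simp add: Jcat_proj1 lzero_mods) (simp add: lzero_def)
qed

text \<open>A projective module with nonzero first component maps onto the simple top of the projective
  \<open>proj1\<close>; lifting that map gives a retraction onto \<open>proj1\<close>.\<close>

lemma projective_retract_proj1:
  fixes Q :: "('k::field, nat \<times> nat list \<Rightarrow> 'k) lmod"
  assumes Q: "projective_in kronecker_algebra kmods Q"
    and nz: "lact Q (path_elt (1, [])) \<noteq> 0\<^sub>m (ldim Q) (ldim Q)"
  shows "\<exists>K\<in>kmods. liso kronecker_algebra Q (lsum proj1 K)"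
proof -
  have Qm: "Q \<in> kmods" using Q by (simp add: projective_in_def)
  let ?P = "proj1 :: ('k, nat \<times> nat list \<Rightarrow> 'k) lmod" and ?T = "vertex_module 1 1 :: ('k, nat \<times> nat list \<Rightarrow> 'k) lmod"
  let ?E = "lact Q (path_elt (1, []))"
  have T: "?T \<in> kmods" by (rule vertex_module_mods) simp
  note cE = modsD(1)[OF Qm path_elt_in_carrier(1)]
  \<comment> \<open>A nonzero entry of the action supplies a vector \<open>v\<close> fixed by the
    trivial path at 1 and a coordinate \<open>i\<close> in which it does not vanish.\<close>
  obtain i j where ij: "i < ldim Q" "j < ldim Q" "?E $$ (i, j) \<noteq> 0"
    using nz cE eq_matI[of ?E "0\<^sub>m (ldim Q) (ldim Q)"] by fastforce
  define v where "v = ?E *\<^sub>v unit_vec (ldim Q) j"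
  have v: "v \<in> carrier_vec (ldim Q)" using cE by (simp add: v_def)
  have vi: "v $ i \<noteq> 0" using ij cE unfolding v_def mat_mult_unit_vec[OF cE ij(2)] by simp
  have Ev: "?E *\<^sub>v v = v" unfolding v_def by (rule path_elt_fixed(1)[OF Qm]) simp
  define r where "r = (mat_of_rows (ldim Q) [unit_vec (ldim Q) i] :: 'k mat)"
  have r: "r \<in> carrier_mat 1 (ldim Q)" unfolding r_def by (rule carrier_matI) simp_all
  have rv: "(r *\<^sub>v w) $ 0 = w $ i" if "w \<in> carrier_vec (ldim Q)" for w
    using that ij(1) r by (simp add: r_def scalar_prod_left_unit)
  \<comment> \<open>Reading off coordinate \<open>i\<close> after projecting to vertex 1 is a module
    map to the simple module at 1, because no arc ends at 1.\<close>
  have f: "r * ?E \<in> lhom kronecker_algebra Q ?T"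
  proof (rule lhomI)
    show "r * ?E \<in> carrier_mat (ldim ?T) (ldim Q)" using r cE by simp
    fix a :: "nat \<times> nat list \<Rightarrow> 'k" assume a: "a \<in> carrier kronecker_algebra"
    have "r * ?E * lact Q a = r * (?E * lact Q a)" by (rule assoc_mult_mat[OF r cE modsD(1)[OF Qm a]])
    also have "\<dots> = r * (a (1, []) \<cdot>\<^sub>m ?E)"
      using modsD(3)[OF Qm path_elt_in_carrier(1) a] modsD(5)[OF Qm path_elt_in_carrier(1)] mult_path_elt(5)[OF a] by simp
    also have "\<dots> = lact ?T a * (r * ?E)" using r cE by (simp add: mult_mat_smult)
    finally show "r * ?E * lact Q a = lact ?T a * (r * ?E)" .
  qed
  define e where "e = (mat_of_rows 3 [unit_vec 3 0] :: 'k mat)"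
  have e: "e \<in> carrier_mat 1 3" unfolding e_def by (rule carrier_matI) simp_all
  have ew: "(e *\<^sub>v w) $ 0 = w $ 0" if "w \<in> carrier_vec 3" for w
    using that e by (simp add: e_def scalar_prod_left_unit)
  have el: "e \<in> lhom kronecker_algebra ?P ?T"
  proof (rule lhomI)
    show "e \<in> carrier_mat (ldim ?T) (ldim ?P)" using e by simp
    fix a :: "nat \<times> nat list \<Rightarrow> 'k" assume a: "a \<in> carrier kronecker_algebra"
    have c: "e * lact ?P a \<in> carrier_mat 1 3" "lact ?T a * e \<in> carrier_mat 1 3"
      by (rule mult_carrier_mat[OF e lact_proj1_carrier], rule mult_carrier_mat[OF _ e]) simp
    have "col (e * lact ?P a) j = col (lact ?T a * e) j" if j: "j < 3" for j
    proof (rule eq_vecI)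
      fix k assume "k < dim_vec (col (lact ?T a * e) j)"
      then have k: "k = 0" using e by simp
      have "col (e * lact ?P a) j $ 0 = col (lact ?P a) j $ 0"
        unfolding col_mult2[OF e lact_proj1_carrier j] by (rule ew[OF col_carrier_vec[OF j lact_proj1_carrier]])
      also have "\<dots> = (if j = 0 then a (1, []) else 0)"
        using j unfolding less_3 by (elim disjE) (simp_all only: lact_proj1_col, simp_all)
      also have "\<dots> = col (lact ?T a * e) j $ 0"
        using j e by (simp add: mult_mat_smult e_def mat_of_rows_def)
      finally show "col (e * lact ?P a) j $ k = col (lact ?T a * e) j $ k" unfolding k .
    qed (use e in simp)
    then show "e * lact ?P a = lact ?T a * e" by (intro mat_eq_3I[OF c]) simp_all
  qed
  have "mat_surj e"
    unfolding mat_surj_def mat_image_def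
  proof (intro equalityI subsetI)
    fix y :: "'k vec" assume "y \<in> carrier_vec (dim_row e)"
    then have y: "y \<in> carrier_vec 1" using e by simp
    have "y = e *\<^sub>v (y $ 0 \<cdot>\<^sub>v unit_vec 3 0)"
    proof (rule eq_vecI)
      fix k assume "k < dim_vec (e *\<^sub>v (y $ 0 \<cdot>\<^sub>v unit_vec 3 0))"
      then have k: "k = 0" using e by simp
      show "y $ k = (e *\<^sub>v (y $ 0 \<cdot>\<^sub>v unit_vec 3 0)) $ k" unfolding k by (subst ew) simp_all
    qed (use e y in simp)
    then show "y \<in> (\<lambda>v. e *\<^sub>v v) ` carrier_vec (dim_col e)" using e by (intro image_eqI) auto
  qed (use e in auto)
  \<comment> \<open>The map lifts along \<open>e\<close>, the projection of P onto its top; the lift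
    sends \<open>v\<close> to \<open>v $ i\<close> times the generator of P, as computed
    next.\<close>
  then obtain h where h: "h \<in> lhom kronecker_algebra Q ?P" "e * h = r * ?E"
    using Q T proj1_mods el f unfolding projective_in_def by blast
  note ch = lhomD(1)[OF h(1)]
  let ?w = "h *\<^sub>v v"
  have w: "?w \<in> carrier_vec 3" using ch v by simp
  have "lact ?P (path_elt (1, [])) *\<^sub>v ?w = ?w"
    using lhom_vec[OF h(1) Qm proj1_mods path_elt_in_carrier(1) v] Ev by simp
  then have w0: "?w = ?w $ 0 \<cdot>\<^sub>v unit_vec 3 0" by (rule proj1_path_elt[OF w])
  have "?w $ 0 = (e *\<^sub>v ?w) $ 0" using ew[OF w] by simp
  also have "e *\<^sub>v ?w = (r * ?E) *\<^sub>v v" using assoc_mult_mat_vec[OF _ ch v, of e 1] e h(2) by simp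
  also have "\<dots> = r *\<^sub>v v" using assoc_mult_mat_vec[OF r cE v] Ev by simp
  also have "\<dots> $ 0 = v $ i" by (rule rv[OF v])
  finally have c: "?w $ 0 = v $ i" .
  have v': "inverse (v $ i) \<cdot>\<^sub>v v \<in> carrier_vec (ldim Q)" using v by simp
  have "?E *\<^sub>v (inverse (v $ i) \<cdot>\<^sub>v v) = inverse (v $ i) \<cdot>\<^sub>v v" using mult_mat_vec[OF cE v] Ev by simp
  \<comment> \<open>Dividing by \<open>v $ i\<close> normalises the section, so that
    \<open>h * s\<close> fixes the generator of P.\<close>
  then obtain s where s: "s \<in> lhom kronecker_algebra ?P Q" "s *\<^sub>v unit_vec 3 0 = inverse (v $ i) \<cdot>\<^sub>v v"
    using proj1_hom[OF Qm v'] by blast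
  have "h * s = 1\<^sub>m (ldim ?P)"
  proof (rule proj1_hom_unique[OF proj1_mods lhom_comp[OF proj1_mods Qm proj1_mods s(1) h(1)] lhom_id[OF proj1_mods]])
    have u: "unit_vec 3 0 \<in> carrier_vec (ldim ?P)" by simp
    have "h * s *\<^sub>v unit_vec 3 0 = inverse (v $ i) \<cdot>\<^sub>v ?w"
      using assoc_mult_mat_vec[OF ch lhomD(1)[OF s(1)] u] s(2) mult_mat_vec[OF ch v] by simp
    also have "\<dots> = inverse (v $ i) \<cdot>\<^sub>v (?w $ 0 \<cdot>\<^sub>v unit_vec 3 0)" using w0 by simp
    also have "\<dots> = unit_vec 3 0" unfolding c using vi by (simp add: smult_smult_assoc)
    finally show "h * s *\<^sub>v unit_vec 3 0 = 1\<^sub>m (ldim ?P) *\<^sub>v unit_vec 3 0" by simp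
  qed
  then show ?thesis using retract_splits[OF Qm proj1_mods h(1) s(1)] by blast
qed

section \<open>Objects of the category of modules and shifted modules\<close>

lemma biproduct_commute:
  assumes "biproduct A S M N i p j q"
  shows "biproduct A S N M j q i p"
proof -
  note b = biproductD[OF assms]
  have "i * p \<in> carrier_mat (ldim S) (ldim S)" "j * q \<in> carrier_mat (ldim S) (ldim S)"
    using b(1-4)[THEN lhomD(1)] by auto
  then have "j * q + i * p = 1\<^sub>m (ldim S)" using b(9) comm_add_mat by metis
  then show ?thesis using b by (simp add: biproduct_def)
qed

lemma lsum_commute:
  assumes "M \<in> mods A" "N \<in> mods A"
  shows "liso A (lsum M N) (lsum N M)"
  using lsum_biproduct[OF assms] biproduct_commute liso_lsum_iff[OF lsum_mods[OF assms] assms(2,1)] by blast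

lemma liso_lsum_zero:
  fixes M Z :: "('k::field, 'a) lmod"
  assumes M: "M \<in> mods A" and Z: "Z \<in> mods A" and 0: "ldim Z = 0"
  shows "liso A M (lsum M Z)" "liso A M (lsum Z M)"
proof -
  have z: "0\<^sub>m (ldim M) 0 \<in> lhom A Z M" "0\<^sub>m 0 (ldim M) \<in> lhom A M Z"
    using lhom_zero_map[OF Z M] lhom_zero_map[OF M Z] 0 by simp_all
  have "1\<^sub>m (ldim M) + 0\<^sub>m (ldim M) 0 * 0\<^sub>m 0 (ldim M) = (1\<^sub>m (ldim M) :: 'k mat)"
    by (subst mult_mat_inner_0[OF zero_carrier_mat zero_carrier_mat]) simp
  moreover have "0\<^sub>m 0 (ldim M) * 0\<^sub>m (ldim M) 0 = (1\<^sub>m 0 :: 'k mat)" by (rule eq_matI) simp_all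
  ultimately have b: "biproduct A M M Z (1\<^sub>m (ldim M)) (1\<^sub>m (ldim M)) (0\<^sub>m (ldim M) 0) (0\<^sub>m 0 (ldim M))"
    unfolding biproduct_def using z lhom_id[OF M] 0 by simp
  then show "liso A M (lsum M Z)" using liso_lsum_iff[OF M M Z] by blast
  show "liso A M (lsum Z M)" using liso_lsum_iff[OF M Z M] biproduct_commute[OF b] by blast
qed

lemma lsum_cong:
  assumes M: "M \<in> mods A" and N: "N \<in> mods A" and M': "M' \<in> mods A" and N': "N' \<in> mods A"
    and "liso A M M'" "liso A N N'"
  shows "liso A (lsum M N) (lsum M' N')"
proof -
  let ?S = "lsum M N"
  have S: "?S \<in> mods A" by (rule lsum_mods[OF M N])
  obtain i p j q where "biproduct A ?S M N i p j q" using lsum_biproduct[OF M N] by blast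
  note b = biproductD[OF this]
  obtain f f' where f: "f \<in> lhom A M M'" "f' \<in> lhom A M' M" "f' * f = 1\<^sub>m (ldim M)" "f * f' = 1\<^sub>m (ldim M')"
    using assms(5) by (auto simp: liso_def)
  obtain g g' where g: "g \<in> lhom A N N'" "g' \<in> lhom A N' N" "g' * g = 1\<^sub>m (ldim N)" "g * g' = 1\<^sub>m (ldim N')"
    using assms(6) by (auto simp: liso_def)
  note c = b(1-4)[THEN lhomD(1)] f(1,2)[THEN lhomD(1)] g(1,2)[THEN lhomD(1)]
  note [simp] = c[THEN carrier_matD(1)] c[THEN carrier_matD(2)]
  have [simp]: "p * (i * f') = f'" "q * (j * g') = g'" "p * (j * g') = 0\<^sub>m (ldim M) (ldim N')"
    "q * (i * f') = 0\<^sub>m (ldim N) (ldim M')" "f' * (f * p) = p" "g' * (g * q) = q"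
    using b(5-8) c f g by (simp_all flip: mult_mat_assoc)
  have "biproduct A ?S M' N' (i * f') (f * p) (j * g') (g * q)"
    unfolding biproduct_def
  proof (intro conjI)
    show "i * f' \<in> lhom A M' ?S" "f * p \<in> lhom A ?S M'" "j * g' \<in> lhom A N' ?S" "g * q \<in> lhom A ?S N'"
      by (rule lhom_comp[OF M' M S f(2) b(1)] lhom_comp[OF S M M' b(2) f(1)]
          lhom_comp[OF N' N S g(2) b(3)] lhom_comp[OF S N N' b(4) g(1)])+
    show "i * f' * (f * p) + j * g' * (g * q) = 1\<^sub>m (ldim ?S)"
      using b(9) by (simp add: mult_mat_assoc)
  qed (use f g c in \<open>simp_all add: mult_mat_assoc\<close>)
  then show ?thesis using liso_lsum_iff[OF S M' N'] by blast
qed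

lemma cobjsD: "U \<in> cobjs A \<Longrightarrow> mpart U \<in> mods A" "U \<in> cobjs A \<Longrightarrow> spart U \<in> mods A"
  by (auto simp: cobjs_def)

lemma cobjsI: "M \<in> mods A \<Longrightarrow> N \<in> mods A \<Longrightarrow> CObj M N \<in> cobjs A"
  by (auto simp: cobjs_def)

lemma ciso_refl: "U \<in> cobjs A \<Longrightarrow> ciso A U U"
  by (auto simp: ciso_def cobjs_def liso_refl)

lemma ciso_sym: "ciso A U V \<Longrightarrow> ciso A V U"
  by (auto simp: ciso_def liso_sym)

lemma ciso_trans:
  "U \<in> cobjs A \<Longrightarrow> V \<in> cobjs A \<Longrightarrow> W \<in> cobjs A \<Longrightarrow> ciso A U V \<Longrightarrow> ciso A V W \<Longrightarrow> ciso A U W"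
  unfolding ciso_def by (blast intro: liso_trans dest: cobjsD)

lemma csum_cobjs: "U \<in> cobjs A \<Longrightarrow> V \<in> cobjs A \<Longrightarrow> csum U V \<in> cobjs A"
  by (auto simp: csum_def cobjs_def lsum_mods)

lemma ciso_is_module: "ciso A U V \<Longrightarrow> is_module U \<longleftrightarrow> is_module V"
  by (auto simp: ciso_def is_module_def liso_ldim_0_iff)

lemma ciso_is_shifted: "ciso A U V \<Longrightarrow> is_shifted U \<longleftrightarrow> is_shifted V"
  by (auto simp: ciso_def is_shifted_def liso_ldim_0_iff)

lemma iso_class_iff: "V \<in> iso_class A U \<longleftrightarrow> V \<in> cobjs A \<and> ciso A U V"
  by (simp add: iso_class_def)

lemma iso_class_self: "U \<in> cobjs A \<Longrightarrow> U \<in> iso_class A U"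
  by (simp add: iso_class_def ciso_refl)

lemma iso_class_eqI:
  assumes "U \<in> cobjs A" "V \<in> cobjs A" "ciso A U V"
  shows "iso_class A U = iso_class A V"
  using assms ciso_trans ciso_sym unfolding iso_class_def by blast

lemma iso_class_eq_iff:
  assumes "U \<in> cobjs A" "V \<in> cobjs A"
  shows "iso_class A U = iso_class A V \<longleftrightarrow> ciso A U V"
  using assms iso_class_eqI iso_class_self by (metis iso_class_iff)

lemma indecomposable_cobjs: "indecomposable A U \<Longrightarrow> U \<in> cobjs A"
  by (simp add: indecomposable_def)

text \<open>Every object splits into its module part and its shifted part, and one of these must
  vanish.\<close>

lemma indecomposable_cases:
  assumes "indecomposable A U"
  shows "is_module U \<or> is_shifted U"
proof -
  have U: "U \<in> cobjs A" by (rule indecomposable_cobjs[OF assms])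
  let ?V = "CObj (mpart U) lzero" and ?W = "CObj lzero (spart U)"
  have "?V \<in> cobjs A" "?W \<in> cobjs A" using cobjsD[OF U] by (auto intro!: cobjsI lzero_mods)
  moreover have "ciso A U (csum ?V ?W)"
    using liso_lsum_zero[OF cobjsD(1)[OF U] lzero_mods ldim_lzero] liso_lsum_zero[OF cobjsD(2)[OF U] lzero_mods ldim_lzero]
    by (simp add: ciso_def csum_def)
  ultimately have "is_zero ?V \<or> is_zero ?W" using assms unfolding indecomposable_def by blast
  then show ?thesis by (auto simp: is_zero_def is_module_def is_shifted_def)
qed

lemma indecomposable_scalar_endos:
  assumes S: "S \<in> mods A" and sc: "scalar_endos A S" and nz: "ldim S \<noteq> 0"
  shows "indecomposable A (CObj S lzero)" "indecomposable A (CObj lzero S)"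
proof -
  have "is_zero V \<or> is_zero W"
    if V: "V \<in> cobjs A" and W: "W \<in> cobjs A" and iso: "ciso A (CObj S lzero) (csum V W)" for V W
    using scalar_endos_lsum[OF S cobjsD(1)[OF V] cobjsD(1)[OF W] sc] liso_ldim_0[of A lzero "lsum (spart V) (spart W)"] iso
    by (auto simp: ciso_def csum_def is_zero_def is_module_def is_shifted_def)
  then show "indecomposable A (CObj S lzero)"
    using nz cobjsI[OF S lzero_mods] by (auto simp: indecomposable_def is_zero_def is_shifted_def)
  have "is_zero V \<or> is_zero W"
    if V: "V \<in> cobjs A" and W: "W \<in> cobjs A" and iso: "ciso A (CObj lzero S) (csum V W)" for V W
    using scalar_endos_lsum[OF S cobjsD(2)[OF V] cobjsD(2)[OF W] sc] liso_ldim_0[of A lzero "lsum (mpart V) (mpart W)"] iso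
    by (auto simp: ciso_def csum_def is_zero_def is_module_def is_shifted_def)
  then show "indecomposable A (CObj lzero S)"
    using nz cobjsI[OF lzero_mods S] by (auto simp: indecomposable_def is_zero_def is_module_def)
qed

section \<open>Ordered support tau-tilting objects\<close>

lemma support_tau_tilting2_ciso:
  assumes U: "U \<in> cobjs A" and V: "V \<in> cobjs A" and iso: "ciso A U V" and t: "support_tau_tilting2 A U"
  shows "support_tau_tilting2 A V"
proof -
  have m: "liso A (mpart U) (mpart V)" and s: "liso A (spart U) (spart V)" using iso by (auto simp: ciso_def)
  have "basic A V"
    unfolding basic_def
  proof (intro conjI V ballI impI)
    fix X W assume XW: "X \<in> cobjs A" "W \<in> cobjs A" and "ciso A V (csum (csum X X) W)"
    then have "ciso A U (csum (csum X X) W)"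
      using ciso_trans[OF U V _ iso] csum_cobjs by blast
    then show "is_zero X" using t XW by (auto simp: support_tau_tilting2_def support_tau_rigid_def basic_def)
  qed
  moreover have "tau_rigid_in A (mods A) (mpart V)" "projective_in A (mods A) (spart V)"
    "lhom_zero A (spart V) (mpart V)"
    using t tau_rigid_in_liso[OF cobjsD(1)[OF V] m] projective_in_liso[OF _ cobjsD(2)[OF V] s]
      lhom_zero_liso[OF cobjsD(2)[OF U] cobjsD(2)[OF V] cobjsD(1)[OF U] cobjsD(1)[OF V] s m]
    by (auto simp: support_tau_tilting2_def support_tau_rigid_def)
  moreover have "\<exists>U1 U2. indecomposable A U1 \<and> indecomposable A U2 \<and> ciso A V (csum U1 U2)"
    using t ciso_trans[OF V U _ ciso_sym[OF iso]] csum_cobjs indecomposable_cobjs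
    unfolding support_tau_tilting2_def by metis
  ultimately show ?thesis by (simp add: support_tau_tilting2_def support_tau_rigid_def)
qed

lemma ordered_support_tau_tilting2_commute:
  assumes "ordered_support_tau_tilting2 A T1 T2"
  shows "ordered_support_tau_tilting2 A T2 T1"
proof -
  have T: "T1 \<in> cobjs A" "T2 \<in> cobjs A"
    using assms by (auto simp: ordered_support_tau_tilting2_def indecomposable_cobjs)
  have "ciso A (csum T1 T2) (csum T2 T1)"
    using lsum_commute[OF cobjsD(1)[OF T(1)] cobjsD(1)[OF T(2)]] lsum_commute[OF cobjsD(2)[OF T(1)] cobjsD(2)[OF T(2)]]
    by (simp add: ciso_def csum_def)
  then show ?thesis
    using assms support_tau_tilting2_ciso[OF csum_cobjs[OF T] csum_cobjs[OF T(2,1)]]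
    by (auto simp: ordered_support_tau_tilting2_def)
qed

lemma OST_commute: "(c, d) \<in> OST A \<Longrightarrow> (d, c) \<in> OST A"
  unfolding OST_def using ordered_support_tau_tilting2_commute by blast

lemma OST_class_fst:
  assumes "(c, d) \<in> OST A" "X \<in> c"
  shows "X \<in> cobjs A" "iso_class A X = c"
proof -
  obtain T where T: "T \<in> cobjs A" "c = iso_class A T"
    using assms(1) by (auto simp: OST_def ordered_support_tau_tilting2_def dest: indecomposable_cobjs)
  then show "X \<in> cobjs A" "iso_class A X = c"
    using assms(2) iso_class_eqI[OF T(1), of X] by (auto simp: iso_class_iff)
qed

lemma OST_nonempty_fst: "(c, d) \<in> OST A \<Longrightarrow> c \<noteq> {}"
  by (auto simp: OST_def ordered_support_tau_tilting2_def dest!: indecomposable_cobjs iso_class_self)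

text \<open>Isomorphic entries would make \<open>T1\<close> a summand twice, against
  basicness.\<close>

lemma ordered_support_tau_tilting2_not_ciso:
  assumes T: "ordered_support_tau_tilting2 A T1 T2" and iso: "ciso A T1 T2"
  shows False
proof -
  have i: "indecomposable A T1" "indecomposable A T2" and b: "basic A (csum T1 T2)"
    using T by (auto simp: ordered_support_tau_tilting2_def support_tau_tilting2_def support_tau_rigid_def)
  note c = i[THEN indecomposable_cobjs]
  let ?Z = "CObj lzero lzero"
  have Z: "?Z \<in> cobjs A" by (intro cobjsI lzero_mods)
  have "liso A (lsum M1 M2) (lsum (lsum M1 M1) lzero)"
    if M1: "M1 \<in> mods A" and M2: "M2 \<in> mods A" and i: "liso A M1 M2" for M1 M2
    using liso_trans[OF lsum_mods[OF M1 M2] lsum_mods[OF M1 M1] lsum_mods[OF lsum_mods[OF M1 M1] lzero_mods]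
        lsum_cong[OF M1 M2 M1 M1 liso_refl[OF M1] liso_sym[OF i]] liso_lsum_zero(1)[OF lsum_mods[OF M1 M1] lzero_mods ldim_lzero]] .
  then have "ciso A (csum T1 T2) (csum (csum T1 T1) ?Z)"
    using iso cobjsD[OF c(1)] cobjsD[OF c(2)] by (simp add: ciso_def csum_def)
  then have "is_zero T1" using b c(1) Z unfolding basic_def by blast
  then show False using i(1) by (simp add: indecomposable_def)
qed

lemma OST_irrefl: "(c, c) \<notin> OST A"
proof
  assume "(c, c) \<in> OST A"
  then obtain T1 T2 where T: "ordered_support_tau_tilting2 A T1 T2" and "iso_class A T1 = iso_class A T2"
    by (auto simp: OST_def)
  then have "ciso A T1 T2"
    using iso_class_eq_iff by (auto simp: ordered_support_tau_tilting2_def dest!: indecomposable_cobjs)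
  then show False using ordered_support_tau_tilting2_not_ciso[OF T] by blast
qed

section \<open>The support tau-tilting objects containing a shifted projective\<close>

abbreviation obj_S :: "('k::field, nat \<times> nat list \<Rightarrow> 'k) cobj" where
  "obj_S \<equiv> CObj simple2 lzero"

abbreviation obj_S_shift :: "('k::field, nat \<times> nat list \<Rightarrow> 'k) cobj" where
  "obj_S_shift \<equiv> CObj lzero simple2"

abbreviation obj_P :: "('k::field, nat \<times> nat list \<Rightarrow> 'k) cobj" where
  "obj_P \<equiv> CObj proj1 lzero"

abbreviation obj_P_shift :: "('k::field, nat \<times> nat list \<Rightarrow> 'k) cobj" where
  "obj_P_shift \<equiv> CObj lzero proj1"

abbreviation kclass :: "('k::field, nat \<times> nat list \<Rightarrow> 'k) cobj \<Rightarrow> ('k, nat \<times> nat list \<Rightarrow> 'k) cobj set" where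
  "kclass \<equiv> iso_class kronecker_algebra"

lemma obj_indecomposable:
  "indecomposable kronecker_algebra obj_S" "indecomposable kronecker_algebra obj_S_shift"
  "indecomposable kronecker_algebra obj_P" "indecomposable kronecker_algebra obj_P_shift"
  using indecomposable_scalar_endos[OF simple2_mods scalar_endos_1_dim]
    indecomposable_scalar_endos[OF proj1_mods scalar_endos_proj1] by simp_all

lemmas obj_cobjs = obj_indecomposable[THEN indecomposable_cobjs]

lemma ordered_S_P_shift: "ordered_support_tau_tilting2 kronecker_algebra obj_S obj_P_shift"
proof -
  let ?S = "simple2 :: ('a, nat \<times> nat list \<Rightarrow> 'a) lmod" and ?P = "proj1 :: ('a, nat \<times> nat list \<Rightarrow> 'a) lmod"
  let ?K = "kronecker_algebra :: ('a, nat \<times> nat list \<Rightarrow> 'a) module"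
  let ?U = "csum obj_S obj_P_shift :: ('a, nat \<times> nat list \<Rightarrow> 'a) cobj"
  \<comment> \<open>The conditions are checked on this isomorphic object, from which the zero
    summands of \<open>csum\<close> have disappeared.\<close>
  let ?V = "CObj ?S ?P"
  have V: "?V \<in> cobjs ?K" by (rule cobjsI[OF simple2_mods proj1_mods])
  have U: "?U \<in> cobjs ?K" by (rule csum_cobjs[OF obj_cobjs(1,4)])
  have VU: "ciso ?K ?V ?U"
    using liso_lsum_zero(1)[OF simple2_mods lzero_mods ldim_lzero] liso_lsum_zero(2)[OF proj1_mods lzero_mods ldim_lzero]
    unfolding ciso_def csum_def cobj.sel by (intro conjI)
  have "basic ?K ?V"
    unfolding basic_def
  proof (intro conjI V ballI impI)
    fix X W assume X: "X \<in> cobjs ?K" and W: "W \<in> cobjs ?K" and iso: "ciso ?K ?V (csum (csum X X) W)"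
    have "ldim (mpart X) = 0" "ldim (spart X) = 0"
      using iso scalar_endos_square[OF simple2_mods cobjsD(1)[OF X] cobjsD(1)[OF W] scalar_endos_1_dim]
        scalar_endos_square[OF proj1_mods cobjsD(2)[OF X] cobjsD(2)[OF W] scalar_endos_proj1]
      unfolding ciso_def csum_def cobj.sel by simp_all
    then show "is_zero X" by (simp add: is_zero_def is_module_def is_shifted_def)
  qed
  moreover have "lact ?S (path_elt (1, [])) = 0\<^sub>m (ldim ?S) (ldim ?S)"
    using simple2_Jcat unfolding Jcat_proj1 by blast
  then have "lhom_zero ?K ?P ?S" unfolding lhom_zero_proj1[OF simple2_mods] .
  ultimately have "support_tau_rigid ?K ?V"
    unfolding support_tau_rigid_def cobj.sel
    by (intro conjI tau_rigid_projective_kmods simple2_projective proj1_projective)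
  then have "support_tau_tilting2 ?K ?V"
    unfolding support_tau_tilting2_def using VU obj_indecomposable by blast
  then have "support_tau_tilting2 ?K ?U" by (rule support_tau_tilting2_ciso[OF V U VU])
  then show ?thesis
    unfolding ordered_support_tau_tilting2_def by (intro conjI obj_indecomposable)
qed

text \<open>For larger \<open>n\<close> one copy of S splits off. The two alternatives treat S as
  part of a module and of a shifted module together.\<close>

lemma indecomposable_vertex_module:
  fixes M Z :: "('k::field, nat \<times> nat list \<Rightarrow> 'k) lmod"
  assumes "liso kronecker_algebra M (vertex_module 2 n)" "M \<in> kmods" "n \<noteq> 0"
    and ind: "indecomposable kronecker_algebra (CObj M Z) \<and> ldim Z = 0 \<or> indecomposable kronecker_algebra (CObj Z M) \<and> ldim Z = 0"
    and Z: "Z \<in> kmods"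
  shows "n = 1"
proof (rule ccontr)
  assume "n \<noteq> 1"
  let ?A = "vertex_module 2 1 :: ('k, nat \<times> nat list \<Rightarrow> 'k) lmod"
    and ?B = "vertex_module 2 (n - 1) :: ('k, nat \<times> nat list \<Rightarrow> 'k) lmod"
  have AB: "?A \<in> kmods" "?B \<in> kmods" by (simp_all only: vertex_module_mods simp_thms)
  have n: "1 + (n - 1) = n" using assms(3) by simp
  have M: "liso kronecker_algebra M (lsum ?A ?B)" unfolding lsum_vertex_module n by (rule assms(1))
  have z: "liso kronecker_algebra Z (lsum lzero lzero)" if "ldim Z = 0"
    using that by (intro liso_ldim_zero Z lsum_mods lzero_mods) simp_all
  have "is_zero (CObj ?A lzero) \<or> is_zero (CObj ?B lzero) \<or> is_zero (CObj lzero ?A) \<or> is_zero (CObj lzero ?B)"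
    using ind
  proof (elim disjE conjE)
    assume "indecomposable kronecker_algebra (CObj M Z)" "ldim Z = 0"
    moreover from this have "ciso kronecker_algebra (CObj M Z) (csum (CObj ?A lzero) (CObj ?B lzero))"
      using M z by (simp add: ciso_def csum_def)
    ultimately show ?thesis
      unfolding indecomposable_def using cobjsI[OF AB(1) lzero_mods] cobjsI[OF AB(2) lzero_mods] by blast
  next
    assume "indecomposable kronecker_algebra (CObj Z M)" "ldim Z = 0"
    moreover from this have "ciso kronecker_algebra (CObj Z M) (csum (CObj lzero ?A) (CObj lzero ?B))"
      using M z by (simp add: ciso_def csum_def)
    ultimately show ?thesis
      unfolding indecomposable_def using cobjsI[OF lzero_mods AB(1)] cobjsI[OF lzero_mods AB(2)] by blast
  qed
  then show False using assms(3) \<open>n \<noteq> 1\<close> by (auto simp: is_zero_def is_module_def is_shifted_def)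
qed

text \<open>A module complement admits no map from P, hence is a power of S. A shifted complement
  comes from a projective: either it has no component at vertex 1 and is a power of S, or P splits
  off, and then indecomposability makes it P[1], which basicness excludes.\<close>

lemma complements_of_P_shift:
  fixes X :: "('k::field, nat \<times> nat list \<Rightarrow> 'k) cobj"
  assumes T: "ordered_support_tau_tilting2 kronecker_algebra X U" and UP: "ciso kronecker_algebra U obj_P_shift"
  shows "ciso kronecker_algebra X obj_S \<or> ciso kronecker_algebra X obj_S_shift"
proof -
  let ?K = "kronecker_algebra :: ('k, nat \<times> nat list \<Rightarrow> 'k) module"
  have X: "indecomposable ?K X" and U: "indecomposable ?K U" and r: "support_tau_rigid ?K (csum X U)"
    using T by (auto simp: ordered_support_tau_tilting2_def support_tau_tilting2_def)
  note Xc = indecomposable_cobjs[OF X] and Uc = indecomposable_cobjs[OF U]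
  note Xm = cobjsD(1)[OF Xc] and Xs = cobjsD(2)[OF Xc] and Um = cobjsD(1)[OF Uc] and Us = cobjsD(2)[OF Uc]
  have nz: "ldim (mpart X) \<noteq> 0 \<or> ldim (spart X) \<noteq> 0"
    using X by (auto simp: indecomposable_def is_zero_def is_module_def is_shifted_def)
  have vanish: "lhom_zero ?K (lsum (spart X) (spart U)) (lsum (mpart X) (mpart U))"
    and proj: "projective_in ?K kmods (lsum (spart X) (spart U))"
    using r by (auto simp: support_tau_rigid_def csum_def)
  obtain i1 p1 i2 p2 where "biproduct ?K (lsum (spart X) (spart U)) (spart X) (spart U) i1 p1 i2 p2"
    using lsum_biproduct[OF Xs Us] by blast
  note s = biproductD[OF this]
  obtain j1 q1 j2 q2 where "biproduct ?K (lsum (mpart X) (mpart U)) (mpart X) (mpart U) j1 q1 j2 q2"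
    using lsum_biproduct[OF Xm Um] by blast
  note m = biproductD[OF this]
  show ?thesis
    using indecomposable_cases[OF X]
  proof
    assume mod: "is_module X"
    have sz: "ldim (spart X) = 0" using mod by (simp add: is_module_def)
    \<comment> \<open>Vanishing is known for the whole sum; restricting to the shifted part of
      \<open>U\<close> and to the module part of \<open>X\<close> isolates Hom(P, X).\<close>
    have "lhom_zero ?K (spart U) (lsum (mpart X) (mpart U))"
      by (rule lhom_zero_retract_left[OF lsum_mods[OF Xs Us] Us lsum_mods[OF Xm Um] s(3,4,6) vanish])
    then have "lhom_zero ?K (spart U) (mpart X)"
      by (rule lhom_zero_retract_right[OF Us Xm lsum_mods[OF Xm Um] m(1,2,5)])
    then have "lhom_zero ?K proj1 (mpart X)"
      using UP lhom_zero_liso[OF Us proj1_mods Xm Xm _ liso_refl[OF Xm]] by (simp add: ciso_def)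
    then have iso: "liso ?K (mpart X) (vertex_module 2 (ldim (mpart X)))"
      unfolding lhom_zero_proj1[OF Xm] by (rule liso_vertex_module[OF Xm])
    have "ldim (mpart X) = 1"
      using indecomposable_vertex_module[OF iso Xm _ _ Xs] nz sz X by simp
    then have "ciso ?K X obj_S"
      using iso liso_ldim_zero[OF Xs lzero_mods sz ldim_lzero] unfolding ciso_def cobj.sel by simp
    then show ?thesis ..
  next
    assume shifted: "is_shifted X"
    have mz: "ldim (mpart X) = 0" using shifted by (simp add: is_shifted_def)
    let ?Q = "spart X"
    have Q: "projective_in ?K kmods ?Q" by (rule projective_in_retract[OF proj Xs s(1,2,5)])
    show ?thesis
    proof (cases "lact ?Q (path_elt (1, [])) = 0\<^sub>m (ldim ?Q) (ldim ?Q)")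
      case True
      have iso: "liso ?K ?Q (vertex_module 2 (ldim ?Q))" by (rule liso_vertex_module[OF Xs True])
      have "ldim ?Q = 1"
        using indecomposable_vertex_module[OF iso Xs _ _ Xm] nz mz X by simp
      then have "ciso ?K X obj_S_shift"
        using iso liso_ldim_zero[OF Xm lzero_mods mz ldim_lzero] unfolding ciso_def cobj.sel by simp
      then show ?thesis ..
    next
      case False
      obtain L where L: "L \<in> kmods" "liso ?K ?Q (lsum proj1 L)"
        using projective_retract_proj1[OF Q False] by blast
      have "ciso ?K X (csum obj_P_shift (CObj lzero L))"
        using L(2) liso_ldim_zero[OF Xm lsum_mods[OF lzero_mods lzero_mods] mz] unfolding ciso_def csum_def by simp
      then have "is_zero (obj_P_shift :: ('k, nat \<times> nat list \<Rightarrow> 'k) cobj) \<or> is_zero (CObj lzero L)"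
        using X obj_cobjs(4) cobjsI[OF lzero_mods L(1)] unfolding indecomposable_def by blast
      then have "ldim L = 0" by (auto simp: is_zero_def is_module_def)
      then have "liso ?K ?Q proj1"
        using liso_trans[OF Xs lsum_mods[OF proj1_mods L(1)] proj1_mods L(2)] liso_lsum_zero(1)[OF proj1_mods L(1)] liso_sym
        by blast
      then have "ciso ?K X obj_P_shift"
        using liso_ldim_zero[OF Xm lzero_mods mz ldim_lzero] unfolding ciso_def cobj.sel by simp
      then have "ciso ?K X U"
        using ciso_trans[OF Xc obj_cobjs(4) Uc] ciso_sym[OF UP] by blast
      then show ?thesis using ordered_support_tau_tilting2_not_ciso[OF T] by blast
    qed
  qed
qed

lemma OST_S_P_shift: "(kclass obj_S, kclass obj_P_shift) \<in> OST kronecker_algebra"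
  unfolding OST_def using ordered_S_P_shift by blast

lemma OST_P_shift:
  assumes "(c, kclass obj_P_shift) \<in> OST kronecker_algebra"
  shows "c = kclass obj_S \<or> c = kclass obj_S_shift"
proof -
  obtain X U where T: "ordered_support_tau_tilting2 kronecker_algebra X U" and c: "c = kclass X"
    and U: "kclass obj_P_shift = kclass U"
    using assms by (auto simp: OST_def)
  have Xc: "X \<in> cobjs kronecker_algebra" and Uc: "U \<in> cobjs kronecker_algebra"
    using T by (auto simp: ordered_support_tau_tilting2_def indecomposable_cobjs)
  have "ciso kronecker_algebra U obj_P_shift"
    using U iso_class_eq_iff[OF obj_cobjs(4) Uc] ciso_sym by blast
  then show ?thesis
    using complements_of_P_shift[OF T] iso_class_eqI[OF Xc obj_cobjs(1)] iso_class_eqI[OF Xc obj_cobjs(2)] c by blast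
qed

section \<open>Values of \<open>psi\<close> at P[1] and three exceptional sequences\<close>

lemma iso_class_is_module:
  assumes "U \<in> iso_class A V"
  shows "is_module U \<longleftrightarrow> is_module V" "is_shifted U \<longleftrightarrow> is_shifted V"
proof -
  have "ciso A V U" using assms by (simp add: iso_class_iff)
  from ciso_is_module[OF this] ciso_is_shifted[OF this]
  show "is_module U \<longleftrightarrow> is_module V" "is_shifted U \<longleftrightarrow> is_shifted V" by simp_all
qed

lemma kclass_simps:
  "U \<in> kclass obj_S \<Longrightarrow> is_module U" "U \<in> kclass obj_S_shift \<Longrightarrow> \<not> is_module U"
  "U \<in> kclass obj_P \<Longrightarrow> is_module U" "U \<in> kclass obj_P_shift \<Longrightarrow> is_shifted U" "U \<in> kclass obj_P_shift \<Longrightarrow> \<not> is_module U"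
  by (drule iso_class_is_module(1) iso_class_is_module(2), simp add: is_module_def is_shifted_def)+

text \<open>For a shifted \<open>U\<close> the map is the identity on modules, up to
  isomorphism.\<close>

lemma psi_S_P_shift:
  "psi (kronecker_algebra :: ('k::field, nat \<times> nat list \<Rightarrow> 'k) module) (kclass obj_S, kclass obj_P_shift) =
    (kclass obj_S, kclass obj_P_shift)"
proof -
  let ?K = "kronecker_algebra :: ('k, nat \<times> nat list \<Rightarrow> 'k) module"
  have E: "is_E ?K U X Z \<longleftrightarrow> ciso ?K X Z"
    if "X \<in> kclass obj_S" "U \<in> kclass obj_P_shift" for X U Z
    using kclass_simps(1)[OF that(1)] kclass_simps(4)[OF that(2)] by (simp add: is_E_def)
  have P: "obj_P_shift \<in> iso_class ?K obj_P_shift" and S: "obj_S \<in> iso_class ?K obj_S"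
    by (rule iso_class_self obj_cobjs)+
  have "{Z \<in> cobjs ?K. \<exists>X\<in>kclass obj_S. \<exists>U\<in>kclass obj_P_shift. is_E ?K U X Z} = kclass obj_S" (is "?L = _")
  proof (intro equalityI subsetI)
    fix Z assume "Z \<in> ?L"
    then obtain X where "Z \<in> cobjs ?K" "X \<in> kclass obj_S" "ciso ?K X Z" using E by blast
    then show "Z \<in> kclass obj_S"
      using ciso_trans[OF obj_cobjs(1)] unfolding iso_class_iff by blast
  next
    fix Z :: "('k, nat \<times> nat list \<Rightarrow> 'k) cobj" assume "Z \<in> kclass obj_S"
    then show "Z \<in> ?L" using E[OF S P] S P unfolding iso_class_iff[of Z] by blast
  qed
  then show ?thesis unfolding psi_def by (simp only: prod.case)
qed

text \<open>Shifted arguments have only shifted values here, and S is a nonzero module. This already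
  separates the two possible preimages.\<close>

lemma psi_S_shift_P_shift: "obj_S \<notin> fst (psi kronecker_algebra (kclass obj_S_shift, kclass obj_P_shift))"
proof -
  have S: "\<not> is_shifted (obj_S :: ('a, nat \<times> nat list \<Rightarrow> 'a) cobj)" by (simp add: is_shifted_def)
  have "\<not> is_E kronecker_algebra U X (obj_S :: ('a, nat \<times> nat list \<Rightarrow> 'a) cobj)" if "X \<in> kclass obj_S_shift" "U \<in> kclass obj_P_shift" for X U
    using kclass_simps(2)[OF that(1)] kclass_simps(4)[OF that(2)] S by (simp add: is_E_def)
  then show ?thesis unfolding psi_def by auto
qed

lemma kclass_distinct: "kclass obj_S \<noteq> kclass obj_S_shift" "kclass obj_P \<noteq> kclass obj_P_shift"
  using kclass_simps iso_class_self[OF obj_cobjs(1)] iso_class_self[OF obj_cobjs(3)] by blast+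

text \<open>In all three cases \<open>cabs\<close> of the second entry is P. As S is projective in
  J(P), it may stand as a tau-rigid module or be shifted.\<close>

lemma CSES_examples:
  "(kclass obj_S, kclass obj_P_shift) \<in> CSES kronecker_algebra"
  "(kclass obj_S_shift, kclass obj_P_shift) \<in> CSES kronecker_algebra"
  "(kclass obj_S, kclass obj_P) \<in> CSES kronecker_algebra"
proof -
  have c: "cabs obj_P_shift = obj_P" "cabs obj_P = obj_P" by (simp_all add: cabs_def is_module_def)
  have "projective_in kronecker_algebra (Jcat kronecker_algebra obj_P) simple2"
    by (rule Jcat_progenerator[unfolded progenerator_in_def, THEN conjunct1])
  then have "signed_tau_exceptional2 kronecker_algebra obj_S obj_P_shift"
    "signed_tau_exceptional2 kronecker_algebra obj_S_shift obj_P_shift"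
    "signed_tau_exceptional2 kronecker_algebra obj_S obj_P"
    unfolding signed_tau_exceptional2_def c
    using obj_indecomposable simple2_tau_rigid_Jcat proj1_projective tau_rigid_projective_kmods[OF proj1_projective]
    by (simp_all add: is_module_def is_shifted_def)
  then show "(kclass obj_S, kclass obj_P_shift) \<in> CSES kronecker_algebra"
    "(kclass obj_S_shift, kclass obj_P_shift) \<in> CSES kronecker_algebra"
    "(kclass obj_S, kclass obj_P) \<in> CSES kronecker_algebra"
    unfolding CSES_def by blast+
qed

declare One_nat_def [simp del]

section \<open>Words in the mutations\<close>

definition alternating :: "nat list \<Rightarrow> bool" where
  "alternating w \<longleftrightarrow> set w \<subseteq> {1, 2} \<and> distinct_adj w"

lemma alternating_appendD: "alternating (v @ w) \<Longrightarrow> alternating v \<and> alternating w"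
  by (auto simp: alternating_def distinct_adj_append_iff)

lemma alternating_ConsD: "alternating (i # w) \<Longrightarrow> alternating w \<and> (i = 1 \<or> i = 2)"
  by (auto simp: alternating_def distinct_adj_Cons)

text \<open>With two letters available, the first determines the word; \<open>3 - w ! 0\<close> is
  the other letter.\<close>

lemma alternating_nth:
  assumes "alternating w" "i < length w"
  shows "w ! i = (if even i then w ! 0 else 3 - w ! 0)"
  using assms(2)
proof (induction i)
  case (Suc i)
  have "w ! i \<noteq> w ! Suc i" using assms(1) Suc.prems by (auto simp: alternating_def distinct_adj_conv_nth)
  moreover have "w ! i \<in> {1, 2}" "w ! Suc i \<in> {1, 2}" "w ! 0 \<in> {1, 2}"
    using assms(1) Suc.prems nth_mem[of _ w] unfolding alternating_def by (meson Suc_lessD subsetD zero_less_Suc less_trans)+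
  ultimately show ?case using Suc by auto
qed simp

lemma alternating_hd_last:
  assumes w: "alternating w" and ne: "w \<noteq> []"
  shows "hd w = last w \<longleftrightarrow> odd (length w)"
proof -
  have "w ! 0 \<in> {1, 2}" using w ne nth_mem[of 0 w] unfolding alternating_def by blast
  then show ?thesis
    using alternating_nth[OF w, of "length w - 1"] ne by (auto simp: hd_conv_nth last_conv_nth)
qed

text \<open>Words of odd length are palindromes, and reversing one of even length exchanges its
  letters. As reversal is inversion in \<open>G2\<close>, this is what makes reflections
  involutions.\<close>

lemma alternating_rev:
  assumes w: "alternating w"
  shows "rev w = (if odd (length w) then w else map (transpose 1 2) w)"
proof (rule nth_equalityI)
  fix i assume "i < length (rev w)"
  then have i: "i < length w" by simp
  then have w0: "w ! 0 \<in> {1, 2}" using w nth_mem[of 0 w] unfolding alternating_def by fastforce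
  have j: "length w - Suc i < length w" using i by simp
  have par: "even (length w - Suc i) \<longleftrightarrow> odd (length w) = even i" using i by auto
  show "rev w ! i = (if odd (length w) then w else map (transpose 1 2) w) ! i"
    using alternating_nth[OF w i] alternating_nth[OF w j] par w0 i
    by (auto simp: rev_nth transpose_def)
qed simp

section \<open>Mutation\<close>

lemma mutate_fst:
  "mutate A 1 (c, d) = ({X \<in> cobjs A. X \<notin> c \<and> (iso_class A X, d) \<in> OST A}, d)"
  by (simp add: mutate_def)

text \<open>Since \<open>OST\<close> is symmetric, mutation at the second entry is conjugate to
  mutation at the first, so later proofs treat the first entry only.\<close>

lemma mutate_2: "mutate A 2 x = prod.swap (mutate A 1 (prod.swap x))"
proof -
  have "(c, d) \<in> OST A \<longleftrightarrow> (d, c) \<in> OST A" for c d using OST_commute by blast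
  then show ?thesis by (cases x) (simp add: mutate_def)
qed

lemma mutate_swap:
  assumes "i = 1 \<or> i = 2"
  shows "mutate A i (prod.swap x) = prod.swap (mutate A (transpose 1 2 i) x)"
  using assms by (auto simp: mutate_2)

lemma OST_swap: "prod.swap x \<in> OST A \<longleftrightarrow> x \<in> OST A"
  using OST_commute by (cases x) auto

text \<open>The new entry collects the complements of \<open>d\<close> outside \<open>c\<close>; the
  complements of \<open>d\<close> outside that set are those in \<open>c\<close>, which is all of
  \<open>c\<close>.\<close>

lemma mutate_involutive:
  assumes x: "x \<in> OST A" and mx: "mutate A i x \<in> OST A" and i: "i = 1 \<or> i = 2"
  shows "mutate A i (mutate A i x) = x"
proof -
  have 1: "mutate A 1 (mutate A 1 x) = x" if x: "x \<in> OST A" and mx: "mutate A 1 x \<in> OST A" for x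
  proof -
    obtain c d where cd: "x = (c, d)" by force
    let ?c = "{X \<in> cobjs A. X \<notin> c \<and> (iso_class A X, d) \<in> OST A}"
    have "{X \<in> cobjs A. X \<notin> ?c \<and> (iso_class A X, d) \<in> OST A} = c"
      using OST_class_fst[of c d A] x unfolding cd by auto
    then show ?thesis by (simp only: cd mutate_fst)
  qed
  show ?thesis
    using i
  proof
    assume "i = 2"
    then show ?thesis
      using 1[of "prod.swap x"] x mx by (simp add: OST_swap mutate_2)
  qed (use 1 x mx in simp)
qed

text \<open>The new entry is disjoint from the old one, which is nonempty.\<close>

lemma mutate_neq:
  assumes x: "x \<in> OST A" and i: "i = 1 \<or> i = 2"
  shows "mutate A i x \<noteq> x"
proof -
  have 1: "mutate A 1 x \<noteq> x" if "x \<in> OST A" for x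
    using OST_nonempty_fst[of "fst x" "snd x" A] that by (cases x) (auto simp: mutate_fst)
  show ?thesis
    using i
  proof
    assume "i = 2"
    then show ?thesis
      using 1[of "prod.swap x"] x by (metis OST_swap mutate_2 swap_swap)
  qed (use 1 x in simp)
qed

text \<open>Since a mutation leaves the other entry alone, a word whose value is an ordered support
  tau-tilting object passes through such objects only: an entry that is a nonempty set of
  complements and also an isomorphism class must be the class of a complement.\<close>

lemma mutate_mutate_OST:
  assumes ij: "i = 1 \<or> i = 2" "j = 1 \<or> j = 2" "i \<noteq> j" and m: "mutate A i (mutate A j z) \<in> OST A"
  shows "mutate A j z \<in> OST A"
proof -
  have 1: "mutate A 2 z \<in> OST A" if m: "mutate A 1 (mutate A 2 z) \<in> OST A" for z
  proof -
    obtain c d where cd: "z = (c, d)" by force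
    let ?d = "{X \<in> cobjs A. X \<notin> d \<and> (c, iso_class A X) \<in> OST A}"
    have z: "mutate A 2 z = (c, ?d)" by (simp add: mutate_def cd)
    obtain e where e: "(?d, e) \<in> OST A"
      using m OST_commute unfolding z mutate_fst by blast
    then obtain X where X: "X \<in> ?d" using OST_nonempty_fst by blast
    have "iso_class A X = ?d" by (rule OST_class_fst(2)[OF e X])
    then show ?thesis unfolding z using X by auto
  qed
  show ?thesis
    using ij
  proof (elim disjE)
    assume "i = 2" "j = 1"
    then have "mutate A 2 (mutate A 1 z) \<in> OST A" using m by simp
    also have "mutate A 2 (mutate A 1 z) = prod.swap (mutate A 1 (mutate A 2 (prod.swap z)))"
      by (simp add: mutate_2)
    finally have "mutate A 2 (prod.swap z) \<in> OST A" using 1 OST_swap by metis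
    then show ?thesis using \<open>j = 1\<close> by (simp add: OST_swap mutate_2)
  qed (use 1 m in auto)
qed

lemma foldr_mutate_OST:
  assumes "alternating (v @ w)" "x \<in> OST A" "foldr (mutate A) (v @ w) x \<in> OST A"
  shows "foldr (mutate A) w x \<in> OST A"
  using assms(1,3)
proof (induction v)
  case (Cons i v)
  note alt = alternating_ConsD[OF Cons.prems(1)[simplified]]
  have "foldr (mutate A) (v @ w) x \<in> OST A"
  proof (cases "v @ w")
    case Nil then show ?thesis using assms(2) by simp
  next
    case (Cons j u)
    have "i \<noteq> j" "j = 1 \<or> j = 2"
      using Cons.prems(1) Cons alternating_ConsD[of j u] alt by (auto simp: alternating_def)
    then show ?thesis
      using mutate_mutate_OST[of i j A "foldr (mutate A) u x"] Cons.prems(2) alt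
      unfolding Cons append_Cons foldr.simps comp_def by simp
  qed
  then show ?case using Cons.IH alt by simp
qed simp

text \<open>An odd alternating word and the composite of an even one with the transposition are
  conjugate to a single mutation and to the transposition, respectively.\<close>

lemma alternating_no_fixed_point:
  assumes "alternating w" "x \<in> OST A" "foldr (mutate A) w x \<in> OST A"
  shows "(odd (length w) \<longrightarrow> foldr (mutate A) w x \<noteq> x) \<and>
    (even (length w) \<longrightarrow> foldr (mutate A) w x \<noteq> prod.swap x)"
  using assms
proof (induction "length w" arbitrary: w x rule: less_induct)
  case less
  note alt = less.prems(1) and x = less.prems(2) and y = less.prems(3)
  consider "w = []" | i where "w = [i]" | i u j where "w = i # u @ [j]"
    by (metis append_butlast_last_id neq_Nil_conv)
  then show ?case
  proof cases
    case 1
    have "x \<noteq> prod.swap x"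
    proof
      assume "x = prod.swap x"
      then have "x = (fst x, fst x)" by (metis fst_swap prod.collapse)
      then show False using x OST_irrefl[of "fst x" A] by metis
    qed
    then show ?thesis using 1 by simp
  next
    case 2
    then show ?thesis using mutate_neq[OF x] alternating_ConsD[of i "[]"] alt by simp
  next
    case 3
    have i: "i = 1 \<or> i = 2" and j: "j = 1 \<or> j = 2"
      using alt unfolding 3 by (auto simp: alternating_def)
    have u: "alternating u" using alt alternating_appendD[of "[i]" "u @ [j]"] alternating_appendD[of u "[j]"] unfolding 3 by simp
    let ?x = "mutate A j x" and ?y = "foldr (mutate A) w x" and ?z = "foldr (mutate A) (u @ [j]) x"
    have x': "?x \<in> OST A" using foldr_mutate_OST[of "i # u" "[j]" x A] alt x y unfolding 3 by simp
    have z: "?z \<in> OST A" using foldr_mutate_OST[of "[i]" "u @ [j]" x A] alt x y unfolding 3 by simp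
    have zu: "?z = foldr (mutate A) u ?x" by simp
    have "?y = mutate A i ?z" by (simp add: 3)
    \<comment> \<open>The first letter moves to the other side, leaving the inner word
      \<open>u\<close> between the two conjugated points.\<close>
    then have zy: "?z = mutate A i ?y" using mutate_involutive[OF z _ i] y by simp
    have IH: "(odd (length u) \<longrightarrow> ?z \<noteq> ?x) \<and> (even (length u) \<longrightarrow> ?z \<noteq> prod.swap ?x)"
      unfolding zu by (rule less.hyps) (use u x' z zu 3 in auto)
    \<comment> \<open>Equal outer letters conjugate by the same mutation; different ones, in even
      length, are matched by the transposition.\<close>
    have par: "i = j \<longleftrightarrow> odd (length w)" using alternating_hd_last[OF alt] unfolding 3 by simp
    show ?thesis
    proof (intro conjI impI notI)
      assume "odd (length w)" "?y = x"
      then have "?z = ?x" "odd (length u)" using zy par 3 by auto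
      then show False using IH by blast
    next
      assume e: "even (length w)" "?y = prod.swap x"
      then have "j = transpose 1 2 i" using par i j by (auto simp: transpose_def)
      then have "?z = prod.swap ?x" using zy e(2) mutate_swap[OF i] by simp
      moreover have "even (length u)" using e(1) 3 by simp
      ultimately show False using IH by blast
    qed
  qed
qed

text \<open>The reflection formed with the mutation must again be a reduced word before
  \<open>alternating_no_fixed_point\<close> applies, so a letter is cancelled at whichever end
  allows it: a final 1, or an initial 1, which becomes an initial 2 once moved past the
  transposition.\<close>

lemma alternating_not_mutation:
  assumes w: "alternating w" and x: "x \<in> OST A" and mx: "mutate A 1 x \<in> OST A"
  shows "even (length w) \<Longrightarrow> foldr (mutate A) w x \<noteq> mutate A 1 x"
    "odd (length w) \<Longrightarrow> prod.swap (foldr (mutate A) w x) \<noteq> mutate A 1 x"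
proof -
  let ?y = "foldr (mutate A) w x" and ?x = "mutate A 1 x"
  have inv: "mutate A 1 ?x = x" by (rule mutate_involutive[OF x mx]) simp
  have peel: "foldr (mutate A) u x \<in> OST A \<and> foldr (mutate A) u x = mutate A i ?y"
    if "w = i # u" "?y \<in> OST A" for i u
  proof -
    have z: "foldr (mutate A) u x \<in> OST A"
      using foldr_mutate_OST[of "[i]" u x A] w x that by simp
    moreover have "foldr (mutate A) u x = mutate A i ?y"
      using mutate_involutive[OF z, of i] that alternating_ConsD[of i u] w by simp
    ultimately show ?thesis by blast
  qed
  show "?y \<noteq> ?x" if e: "even (length w)"
  proof
    assume y: "?y = ?x"
    show False
    proof (cases w)
      case Nil
      then show False using y mutate_neq[OF x, of 1] by simp
    next
      case (Cons i u)
      have i: "i = 1 \<or> i = 2" and u: "alternating u" using alternating_ConsD[of i u] w Cons by auto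
      show False
        using i
      proof
        assume "i = 1"
        then have "foldr (mutate A) u x = x" "foldr (mutate A) u x \<in> OST A"
          using peel[OF Cons] x unfolding y \<open>i = 1\<close> inv by (simp_all add: mx)
        then show False using alternating_no_fixed_point[OF u x] e Cons by simp
      next
        assume "i = 2"
        \<comment> \<open>An even word starting with 2 ends with 1. Cancelling on the right moves
          the base point to \<open>mutate A 1 x\<close>.\<close>
        then have "last w = 1" using alternating_hd_last[OF w] e Cons w last_in_set[of w] by (auto simp: alternating_def)
        then obtain v where v: "w = v @ [1]" using append_butlast_last_id[of w] Cons by (metis list.distinct(1))
        then have "foldr (mutate A) v ?x = ?x" "alternating v" using y alternating_appendD[of v "[1]"] w by auto
        then show False using alternating_no_fixed_point[of v ?x A] mx e v by simp
      qed
    qed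
  qed
  show "prod.swap ?y \<noteq> ?x" if e: "odd (length w)"
  proof
    assume "prod.swap ?y = ?x"
    then have y: "?y = prod.swap ?x" by (metis swap_swap)
    have yO: "?y \<in> OST A" unfolding y OST_swap by (rule mx)
    obtain i u where iu: "w = i # u" using e by (cases w) auto
    have i: "i = 1 \<or> i = 2" and u: "alternating u" using alternating_ConsD[of i u] w iu by auto
    show False
      using i
    proof
      assume "i = 1"
      then have "last w = 1" using alternating_hd_last[OF w] e iu by simp
      then obtain v where v: "w = v @ [1]" using append_butlast_last_id[of w] iu by (metis list.distinct(1))
      then have "foldr (mutate A) v ?x = prod.swap ?x" "alternating v" using y alternating_appendD[of v "[1]"] w by auto
      then show False using alternating_no_fixed_point[of v ?x A] mx e v yO v by simp
    next
      assume "i = 2"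
      have "foldr (mutate A) u x = prod.swap x"
        using peel[OF iu yO] y inv \<open>i = 2\<close> by (simp add: mutate_2)
      moreover have "foldr (mutate A) u x \<in> OST A" using peel[OF iu yO] by (rule conjunct1)
      ultimately show False using alternating_no_fixed_point[OF u x] e iu by simp
    qed
  qed
qed

section \<open>The group \<open>M2\<close>\<close>

lemma sym_group_2:
  assumes "s \<in> carrier (sym_group 2)"
  shows "s = id \<or> s = transpose 1 2"
proof -
  have "s permutes {1, 2}" using assms by (auto simp: sym_group_def elim!: back_subst[of "\<lambda>A. s permutes A"])
  then show ?thesis by (simp add: permutes_doubleton_iff)
qed

lemma transpose_neq_id: "transpose 1 (2::nat) \<noteq> id"
  by (metis id_apply numeral_eq_one_iff semiring_norm(85) transpose_apply_first)

lemma sym_group_2_inv: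
  assumes "s \<in> carrier (sym_group 2)"
  shows "inv\<^bsub>sym_group 2\<^esub> s = s"
  using group.inv_equality[OF sym_group_is_group _ assms assms] sym_group_2[OF assms]
  by (auto simp: sym_group_mult sym_group_one)

text \<open>A generator either cancels the first letter or is added to it, so word length modulo 2
  is multiplicative.\<close>

lemma length_mu_cons: "even (length (mu_cons i w)) \<longleftrightarrow> odd (length w)"
  by (cases w) auto

lemma length_foldr_mu_cons: "even (length (foldr mu_cons v w)) \<longleftrightarrow> even (length v + length w)"
  by (induction v) (auto simp: length_mu_cons)

text \<open>The generators are involutions, so the reversed word is the inverse.\<close>

lemma foldr_mu_cons_rev: "foldr mu_cons (rev w) w = []"
proof (induction w)
  case (Cons i w)
  then show ?case by simp
qed simp

lemma foldr_mu_cons_Nil: "distinct_adj w \<Longrightarrow> foldr mu_cons w [] = w"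
proof (induction w)
  case (Cons i w)
  then show ?case by (cases w) (auto simp: distinct_adj_Cons)
qed simp

lemma M2_carrier: "(s, w) \<in> carrier M2 \<longleftrightarrow> s \<in> carrier (sym_group 2) \<and> alternating w"
  by (simp add: M2_def G2_def alternating_def)

text \<open>The inverse in the semidirect product disappears because permutations of two letters are
  involutions.\<close>

lemma M2_mult:
  assumes "t \<in> carrier (sym_group 2)"
  shows "(s, v) \<otimes>\<^bsub>M2\<^esub> (t, w) = (s \<circ> t, foldr mu_cons (map t v) w)"
  using sym_group_2_inv[OF assms] by (simp add: M2_def G2_def sym_group_mult)

lemma M2_one: "\<one>\<^bsub>M2\<^esub> = (id, [])"
  by (simp add: M2_def G2_def sym_group_one)

lemma M2_right_one:
  assumes "g \<in> carrier M2"
  shows "g \<otimes>\<^bsub>M2\<^esub> \<one>\<^bsub>M2\<^esub> = g"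
proof -
  obtain s w where g: "g = (s, w)" by force
  have "id \<in> carrier (sym_group 2)" by (simp add: sym_group_def)
  then show ?thesis
    using M2_mult[of id s w "[]"] assms by (simp add: g M2_one M2_carrier alternating_def foldr_mu_cons_Nil)
qed

text \<open>\<open>M2\<close> is the infinite dihedral group; this tells the reflections from the rotations.\<close>

definition reflection :: "(nat \<Rightarrow> nat) \<times> nat list \<Rightarrow> bool" where
  "reflection g \<longleftrightarrow> (fst g = id) = odd (length (snd g))"

text \<open>The sign of the permutation and the parity of the word are homomorphisms to the group of
  order two, and being a reflection is their sum.\<close>

lemma reflection_mult:
  assumes "g \<in> carrier M2" "h \<in> carrier M2"
  shows "reflection (g \<otimes>\<^bsub>M2\<^esub> h) \<longleftrightarrow> reflection g \<noteq> reflection h"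
proof -
  obtain s v t w where gh: "g = (s, v)" "h = (t, w)" by force
  have st: "s \<in> carrier (sym_group 2)" "t \<in> carrier (sym_group 2)" using assms by (simp_all add: gh M2_carrier)
  have "s \<circ> t = id \<longleftrightarrow> (s = id \<longleftrightarrow> t = id)"
    using sym_group_2[OF st(1)] sym_group_2[OF st(2)] transpose_neq_id by auto
  then show ?thesis
    unfolding gh M2_mult[OF st(2)] reflection_def fst_conv snd_conv length_foldr_mu_cons by auto
qed

text \<open>The word part of the square is \<open>map s v\<close> times \<open>v\<close>; for a
  reflection \<open>map s v\<close> is \<open>rev v\<close>, the inverse of
  \<open>v\<close>.\<close>

lemma reflection_square:
  assumes "g \<in> carrier M2" "reflection g"
  shows "g \<otimes>\<^bsub>M2\<^esub> g = \<one>\<^bsub>M2\<^esub>"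
proof -
  obtain s v where g: "g = (s, v)" by force
  have s: "s \<in> carrier (sym_group 2)" and v: "alternating v" using assms(1) by (simp_all add: g M2_carrier)
  have "map s v = rev v" "s \<circ> s = id"
    using sym_group_2[OF s] assms(2) alternating_rev[OF v] transpose_neq_id
    by (auto simp: g reflection_def)
  then show ?thesis unfolding g M2_mult[OF s] M2_one by (simp add: foldr_mu_cons_rev)
qed

text \<open>The square of a reflection is trivial, so \<open>\<phi> 2\<close> is the unit and
  \<open>\<phi>\<close> depends on parity only.\<close>

lemma hom_reflection_periodic:
  assumes \<phi>: "\<phi> \<in> hom B2 M2" and r: "reflection (\<phi> 1)"
  shows "\<phi> n = \<phi> (n mod 2)"
proof -
  have c: "\<phi> n \<in> carrier M2" and m: "\<phi> (a + b) = \<phi> a \<otimes>\<^bsub>M2\<^esub> \<phi> b" for n a b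
    using \<phi> by (auto simp: hom_def)
  have "\<phi> 2 = \<one>\<^bsub>M2\<^esub>" using m[of 1 1] reflection_square[OF c r] by simp
  then have step: "\<phi> (n + 2) = \<phi> n" for n using m[of n 2] M2_right_one[OF c] by simp
  have "\<phi> (2 * k + l) = \<phi> l" for k l
  proof (induction k rule: int_induct[where k = 0])
    case (step1 i)
    then show ?case using step[of "2 * i + l"] by (simp add: algebra_simps)
  next
    case (step2 i)
    then show ?case using step[of "2 * (i - 1) + l"] by (simp add: algebra_simps)
  qed simp
  from this[of "n div 2" "n mod 2"] show ?thesis by simp
qed

text \<open>By \<open>reflection_mult\<close>, multiplying by a rotation does not change the type of
  an element.\<close>

lemma hom_not_reflection:
  assumes \<phi>: "\<phi> \<in> hom B2 M2" and r: "\<not> reflection (\<phi> 1)"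
  shows "\<not> reflection (\<phi> n)"
proof -
  have "reflection (\<phi> (a + 1)) = reflection (\<phi> a)" for a
    using \<phi> reflection_mult[of "\<phi> a" "\<phi> 1"] r by (auto simp: hom_def)
  note step = this
  show ?thesis
  proof (induction n rule: int_induct[where k = 1])
    case (step2 i)
    then show ?case using step[of "i - 1"] by simp
  qed (use r step in auto)
qed

section \<open>Mutations of the objects containing the shifted projective\<close>

text \<open>If \<open>d\<close> has at most two classes of complements, those outside
  \<open>a\<close> form a single class, so here the set produced by \<open>mutate\<close> is an
  isomorphism class.\<close>

lemma complement_class:
  assumes a: "(a, d) \<in> OST A" and c: "c = {X \<in> cobjs A. X \<notin> a \<and> (iso_class A X, d) \<in> OST A}" "c \<noteq> {}"
    and two: "\<And>c. (c, d) \<in> OST A \<Longrightarrow> c = c0 \<or> c = c1"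
  shows "(c, d) \<in> OST A"
proof -
  obtain X where X: "X \<in> cobjs A" "X \<notin> a" "(iso_class A X, d) \<in> OST A" using c by blast
  have Xa: "iso_class A X \<noteq> a" using iso_class_self[OF X(1)] X(2) by blast
  have "c = iso_class A X"
  proof (intro equalityI subsetI)
    fix Y assume "Y \<in> c"
    then have Y: "Y \<in> cobjs A" "Y \<notin> a" "(iso_class A Y, d) \<in> OST A" using c by auto
    have "iso_class A Y \<noteq> a" using iso_class_self[OF Y(1)] Y(2) by blast
    then have "iso_class A Y = iso_class A X" using two[OF Y(3)] two[OF X(3)] two[OF a] Xa by auto
    then show "Y \<in> iso_class A X" using iso_class_self[OF Y(1)] by simp
  next
    fix Y assume Y: "Y \<in> iso_class A X"
    have "Y \<in> cobjs A" "iso_class A Y = iso_class A X" using OST_class_fst[OF X(3) Y] .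
    moreover have "Y \<notin> a" using OST_class_fst(2)[OF a, of Y] Xa calculation by auto
    ultimately show "Y \<in> c" using c X(3) by simp
  qed
  then show ?thesis using X(3) by simp
qed

text \<open>\<open>psi\<close> keeps the second entry, so the first is S or S[1], and S[1] does not
  yield the module S. This pins down the value of \<open>inv_into\<close> at the one sequence where
  it is evaluated.\<close>

lemma OST_psi_S_P_shift:
  assumes T: "T \<in> OST kronecker_algebra"
    and p: "psi kronecker_algebra T = (kclass obj_S, kclass obj_P_shift)"
  shows "T = (kclass obj_S, kclass obj_P_shift)"
proof -
  obtain c where T': "T = (c, kclass obj_P_shift)" using p by (cases T) (simp add: psi_def)
  have "c \<noteq> kclass obj_S_shift"
    using p psi_S_shift_P_shift iso_class_self[OF obj_cobjs(1)] unfolding T' by (metis fst_conv)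
  then show ?thesis using OST_P_shift[of c] T T' by blast
qed

text \<open>The value of \<open>psi\<close> reveals only that the second entry of \<open>y\<close>
  is the class of P[1] and that the first is nonempty. Membership of \<open>y\<close> in
  \<open>OST\<close> is recovered from the last one or two mutations of the word; then
  \<open>y\<close> is the mutation of the starting pair at its first entry.\<close>

lemma word_endpoint:
  assumes w: "alternating w" and par: "(s = id) = even (length w)"
    and y: "y = M2_act_OST kronecker_algebra (s, w) (kclass obj_S, kclass obj_P_shift)"
    and p: "psi kronecker_algebra y = (kclass obj_S_shift, kclass obj_P_shift)"
  shows False
proof -
  let ?K = "kronecker_algebra :: ('a, nat \<times> nat list \<Rightarrow> 'a) module"
  let ?c0 = "iso_class ?K obj_S" and ?c1 = "iso_class ?K obj_S_shift" and ?d = "iso_class ?K obj_P_shift"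
  let ?x = "(?c0, ?d)" and ?z = "foldr (mutate ?K) w (?c0, ?d)"
  have x: "?x \<in> OST ?K" by (rule OST_S_P_shift)
  have y': "y = (if s = id then ?z else prod.swap ?z)" unfolding y by (simp add: M2_act_OST_def)
  obtain c where yc: "y = (c, ?d)" using p by (cases y) (simp add: psi_def)
  have dn: "obj_P_shift \<in> ?d" by (rule iso_class_self[OF obj_cobjs(4)])
  have "?c1 \<noteq> {}" using iso_class_self[OF obj_cobjs(2)] by blast
  \<comment> \<open>An empty first entry would make the first entry of \<open>psi\<close> empty as
    well.\<close>
  then have cn: "c \<noteq> {}" using p unfolding yc psi_def by auto
  have yO: "y \<in> OST ?K"
  proof (cases w)
    case Nil
    then show ?thesis using par x y' by simp
  next
    case (Cons i u)
    have i: "i = 1 \<or> i = 2" using alternating_ConsD[of i u] w Cons by simp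
    define z where "z = (if s = id then foldr (mutate ?K) u ?x else prod.swap (foldr (mutate ?K) u ?x))"
    \<comment> \<open>Pulled through the transposition, the last mutation acts at entry
      \<open>k\<close>.\<close>
    define k where "k = (if s = id then i else transpose 1 2 i)"
    have k: "k = 1 \<or> k = 2" using i by (auto simp: k_def)
    have yz: "y = mutate ?K k z"
    proof (cases "s = id")
      case False
      have "mutate ?K (transpose 1 2 i) (prod.swap v) = prod.swap (mutate ?K i v)" for v
        using mutate_swap[of "transpose 1 2 i" ?K v] i by auto
      then show ?thesis using False by (simp add: y' Cons z_def k_def)
    qed (simp add: y' Cons z_def k_def)
    obtain a b where ab: "z = (a, b)" by force
    show ?thesis
      using k
    proof
      assume k1: "k = 1"
      \<comment> \<open>The last mutation left P[1] alone, so \<open>complement_class\<close>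
        applies once \<open>z\<close> is known to lie in \<open>OST\<close>.\<close>
      have b: "b = ?d" and c: "c = {X \<in> cobjs ?K. X \<notin> a \<and> (iso_class ?K X, ?d) \<in> OST ?K}"
        using yz unfolding yc ab k1 mutate_fst by auto
      have "z \<in> OST ?K"
      proof (cases u)
        case Nil
        then show ?thesis using x OST_commute[OF x] by (simp add: z_def)
      next
        case (Cons j u')
        have j: "j \<noteq> i" "j = 1 \<or> j = 2" using w \<open>w = i # u\<close> Cons by (auto simp: alternating_def)
        define z' where "z' = (if s = id then foldr (mutate ?K) u' ?x else prod.swap (foldr (mutate ?K) u' ?x))"
        \<comment> \<open>Adjacent letters differ, so the mutation before the last one created the
          second entry. That entry contains P[1], which therefore complements
          \<open>a\<close>.\<close>
        have "z = mutate ?K (transpose 1 2 k) z'"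
        proof (cases "s = id")
          case True
          have "transpose 1 2 i = j" using i j by (auto simp: transpose_def)
          then show ?thesis using True by (simp add: Cons z_def z'_def k_def)
        next
          case False
          have "mutate ?K (transpose 1 2 j) (prod.swap v) = prod.swap (mutate ?K j v)" for v
            using mutate_swap[of "transpose 1 2 j" ?K v] j by auto
          moreover have "j = transpose 1 2 i" using i j by (auto simp: transpose_def)
          ultimately show ?thesis using False by (simp add: Cons z_def z'_def k_def)
        qed
        then have "z = mutate ?K 2 z'" using k1 by simp
        then have "?d = {X \<in> cobjs ?K. X \<notin> snd z' \<and> (a, iso_class ?K X) \<in> OST ?K}"
          unfolding ab b by (cases z') (auto simp: mutate_def)
        then show ?thesis unfolding ab b using dn by blast
      qed
      then show ?thesis
        unfolding yc ab b using complement_class[OF _ c cn OST_P_shift] by blast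
    next
      assume "k = 2"
      \<comment> \<open>Here the last mutation created the class of P[1] as a set of complements of
        \<open>c\<close>.\<close>
      then have "?d = {X \<in> cobjs ?K. X \<notin> b \<and> (c, iso_class ?K X) \<in> OST ?K}"
        using yz unfolding yc ab by (simp add: mutate_def)
      then show ?thesis unfolding yc using dn by blast
    qed
  qed
  have "c \<noteq> ?c0" using p kclass_distinct(1) unfolding yc by (auto simp: psi_S_P_shift)
  then have c: "c = ?c1" using OST_P_shift yO unfolding yc by blast
  have c1: "(?c1, ?d) \<in> OST ?K" using yO unfolding yc c .
  \<comment> \<open>That S[1] is a complement of P[1] is inferred from its being reached, through
    \<open>c1\<close>; with S it exhausts the complements.\<close>
  have "{X \<in> cobjs ?K. X \<notin> ?c0 \<and> (iso_class ?K X, ?d) \<in> OST ?K} = ?c1"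
  proof (intro equalityI subsetI)
    fix X assume "X \<in> {X \<in> cobjs ?K. X \<notin> ?c0 \<and> (iso_class ?K X, ?d) \<in> OST ?K}"
    then have X: "X \<in> cobjs ?K" "X \<notin> ?c0" "(iso_class ?K X, ?d) \<in> OST ?K" by auto
    then show "X \<in> ?c1" using OST_P_shift[OF X(3)] iso_class_self[OF X(1)] by auto
  next
    fix X assume "X \<in> ?c1"
    from OST_class_fst[OF c1 this]
    show "X \<in> {X \<in> cobjs ?K. X \<notin> ?c0 \<and> (iso_class ?K X, ?d) \<in> OST ?K}"
      using c1 OST_class_fst(2)[OF x, of X] kclass_distinct(1) by auto
  qed
  then have mx: "mutate ?K 1 ?x = y" unfolding mutate_fst yc c by simp
  show False
    using alternating_not_mutation[OF w x] yO par y' unfolding mx by (auto split: if_splits)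
qed

theorem corollary5p2:
  fixes \<Lambda> :: "('k::field, nat \<times> nat list \<Rightarrow> 'k) module"
  assumes "\<Lambda> = path_algebra kronecker_quiver"
  shows "\<not> (\<exists>\<beta>. transitive_action B2 (CSES \<Lambda>) \<beta> \<and> factors_through_M2 \<Lambda> \<beta>)"
proof
  assume "\<exists>\<beta>. transitive_action B2 (CSES \<Lambda>) \<beta> \<and> factors_through_M2 \<Lambda> \<beta>"
  then obtain \<beta> \<phi> where tr: "transitive_action B2 (CSES \<Lambda>) \<beta>" and \<phi>: "\<phi> \<in> hom B2 M2"
    and \<beta>: "\<And>z S. S \<in> CSES \<Lambda> \<Longrightarrow> \<beta> z S = M2_act_CSES \<Lambda> (\<phi> z) S"
    by (auto simp: factors_through_M2_def)
  let ?S0 = "(iso_class \<Lambda> obj_S, iso_class \<Lambda> obj_P_shift)"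
    and ?S1 = "(iso_class \<Lambda> obj_S_shift, iso_class \<Lambda> obj_P_shift)"
    and ?S2 = "(iso_class \<Lambda> obj_S, iso_class \<Lambda> obj_P)"
  have S: "?S0 \<in> CSES \<Lambda>" "?S1 \<in> CSES \<Lambda>" "?S2 \<in> CSES \<Lambda>"
    unfolding assms by (rule CSES_examples)+
  have reach: "\<exists>n. T = M2_act_CSES \<Lambda> (\<phi> n) ?S0" if "T \<in> CSES \<Lambda>" for T
    using transitive_action.unique_orbit[OF tr S(1) that] \<beta>[OF S(1)] by metis
  show False
  proof (cases "reflection (\<phi> 1)")
    case True
    \<comment> \<open>The action depends on the group element only, and there are just two of
      these.\<close>
    have "T = M2_act_CSES \<Lambda> (\<phi> 0) ?S0 \<or> T = M2_act_CSES \<Lambda> (\<phi> 1) ?S0" if T: "T \<in> CSES \<Lambda>" for T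
    proof -
      obtain n where "T = M2_act_CSES \<Lambda> (\<phi> (n mod 2)) ?S0"
        using reach[OF T] hom_reflection_periodic[OF \<phi> True] by metis
      then show ?thesis using mod2_eq_if[of n] by auto
    qed
    note two = this
    have "?S0 \<noteq> ?S1" "?S0 \<noteq> ?S2" "?S1 \<noteq> ?S2"
      unfolding assms by (simp_all add: kclass_distinct kclass_distinct[symmetric])
    then show False using two[OF S(1)] two[OF S(2)] two[OF S(3)] by metis
  next
    case False
    obtain n where n: "?S1 = M2_act_CSES \<Lambda> (\<phi> n) ?S0" using reach[OF S(2)] by blast
    obtain s w where sw: "\<phi> n = (s, w)" by force
    have "\<phi> n \<in> carrier M2" using \<phi> by (auto simp: hom_def)
    then have w: "alternating w" by (simp add: sw M2_carrier)
    have par: "(s = id) = even (length w)"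
      using hom_not_reflection[OF \<phi> False, of n] by (auto simp: sw reflection_def)
    \<comment> \<open>\<open>inv_into\<close> returns a genuine preimage only for a point of the
      image.\<close>
    have im: "?S0 \<in> psi \<Lambda> ` OST \<Lambda>"
      unfolding assms using psi_S_P_shift OST_S_P_shift by (metis image_eqI)
    have "inv_into (OST \<Lambda>) (psi \<Lambda>) ?S0 = ?S0"
      using OST_psi_S_P_shift inv_into_into[OF im] f_inv_into_f[OF im] unfolding assms by blast
    then have "psi \<Lambda> (M2_act_OST \<Lambda> (s, w) ?S0) = ?S1" using n by (simp add: M2_act_CSES_def sw)
    then show False using word_endpoint[OF w par refl] unfolding assms by blast
  qed
qed

end
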